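(* Let $G=A_n$ with $n>4$ and let $g\in G$. Let $\omega(G)$ be the set of element orders of $G$ and suppose that $2|g|\notin\omega(G)$ and $3|g|\notin\omega(G)$, where $|g|$ is the order of $g$. If $n\ne 7$, then $g$ is vanishing.
   Context: An element $g$ of a finite group $G$ is vanishing if $\chi(g)=0$ for some irreducible complex character $\chi$ of $G$. *)

theory Defs
  imports "HOL-Algebra.Sym_Groups" "HOL-Algebra.Multiplicative_Group"
    "Jordan_Normal_Form.VS_Connect"
begin

abbreviation GL :: "nat \<Rightarrow> complex mat monoid"
  where "GL d \<equiv> units_of (ring_mat TYPE(complex) d ())"

definition mat_trace :: "'a :: comm_monoid_add mat \<Rightarrow> 'a"
  where "mat_trace A = (\<Sum>i<dim_row A. A $$ (i, i))"

definition invariant_subspace ::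
    "('g, 'm) monoid_scheme \<Rightarrow> nat \<Rightarrow> ('g \<Rightarrow> complex mat) \<Rightarrow> complex vec set \<Rightarrow> bool"
  where "invariant_subspace G d \<rho> W \<longleftrightarrow>
    VectorSpace.subspace class_ring W (module_vec TYPE(complex) d) \<and>
    (\<forall>x\<in>carrier G. \<forall>w\<in>W. \<rho> x *\<^sub>v w \<in> W)"

text \<open>The zero-dimensional representation does not count as irreducible.\<close>

definition irreducible_rep ::
    "('g, 'm) monoid_scheme \<Rightarrow> nat \<Rightarrow> ('g \<Rightarrow> complex mat) \<Rightarrow> bool"
  where "irreducible_rep G d \<rho> \<longleftrightarrow>
    \<rho> \<in> hom G (GL d) \<and> d > 0 \<and>
    (\<forall>W. invariant_subspace G d \<rho> W \<longrightarrow> W = {0\<^sub>v d} \<or> W = carrier_vec d)"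

text \<open>Characters are functions on the carrier only, hence \<open>restrict\<close>.\<close>

definition irreducible_characters :: "('g, 'm) monoid_scheme \<Rightarrow> ('g \<Rightarrow> complex) set"
  where "irreducible_characters G =
    {restrict (\<lambda>x. mat_trace (\<rho> x)) (carrier G) | d \<rho>. irreducible_rep G d \<rho>}"

definition vanishing :: "('g, 'm) monoid_scheme \<Rightarrow> 'g \<Rightarrow> bool"
  where "vanishing G g \<longleftrightarrow>
    g \<in> carrier G \<and> (\<exists>\<chi>\<in>irreducible_characters G. \<chi> g = 0)"

definition element_orders :: "('g, 'm) monoid_scheme \<Rightarrow> nat set"
  where "element_orders G = group.ord G ` carrier G"

end

(*
  Write m for the order of g. By Frobenius' formula, a set of k beads (first column hook lengths of
  a partition of n) gives a signed sum of permutation characters; if one of the beads is at least 2k,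
  the partition is not self-conjugate and the restriction of this virtual character to A_n has norm 1,
  hence is irreducible up to sign. Removing a cycle of length L from a permutation moves a bead down
  by L. So the character of an L-core, where no bead can move down, vanishes on every element with an
  L-cycle.

  If n exceeded the sum of the prime powers exactly dividing 2m by at least 2, then A_n would contain
  an element of order 2m. The other case leaves n small compared with the length L of the longest cycle
  of g, and for L > 3 there is an L-core of n of the required shape, except for L = 4 and n = 10,
  where a 3-core does it. If L < 4, then n < 9, and g has exactly one fixed point, whence the
  character counting fixed points minus one vanishes, or n = 6 and a 3-core works, or g is a 3-cycle
  in A_5.
*)

theory Submission
  imports Defs "Jordan_Normal_Form.Spectral_Radius"
begin

section \<open>Characters of finite groups\<close>

text \<open>A representation enters only through its trace. Traces add up along any invariant
  subspace, so permutation characters are integral combinations of irreducible characters, and an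
  integral combination of norm 1 is a single one up to sign. All the work thus lies in inner
  products. Over S_n they count integer matrices with given margins, and the alternating sum over
  two determinants is the coefficient form of Cauchy's identity for det (1 / (1 - x_i y_j)); this
  makes the virtual characters orthonormal. Over A_n the sign-twisted inner product has to vanish
  too. Hence the bead of size at least 2k: the colour class that it produces has more points than
  there are colours, so that a transposition cancels all terms.

  On the arithmetic side two quadratic bounds compete. The prime powers above 3 that may divide the
  order sum to about L^2 / 6 at most, while beads on one or two levels give cores of all n up to
  about L^2 / 4. Only small L need a table.\<close>

definition mat_rep :: "('g, 'm) monoid_scheme \<Rightarrow> nat \<Rightarrow> ('g \<Rightarrow> complex mat) \<Rightarrow> bool"
  where "mat_rep G d \<rho> \<longleftrightarrow>
    (\<forall>x\<in>carrier G. \<rho> x \<in> carrier_mat d d) \<and>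
    (\<forall>x\<in>carrier G. \<forall>y\<in>carrier G. \<rho> (x \<otimes>\<^bsub>G\<^esub> y) = \<rho> x * \<rho> y) \<and> \<rho> \<one>\<^bsub>G\<^esub> = 1\<^sub>m d"

lemma carrier_GL: "A \<in> carrier (GL d) \<longleftrightarrow>
    A \<in> carrier_mat d d \<and> (\<exists>B\<in>carrier_mat d d. B * A = 1\<^sub>m d \<and> A * B = 1\<^sub>m d)"
  by (auto simp: units_of_def Units_def ring_mat_simps)

text \<open>Invertibility is automatic, since \<open>\<rho> (inv x)\<close> inverts
  \<open>\<rho> x\<close>. Later constructions therefore only have to check products and the
  identity.\<close>

lemma hom_GL_iff_mat_rep:
  assumes "group G"
  shows "\<rho> \<in> hom G (GL d) \<longleftrightarrow> mat_rep G d \<rho>"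
proof
  interpret G: group G by fact
  assume h: "\<rho> \<in> hom G (GL d)"
  interpret R: ring "ring_mat TYPE(complex) d ()" by (rule ring_mat)
  have "\<rho> \<one>\<^bsub>G\<^esub> = \<one>\<^bsub>GL d\<^esub>"
    by (rule hom_one[OF h G.is_group R.units_group])
  then show "mat_rep G d \<rho>"
    using h unfolding mat_rep_def hom_def
    by (auto simp: carrier_GL Pi_iff) (auto simp: units_of_def ring_mat_simps)
next
  interpret G: group G by fact
  assume r: "mat_rep G d \<rho>"
  show "\<rho> \<in> hom G (GL d)"
  proof (rule homI)
    fix x assume x: "x \<in> carrier G"
    then have "\<rho> (inv\<^bsub>G\<^esub> x) * \<rho> x = 1\<^sub>m d" "\<rho> x * \<rho> (inv\<^bsub>G\<^esub> x) = 1\<^sub>m d"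
      using r unfolding mat_rep_def by (metis G.inv_closed G.l_inv, metis G.inv_closed G.r_inv)
    then show "\<rho> x \<in> carrier (GL d)"
      using r x by (auto simp: carrier_GL mat_rep_def)
  next
    fix x y assume "x \<in> carrier G" "y \<in> carrier G"
    then show "\<rho> (x \<otimes>\<^bsub>G\<^esub> y) = \<rho> x \<otimes>\<^bsub>GL d\<^esub> \<rho> y"
      using r by (auto simp: units_of_def ring_mat_simps mat_rep_def)
  qed
qed

section \<open>Subspaces and adapted bases\<close>

lemma subspace_vec_iff:
  "VectorSpace.subspace class_ring W (module_vec TYPE(complex) d) \<longleftrightarrow>
    W \<subseteq> carrier_vec d \<and> 0\<^sub>v d \<in> W \<and> (\<forall>v\<in>W. \<forall>w\<in>W. v + w \<in> W) \<and> (\<forall>c. \<forall>v\<in>W. c \<cdot>\<^sub>v v \<in> W)"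
    (is "_ = ?R")
proof
  interpret V: vec_space "TYPE(complex)" d .
  assume "VectorSpace.subspace class_ring W (module_vec TYPE(complex) d)"
  then have s: "submodule class_ring W (module_vec TYPE(complex) d)"
    by (simp add: subspace_def)
  show ?R
    using submodule.subset[OF s] submodule.zero_closed[OF s] submodule.m_closed[OF s]
      submodule.smult_closed[OF s]
    by (auto simp: module_vec_simps)
next
  interpret V: vec_space "TYPE(complex)" d .
  assume R: ?R
  have "submodule class_ring W (module_vec TYPE(complex) d)"
    using R vec_module by (auto simp: submodule_def module_vec_simps)
  then show "VectorSpace.subspace class_ring W (module_vec TYPE(complex) d)"
    using vec_vs by (auto simp: subspace_def)
qed

lemma mat_trace_mult_comm:
  fixes A B :: "'a :: comm_semiring_1 mat"
  assumes "A \<in> carrier_mat n m" "B \<in> carrier_mat m n"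
  shows "mat_trace (A * B) = mat_trace (B * A)"
proof -
  have "mat_trace (A * B) = (\<Sum>i<n. \<Sum>j<m. A $$ (i, j) * B $$ (j, i))"
    using assms by (auto simp: mat_trace_def scalar_prod_def atLeast0LessThan intro!: sum.cong)
  also have "\<dots> = (\<Sum>j<m. \<Sum>i<n. B $$ (j, i) * A $$ (i, j))"
    by (subst sum.swap) (simp add: mult.commute)
  also have "\<dots> = mat_trace (B * A)"
    using assms by (auto simp: mat_trace_def scalar_prod_def atLeast0LessThan intro!: sum.cong)
  finally show ?thesis .
qed

lemma mat_trace_add:
  assumes "A \<in> carrier_mat n n" "B \<in> carrier_mat n n"
  shows "mat_trace (A + B) = mat_trace A + mat_trace B"
  using assms by (auto simp: mat_trace_def sum.distrib[symmetric] intro!: sum.cong)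


text \<open>The columns of \<open>P\<close> are a basis of \<open>W\<close> extended to a basis of
  the whole space; in these coordinates \<open>W\<close> is spanned by the first \<open>r\<close>
  unit vectors.\<close>

lemma subspace_basis_matrix:
  assumes W: "VectorSpace.subspace class_ring W (module_vec TYPE(complex) d)"
  obtains r P Q where "r \<le> d" "P \<in> carrier_mat d d" "Q \<in> carrier_mat d d" "P * Q = 1\<^sub>m d" "Q * P = 1\<^sub>m d"
    "W = {P *\<^sub>v v |v. v \<in> carrier_vec d \<and> (\<forall>i\<in>{r..<d}. v $ i = 0)}"
proof -
  interpret V: vec_space "TYPE(complex)" d .
  have bound: "finite S \<and> card S \<le> d" if "S \<subseteq> carrier_vec d" "V.lin_indpt S" for S
    using V.li_le_dim[OF V.fin_dim, of S] that by (simp add: V.dim_is_n)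
  have Wc: "W \<subseteq> carrier_vec d" using W unfolding subspace_vec_iff by simp
  have e: "V.lin_indpt {}" by (auto simp: V.lin_dep_def)
  obtain A where Af: "finite A" and Am: "maximal A (\<lambda>S. S \<subseteq> W \<and> V.lin_indpt S)"
    using maximal_exists[of "\<lambda>S. S \<subseteq> W \<and> V.lin_indpt S" d "{}"] bound Wc e by blast
  have AW: "A \<subseteq> W" and Ali: "V.lin_indpt A" using Am by (auto simp: maximal_def)
  have Ac: "A \<subseteq> carrier_vec d" using AW Wc by auto
  have sub: "LinearCombinations.submodule class_ring W V.V"
    using W by (simp add: subspace_def)
  have spanA: "V.span A = W"
  proof
    show "V.span A \<subseteq> W" using V.span_is_subset[OF AW sub] .
    show "W \<subseteq> V.span A"
    proof
      fix w assume w: "w \<in> W"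
      show "w \<in> V.span A"
      proof (rule ccontr)
        assume n: "w \<notin> V.span A"
        have wA: "w \<notin> A" using n V.in_own_span[of A] Ac by auto
        have "V.lin_indpt (A \<union> {w})"
          using V.lin_dep_iff_in_span[of A w] Ac Ali w Wc wA n by auto
        then show False using Am w wA AW by (auto simp: maximal_def)
      qed
    qed
  qed
  obtain B where Bf: "finite B" and Bm: "maximal B (\<lambda>S. A \<subseteq> S \<and> S \<subseteq> carrier_vec d \<and> V.lin_indpt S)"
    using maximal_exists[of "\<lambda>S. A \<subseteq> S \<and> S \<subseteq> carrier_vec d \<and> V.lin_indpt S" d A] bound Ac Ali by blast
  have AB: "A \<subseteq> B" and Bc: "B \<subseteq> carrier_vec d" and Bli: "V.lin_indpt B"
    using Bm by (auto simp: maximal_def)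
  have Bmax: "\<forall>S. B \<subseteq> S \<and> A \<subseteq> S \<and> S \<subseteq> carrier_vec d \<and> V.lin_indpt S \<longrightarrow> S = B"
    using Bm unfolding maximal_def by simp
  have Bmax': "S = B" if "B \<subseteq> S" "S \<subseteq> carrier_vec d" "V.lin_indpt S" for S
    using Bmax that AB by (meson subset_trans)
  have "maximal B (\<lambda>S. S \<subseteq> carrier_vec d \<and> V.lin_indpt S)"
    unfolding maximal_def using Bmax' Bc Bli by (simp add: module_vec_simps)
  then have "V.basis B" by (rule V.max_li_is_basis)
  then have cB: "card B = d" using V.dim_basis[of B] Bf V.dim_is_n by simp
  obtain as where as: "set as = A" "distinct as" using finite_distinct_list[OF Af] by blast
  obtain cs where cs: "set cs = B - A" "distinct cs" using finite_distinct_list[of "B - A"] Bf by blast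
  define bs where "bs = as @ cs"
  have bs: "set bs = B" "distinct bs" using as cs AB by (auto simp: bs_def)
  have lb: "length bs = d" using bs cB distinct_card by metis
  define r where "r = length as"
  have rd: "r \<le> d" using lb by (auto simp: r_def bs_def)
  have bc: "bs ! i \<in> carrier_vec d" if "i < d" for i
    using that bs lb Bc nth_mem by blast
  define P where "P = mat_of_cols d bs"
  have P: "P \<in> carrier_mat d d" using lb by (auto simp: P_def)
  have Pk: "(P *\<^sub>v v) $ k = (\<Sum>i<d. (bs ! i) $ k * v $ i)" if "v \<in> carrier_vec d" "k < d" for v k
    using that lb by (auto simp: P_def scalar_prod_def mat_of_cols_def row_def atLeast0LessThan intro!: sum.cong)
  have det: "det P \<noteq> 0"
  proof
    assume "det P = 0"
    then obtain v where v: "v \<in> carrier_vec d" "v \<noteq> 0\<^sub>v d" "P *\<^sub>v v = 0\<^sub>v d"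
      using det_0_iff_vec_prod_zero_field[OF P] by blast
    obtain j where j: "j < d" "v $ j \<noteq> 0"
      using v(1,2) by (metis carrier_vecD eq_vecI index_zero_vec)
    define f where "f x = v $ (the_inv_into {..<d} ((!) bs) x)" for x
    have inj: "inj_on ((!) bs) {..<d}" using bs lb by (auto simp: inj_on_nth)
    have fv: "f (bs ! i) = v $ i" if "i < d" for i
      using that the_inv_into_f_f[OF inj] by (simp add: f_def)
    have "V.lincomb f B = 0\<^sub>v d"
    proof (rule eq_vecI)
      show "dim_vec (V.lincomb f B) = dim_vec (0\<^sub>v d)"
        using V.lincomb_dim[OF Bf Bc] by simp
      fix k assume k: "k < dim_vec (0\<^sub>v d :: complex vec)"
      have "bij_betw ((!) bs) {..<d} B" using bs lb by (auto intro: bij_betw_nth)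
      then have "(\<Sum>x\<in>B. f x * x $ k) = (\<Sum>i<d. f (bs ! i) * (bs ! i) $ k)"
        by (rule sum.reindex_bij_betw[symmetric])
      also have "\<dots> = (P *\<^sub>v v) $ k"
        using Pk[OF v(1), of k] k fv by (simp add: mult.commute)
      finally show "V.lincomb f B $ k = 0\<^sub>v d $ k"
        using V.lincomb_index[of k B f] k Bc v by simp
    qed
    then have "V.lin_dep B"
      using Bf bs lb j fv nth_mem[of j bs] unfolding V.lin_dep_def
      by (intro exI[of _ B] exI[of _ f] exI[of _ "bs ! j"]) auto
    then show False using Bli by simp
  qed
  then obtain Q where Q: "Q \<in> carrier_mat d d" "P * Q = 1\<^sub>m d" "Q * P = 1\<^sub>m d"
    using det_non_zero_imp_unit[OF P det] by (auto simp: Units_def ring_mat_simps)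
  have asn: "bs ! i = as ! i" if "i < r" for i using that by (simp add: bs_def r_def nth_append)
  have bij: "bij_betw ((!) as) {..<r} A" using as by (auto simp: r_def intro: bij_betw_nth)
  have key: "P *\<^sub>v v = V.lincomb f A"
    if v: "v \<in> carrier_vec d" "\<forall>i\<in>{r..<d}. v $ i = 0" and f: "\<And>i. i < r \<Longrightarrow> f (as ! i) = v $ i" for v f
  proof (rule eq_vecI)
    show "dim_vec (P *\<^sub>v v) = dim_vec (V.lincomb f A)"
      using V.lincomb_dim[OF Af Ac] P by simp
    fix k assume "k < dim_vec (V.lincomb f A)"
    then have k: "k < d" using V.lincomb_dim[OF Af Ac] by simp
    have "(\<Sum>i<d. (bs ! i) $ k * v $ i) = (\<Sum>i<r. (bs ! i) $ k * v $ i)"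
      using rd v by (intro sum.mono_neutral_right) auto
    also have "\<dots> = (\<Sum>i<r. f (as ! i) * (as ! i) $ k)"
      using f asn by (auto simp: mult.commute intro!: sum.cong)
    also have "\<dots> = (\<Sum>x\<in>A. f x * x $ k)"
      using sum.reindex_bij_betw[OF bij] .
    finally show "(P *\<^sub>v v) $ k = V.lincomb f A $ k"
      using Pk[OF v(1) k] V.lincomb_index[of k A f] k Ac by simp
  qed
  have "W = {P *\<^sub>v v |v. v \<in> carrier_vec d \<and> (\<forall>i\<in>{r..<d}. v $ i = 0)}" (is "_ = ?R")
  proof
    show "W \<subseteq> ?R"
    proof
      fix w assume "w \<in> W"
      then obtain a where a: "w = V.lincomb a A"
        using V.finite_in_span[OF Af, of w] Ac spanA by auto
      let ?v = "vec d (\<lambda>i. if i < r then a (as ! i) else 0)"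
      have "P *\<^sub>v ?v = w" using rd unfolding a by (intro key) auto
      then show "w \<in> ?R" by (auto intro!: exI[of _ ?v])
    qed
    show "?R \<subseteq> W"
    proof
      fix w assume "w \<in> ?R"
      then obtain v where v: "w = P *\<^sub>v v" "v \<in> carrier_vec d" "\<forall>i\<in>{r..<d}. v $ i = 0" by auto
      define f where "f x = v $ (the_inv_into {..<r} ((!) as) x)" for x
      have "f (as ! i) = v $ i" if "i < r" for i
        using that the_inv_into_f_f[of "(!) as" "{..<r}" i] bij by (simp add: f_def bij_betw_def)
      then have "w = V.lincomb f A" using key v by auto
      then show "w \<in> W" using Af spanA by (auto simp: V.span_def)
    qed
  qed
  then show thesis using that[OF rd P Q] by blast
qed

text \<open>\<open>J\<close> and \<open>K\<close> are the inclusion of \<open>W\<close> and a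
  projection onto it, \<open>J'\<close> and \<open>K'\<close> the same for a complement that need
  not be invariant: the column blocks of the adapted basis matrix and the row blocks of its inverse.
  \<open>K'\<close> can equally be read as the projection to the quotient by
  \<open>W\<close>.\<close>

lemma subspace_split:
  assumes W: "VectorSpace.subspace class_ring W (module_vec TYPE(complex) d)"
  obtains r J K J' K' where "r \<le> d" "J \<in> carrier_mat d r" "K \<in> carrier_mat r d"
    "J' \<in> carrier_mat d (d - r)" "K' \<in> carrier_mat (d - r) d"
    "K * J = 1\<^sub>m r" "K' * J' = 1\<^sub>m (d - r)" "K' * J = 0\<^sub>m (d - r) r" "J * K + J' * K' = 1\<^sub>m d"
    "W = {J *\<^sub>v v |v. v \<in> carrier_vec r}"
proof -
  obtain r P Q where r: "r \<le> d" and P: "P \<in> carrier_mat d d" and Q: "Q \<in> carrier_mat d d"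
    and PQ: "P * Q = 1\<^sub>m d" and QP: "Q * P = 1\<^sub>m d"
    and W: "W = {P *\<^sub>v v |v. v \<in> carrier_vec d \<and> (\<forall>i\<in>{r..<d}. v $ i = 0)}"
    using subspace_basis_matrix[OF assms] .
  have QPij: "(\<Sum>l<d. Q $$ (i, l) * P $$ (l, j)) = (if i = j then 1 else 0)" if "i < d" "j < d" for i j
    using arg_cong[OF QP, of "\<lambda>M. M $$ (i, j)"] that P Q by (simp add: scalar_prod_def atLeast0LessThan)
  have PQij: "(\<Sum>l<d. P $$ (i, l) * Q $$ (l, j)) = (if i = j then 1 else 0)" if "i < d" "j < d" for i j
    using arg_cong[OF PQ, of "\<lambda>M. M $$ (i, j)"] that P Q by (simp add: scalar_prod_def atLeast0LessThan)
  have split: "(\<Sum>l<r. h l) + (\<Sum>l<d - r. h (r + l)) = (\<Sum>l<d. h l)" for h :: "nat \<Rightarrow> complex"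
  proof -
    have "(\<Sum>l<d. h l) = (\<Sum>l\<in>{..<r}. h l) + (\<Sum>l\<in>{r..<d}. h l)"
      using r by (metis sum.atLeastLessThan_concat atLeast0LessThan le0)
    also have "(\<Sum>l\<in>{r..<d}. h l) = (\<Sum>l<d - r. h (r + l))"
      using sum.shift_bounds_nat_ivl[of h 0 r "d - r"] r by (simp add: atLeast0LessThan add.commute)
    finally show ?thesis by simp
  qed
  let ?J = "mat d r (\<lambda>(i, j). P $$ (i, j))" and ?K = "mat r d (\<lambda>(i, j). Q $$ (i, j))"
  let ?J' = "mat d (d - r) (\<lambda>(i, j). P $$ (i, r + j))" and ?K' = "mat (d - r) d (\<lambda>(i, j). Q $$ (r + i, j))"
  have "?J * ?K + ?J' * ?K' = 1\<^sub>m d"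
  proof (rule eq_matI)
    fix i j assume "i < dim_row (1\<^sub>m d :: complex mat)" "j < dim_col (1\<^sub>m d :: complex mat)"
    then show "(?J * ?K + ?J' * ?K') $$ (i, j) = 1\<^sub>m d $$ (i, j)"
      using split[of "\<lambda>l. P $$ (i, l) * Q $$ (l, j)"] PQij[of i j]
      by (simp add: scalar_prod_def atLeast0LessThan)
  qed auto
  moreover have "W = {?J *\<^sub>v v |v. v \<in> carrier_vec r}" (is "_ = ?R")
  proof
    have ext: "P *\<^sub>v v = ?J *\<^sub>v u"
      if v: "v \<in> carrier_vec d" "\<forall>i\<in>{r..<d}. v $ i = 0" and u: "u \<in> carrier_vec r" "\<forall>i<r. u $ i = v $ i" for u v
    proof (rule eq_vecI)
      fix k assume "k < dim_vec (?J *\<^sub>v u)"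
      then have k: "k < d" by simp
      have "(\<Sum>l<d. P $$ (k, l) * v $ l) = (\<Sum>l<r. P $$ (k, l) * v $ l)"
        using r v by (intro sum.mono_neutral_right) auto
      then show "(P *\<^sub>v v) $ k = (?J *\<^sub>v u) $ k"
        using k P v u by (simp add: scalar_prod_def atLeast0LessThan)
    qed (use P in auto)
    show "W \<subseteq> ?R"
    proof
      fix w assume "w \<in> W"
      then obtain v where v: "w = P *\<^sub>v v" "v \<in> carrier_vec d" "\<forall>i\<in>{r..<d}. v $ i = 0"
        using W by auto
      have "w = ?J *\<^sub>v vec r (\<lambda>i. v $ i)" using v ext[of v "vec r (\<lambda>i. v $ i)"] by auto
      then show "w \<in> ?R" by auto
    qed
    show "?R \<subseteq> W"
    proof
      fix w assume "w \<in> ?R"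
      then obtain u where u: "w = ?J *\<^sub>v u" "u \<in> carrier_vec r" by auto
      let ?v = "vec d (\<lambda>i. if i < r then u $ i else 0)"
      have "P *\<^sub>v ?v = w" unfolding u(1) using u(2) r by (intro ext) auto
      then show "w \<in> W" using W by (auto intro!: exI[of _ ?v])
    qed
  qed
  ultimately show thesis
    using r P Q QPij
    by (intro that[of r ?J ?K ?J' ?K']) (auto intro!: eq_matI simp: scalar_prod_def atLeast0LessThan)
qed

section \<open>Schur's lemma\<close>

lemma index_mult_mat_sum:
  assumes "A \<in> carrier_mat n m" "B \<in> carrier_mat m p" "i < n" "j < p"
  shows "(A * B) $$ (i, j) = (\<Sum>k<m. A $$ (i, k) * B $$ (k, j))"
  using assms by (simp add: scalar_prod_def atLeast0LessThan)

lemma irreducible_rep_iff: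
  assumes "group G"
  shows "irreducible_rep G d \<rho> \<longleftrightarrow> mat_rep G d \<rho> \<and> d > 0 \<and>
    (\<forall>W. invariant_subspace G d \<rho> W \<longrightarrow> W = {0\<^sub>v d} \<or> W = carrier_vec d)"
  using hom_GL_iff_mat_rep[OF assms] by (simp add: irreducible_rep_def)

text \<open>The kernel of an intertwiner is invariant under \<open>\<sigma>\<close>, so a single
  nonzero vector in it makes it the whole space.\<close>

lemma intertwiner_kernel:
  assumes G: "group G" and \<rho>: "mat_rep G d \<rho>" and \<sigma>: "irreducible_rep G e \<sigma>"
    and T: "T \<in> carrier_mat d e" and comm: "\<And>y. y \<in> carrier G \<Longrightarrow> \<rho> y * T = T * \<sigma> y"
    and v: "v \<in> carrier_vec e" "v \<noteq> 0\<^sub>v e" "T *\<^sub>v v = 0\<^sub>v d"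
  shows "T = 0\<^sub>m d e"
proof -
  have s: "mat_rep G e \<sigma>" using \<sigma> irreducible_rep_iff[OF G] by blast
  define W where "W = {v \<in> carrier_vec e. T *\<^sub>v v = 0\<^sub>v d}"
  have "invariant_subspace G e \<sigma> W"
    unfolding invariant_subspace_def subspace_vec_iff
  proof (intro conjI ballI allI)
    show "W \<subseteq> carrier_vec e" by (auto simp: W_def)
    show "0\<^sub>v e \<in> W" using T by (auto simp: W_def)
    show "v + w \<in> W" if "v \<in> W" "w \<in> W" for v w
      using that T by (auto simp: W_def mult_add_distrib_mat_vec[of _ d e])
    show "c \<cdot>\<^sub>v v \<in> W" if "v \<in> W" for c v
      using that T by (auto simp: W_def mult_mat_vec[of _ d e])
    show "\<sigma> x *\<^sub>v w \<in> W" if x: "x \<in> carrier G" and w: "w \<in> W" for x w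
    proof -
      have sx: "\<sigma> x \<in> carrier_mat e e" and rx: "\<rho> x \<in> carrier_mat d d"
        using s \<rho> x by (auto simp: mat_rep_def)
      have "T *\<^sub>v (\<sigma> x *\<^sub>v w) = (T * \<sigma> x) *\<^sub>v w"
        using T sx w by (auto simp: W_def)
      also have "\<dots> = \<rho> x *\<^sub>v (T *\<^sub>v w)"
        using w assoc_mult_mat_vec[OF rx T, of w] comm[OF x] by (simp add: W_def)
      also have "\<dots> = 0\<^sub>v d" using w rx by (auto simp: W_def)
      finally show ?thesis using sx w by (auto simp: W_def)
    qed
  qed
  then have "W = {0\<^sub>v e} \<or> W = carrier_vec e" using \<sigma> by (auto simp: irreducible_rep_def)
  moreover have "v \<in> W" using v by (auto simp: W_def)
  ultimately have all: "T *\<^sub>v u = 0\<^sub>v d" if "u \<in> carrier_vec e" for u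
    using that v by (auto simp: W_def)
  show ?thesis
  proof (rule eq_matI)
    fix i j assume "i < dim_row (0\<^sub>m d e :: complex mat)" "j < dim_col (0\<^sub>m d e :: complex mat)"
    then have ij: "i < d" "j < e" by auto
    have "T $$ (i, j) = (T *\<^sub>v unit_vec e j) $ i" using T ij by (auto simp: scalar_prod_right_unit)
    then show "T $$ (i, j) = 0\<^sub>m d e $$ (i, j)" using all[of "unit_vec e j"] ij by auto
  qed (use T in auto)
qed

text \<open>The image of an intertwiner is invariant under \<open>\<rho>\<close>; being nonzero, it
  is everything.\<close>

lemma intertwiner_image:
  assumes G: "group G" and \<rho>: "irreducible_rep G d \<rho>" and \<sigma>: "mat_rep G e \<sigma>"
    and T: "T \<in> carrier_mat d e" and comm: "\<And>y. y \<in> carrier G \<Longrightarrow> \<rho> y * T = T * \<sigma> y"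
    and nz: "T \<noteq> 0\<^sub>m d e" and u: "u \<in> carrier_vec d"
  shows "\<exists>v\<in>carrier_vec e. T *\<^sub>v v = u"
proof -
  have r: "mat_rep G d \<rho>" using \<rho> irreducible_rep_iff[OF G] by blast
  define W where "W = {T *\<^sub>v v |v. v \<in> carrier_vec e}"
  have "invariant_subspace G d \<rho> W"
    unfolding invariant_subspace_def subspace_vec_iff
  proof (intro conjI ballI allI)
    show "W \<subseteq> carrier_vec d" using T by (auto simp: W_def)
    show "0\<^sub>v d \<in> W" using T by (auto simp: W_def intro!: exI[of _ "0\<^sub>v e"])
    show "v + w \<in> W" if vw: "v \<in> W" "w \<in> W" for v w
    proof -
      obtain a b where "v = T *\<^sub>v a" "w = T *\<^sub>v b" "a \<in> carrier_vec e" "b \<in> carrier_vec e"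
        using vw unfolding W_def by blast
      then show ?thesis using T
        by (auto simp: W_def mult_add_distrib_mat_vec[symmetric, of _ d e] intro!: exI[of _ "a + b"])
    qed
    show "c \<cdot>\<^sub>v v \<in> W" if cv: "v \<in> W" for c v
    proof -
      obtain a where "v = T *\<^sub>v a" "a \<in> carrier_vec e"
        using cv unfolding W_def by blast
      then show ?thesis using T
        by (auto simp: W_def mult_mat_vec[symmetric, of _ d e] intro!: exI[of _ "c \<cdot>\<^sub>v a"])
    qed
    show "\<rho> x *\<^sub>v w \<in> W" if x: "x \<in> carrier G" and w: "w \<in> W" for x w
    proof -
      obtain a where a: "w = T *\<^sub>v a" "a \<in> carrier_vec e" using w by (auto simp: W_def)
      have sx: "\<sigma> x \<in> carrier_mat e e" and rx: "\<rho> x \<in> carrier_mat d d"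
        using r \<sigma> x by (auto simp: mat_rep_def)
      have "\<rho> x *\<^sub>v w = (\<rho> x * T) *\<^sub>v a" using a T rx by auto
      also have "\<dots> = T *\<^sub>v (\<sigma> x *\<^sub>v a)" using a T sx comm[OF x] by auto
      finally show ?thesis using sx a by (auto simp: W_def)
    qed
  qed
  then have W: "W = {0\<^sub>v d} \<or> W = carrier_vec d" using \<rho> by (auto simp: irreducible_rep_def)
  have "W \<noteq> {0\<^sub>v d}"
  proof
    assume W0: "W = {0\<^sub>v d}"
    have "T = 0\<^sub>m d e"
    proof (rule eq_matI)
      fix i j assume "i < dim_row (0\<^sub>m d e :: complex mat)" "j < dim_col (0\<^sub>m d e :: complex mat)"
      then have ij: "i < d" "j < e" by auto
      have "T $$ (i, j) = (T *\<^sub>v unit_vec e j) $ i" using T ij by (auto simp: scalar_prod_right_unit)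
      moreover have "T *\<^sub>v unit_vec e j \<in> W" by (auto simp: W_def)
      ultimately show "T $$ (i, j) = 0\<^sub>m d e $$ (i, j)" using W0 ij by auto
    qed (use T in auto)
    then show False using nz by simp
  qed
  then have "u \<in> W" using W u by simp
  then show ?thesis unfolding W_def by blast
qed

text \<open>By the two preceding lemmas \<open>T\<close> is bijective. With its inverse
  \<open>U\<close>, \<open>\<rho> x\<close> equals \<open>T * (\<sigma> x * U)\<close>, and the
  trace is cyclic.\<close>

lemma intertwiner_trace:
  assumes G: "group G" and \<rho>: "irreducible_rep G d \<rho>" and \<sigma>: "irreducible_rep G e \<sigma>"
    and T: "T \<in> carrier_mat d e" and comm: "\<And>y. y \<in> carrier G \<Longrightarrow> \<rho> y * T = T * \<sigma> y"
    and nz: "T \<noteq> 0\<^sub>m d e" and x: "x \<in> carrier G"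
  shows "mat_trace (\<rho> x) = mat_trace (\<sigma> x)"
proof -
  have r: "mat_rep G d \<rho>" and s: "mat_rep G e \<sigma>" using \<rho> \<sigma> irreducible_rep_iff[OF G] by blast+
  have sx: "\<sigma> x \<in> carrier_mat e e" and rx: "\<rho> x \<in> carrier_mat d d"
    using r s x by (auto simp: mat_rep_def)
  have "\<forall>i. \<exists>v\<in>carrier_vec e. T *\<^sub>v v = unit_vec d i"
    using intertwiner_image[OF G \<rho> s T comm nz] by auto
  then obtain f where f: "\<And>i. f i \<in> carrier_vec e" "\<And>i. T *\<^sub>v f i = unit_vec d i" by metis
  \<comment> \<open>The columns of \<open>U\<close> are preimages of the unit vectors, so it is a
    right inverse by construction. It is a left inverse because \<open>T * (U * T) = T\<close> and
    \<open>T\<close> is injective.\<close>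
  define U where "U = mat e d (\<lambda>(i, j). f j $ i)"
  have U: "U \<in> carrier_mat e d" by (simp add: U_def)
  have colU: "col U j = f j" if "j < d" for j
    using that f(1)[of j] by (intro eq_vecI) (auto simp: U_def)
  have TU: "T * U = 1\<^sub>m d"
  proof (rule eq_matI)
    fix i j assume "i < dim_row (1\<^sub>m d :: complex mat)" "j < dim_col (1\<^sub>m d :: complex mat)"
    then have ij: "i < d" "j < d" by auto
    have "(T * U) $$ (i, j) = (T *\<^sub>v f j) $ i" using T U ij colU by auto
    then show "(T * U) $$ (i, j) = 1\<^sub>m d $$ (i, j)" using f ij by auto
  qed (use T U in auto)
  have ker: "v = 0\<^sub>v e" if "v \<in> carrier_vec e" "T *\<^sub>v v = 0\<^sub>v d" for v
    using intertwiner_kernel[OF G r \<sigma> T comm that(1) _ that(2)] nz by auto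
  have UT: "U * T = 1\<^sub>m e"
  proof -
    have TUT: "T * (U * T) = T" using assoc_mult_mat[OF T U T] TU T by simp
    have z: "col (U * T) j - unit_vec e j = 0\<^sub>v e" if "j < e" for j
    proof (rule ker)
      have c: "col (U * T) j \<in> carrier_vec e" using U T that by auto
      then show "col (U * T) j - unit_vec e j \<in> carrier_vec e" by auto
      have "T *\<^sub>v col (U * T) j = col (T * (U * T)) j" using T U that by (subst col_mult2[of T d e _ e]) auto
      also have "\<dots> = T *\<^sub>v unit_vec e j"
        using T that by (simp add: TUT) (auto intro!: eq_vecI simp: scalar_prod_right_unit)
      finally show "T *\<^sub>v (col (U * T) j - unit_vec e j) = 0\<^sub>v d"
        using T c by (subst mult_minus_distrib_mat_vec[of _ d e]) auto
    qed
    show ?thesis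
    proof (rule eq_matI)
      fix i j assume "i < dim_row (1\<^sub>m e :: complex mat)" "j < dim_col (1\<^sub>m e :: complex mat)"
      then have ij: "i < e" "j < e" by auto
      have "(col (U * T) j - unit_vec e j) $ i = 0" using z[OF ij(2)] ij by simp
      then show "(U * T) $$ (i, j) = 1\<^sub>m e $$ (i, j)" using ij U T by auto
    qed (use U T in auto)
  qed
  have "mat_trace (\<rho> x) = mat_trace (\<rho> x * (T * U))" using TU rx by simp
  also have "\<rho> x * (T * U) = T * (\<sigma> x * U)"
    unfolding assoc_mult_mat[OF rx T U, symmetric] comm[OF x] by (rule assoc_mult_mat[OF T sx U])
  also have "mat_trace (T * (\<sigma> x * U)) = mat_trace ((\<sigma> x * U) * T)"
    by (rule mat_trace_mult_comm[of _ d e]) (use T U sx in auto)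
  also have "(\<sigma> x * U) * T = \<sigma> x" using assoc_mult_mat[OF sx U T] UT sx by simp
  finally show ?thesis .
qed

text \<open>Over the complex numbers \<open>T\<close> has an eigenvalue \<open>c\<close>; then
  \<open>T - c\<close> is an intertwiner with nonzero kernel, hence 0.\<close>

lemma mat_commutes_scalar:
  assumes G: "group G" and \<rho>: "irreducible_rep G d \<rho>"
    and T: "T \<in> carrier_mat d d" and comm: "\<And>y. y \<in> carrier G \<Longrightarrow> \<rho> y * T = T * \<rho> y"
  shows "\<exists>c. T = c \<cdot>\<^sub>m 1\<^sub>m d"
proof -
  have r: "mat_rep G d \<rho>" and d: "d > 0" using \<rho> irreducible_rep_iff[OF G] by blast+
  obtain c where "eigenvalue T c"
    using spectrum_non_empty[OF T d] by (auto simp: spectrum_def)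
  then obtain v where v: "v \<in> carrier_vec d" "v \<noteq> 0\<^sub>v d" "T *\<^sub>v v = c \<cdot>\<^sub>v v"
    using T by (auto simp: eigenvalue_def eigenvector_def)
  define S where "S = T - c \<cdot>\<^sub>m 1\<^sub>m d"
  have S: "S \<in> carrier_mat d d"
    unfolding S_def by (intro minus_carrier_mat smult_carrier_mat one_carrier_mat)
  have "S = 0\<^sub>m d d"
  proof (rule intertwiner_kernel[OF G r \<rho> S _ v(1,2)])
    show "S *\<^sub>v v = 0\<^sub>v d"
      unfolding S_def using T v
      by (subst minus_mult_distrib_mat_vec[of _ d d])
        (auto intro!: eq_vecI)
    fix y assume y: "y \<in> carrier G"
    have ry: "\<rho> y \<in> carrier_mat d d" using r y by (auto simp: mat_rep_def)
    have "\<rho> y * S = \<rho> y * T - c \<cdot>\<^sub>m \<rho> y"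
      unfolding S_def using T ry
      by (subst mult_minus_distrib_mat[of _ d d]) (auto simp: mult_smult_distrib[of _ d d])
    also have "\<dots> = S * \<rho> y"
      unfolding S_def using T ry comm[OF y]
      by (subst minus_mult_distrib_mat[of _ d d]) (auto simp: mult_smult_assoc_mat[of _ d d])
    finally show "\<rho> y * S = S * \<rho> y" .
  qed
  then have S0: "S $$ (i, j) = 0" if "i < d" "j < d" for i j using that by simp
  have "T $$ (i, j) = (c \<cdot>\<^sub>m 1\<^sub>m d) $$ (i, j)" if "i < d" "j < d" for i j
    using that S0[OF that] T by (simp add: S_def split: if_splits)
  then have "T = c \<cdot>\<^sub>m 1\<^sub>m d" using T by (intro eq_matI) auto
  then show ?thesis by blast
qed

section \<open>Averaging over the group\<close>

definition average_intertwiner ::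
    "('g, 'm) monoid_scheme \<Rightarrow> ('g \<Rightarrow> complex mat) \<Rightarrow> nat \<Rightarrow> ('g \<Rightarrow> complex mat) \<Rightarrow> nat \<Rightarrow> complex mat \<Rightarrow> complex mat"
  where "average_intertwiner G \<rho> d \<sigma> e E =
    mat d e (\<lambda>(i, j). \<Sum>x\<in>carrier G. (\<rho> x * E * \<sigma> (inv\<^bsub>G\<^esub> x)) $$ (i, j))"

text \<open>Replacing the summation variable \<open>x\<close> by \<open>y x\<close> turns the factor
  \<open>\<rho> y\<close> on the left into \<open>\<sigma> y\<close> on the right.\<close>

lemma average_intertwiner_commutes:
  assumes G: "group G" and \<rho>: "mat_rep G d \<rho>" and \<sigma>: "mat_rep G e \<sigma>"
    and E: "E \<in> carrier_mat d e" and y: "y \<in> carrier G"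
  shows "\<rho> y * average_intertwiner G \<rho> d \<sigma> e E = average_intertwiner G \<rho> d \<sigma> e E * \<sigma> y" (is "?L = ?R")
proof -
  interpret G: group G by fact
  let ?T = "average_intertwiner G \<rho> d \<sigma> e E"
  let ?M = "\<lambda>x. \<rho> x * E * \<sigma> (inv\<^bsub>G\<^esub> x)"
  have r: "\<rho> x \<in> carrier_mat d d" and s: "\<sigma> x \<in> carrier_mat e e" if "x \<in> carrier G" for x
    using \<rho> \<sigma> that by (auto simp: mat_rep_def)
  have M: "?M x \<in> carrier_mat d e" if "x \<in> carrier G" for x
    using r[OF that] s[of "inv\<^bsub>G\<^esub> x"] that E by auto
  have T: "?T \<in> carrier_mat d e" by (simp add: average_intertwiner_def)
  have conj: "\<rho> y * ?M x = ?M (y \<otimes>\<^bsub>G\<^esub> x) * \<sigma> y" if x: "x \<in> carrier G" for x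
  proof -
    have "\<sigma> (inv\<^bsub>G\<^esub> (y \<otimes>\<^bsub>G\<^esub> x)) * \<sigma> y = \<sigma> (inv\<^bsub>G\<^esub> (y \<otimes>\<^bsub>G\<^esub> x) \<otimes>\<^bsub>G\<^esub> y)"
      using \<sigma> x y by (simp add: mat_rep_def)
    also have "inv\<^bsub>G\<^esub> (y \<otimes>\<^bsub>G\<^esub> x) \<otimes>\<^bsub>G\<^esub> y = inv\<^bsub>G\<^esub> x"
      using x y by (simp add: G.inv_mult_group G.m_assoc)
    finally have s': "\<sigma> (inv\<^bsub>G\<^esub> (y \<otimes>\<^bsub>G\<^esub> x)) * \<sigma> y = \<sigma> (inv\<^bsub>G\<^esub> x)" .
    have c: "\<rho> y \<in> carrier_mat d d" "\<rho> x \<in> carrier_mat d d" "\<sigma> y \<in> carrier_mat e e"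
        "\<sigma> (inv\<^bsub>G\<^esub> (y \<otimes>\<^bsub>G\<^esub> x)) \<in> carrier_mat e e" "\<sigma> (inv\<^bsub>G\<^esub> x) \<in> carrier_mat e e"
      using r s x y by auto
    have "?M (y \<otimes>\<^bsub>G\<^esub> x) * \<sigma> y = (\<rho> y * \<rho> x * E * \<sigma> (inv\<^bsub>G\<^esub> (y \<otimes>\<^bsub>G\<^esub> x))) * \<sigma> y"
      using \<rho> x y by (simp add: mat_rep_def)
    also have "\<dots> = (\<rho> y * \<rho> x * E) * (\<sigma> (inv\<^bsub>G\<^esub> (y \<otimes>\<^bsub>G\<^esub> x)) * \<sigma> y)"
      by (rule assoc_mult_mat[OF _ c(4) c(3)]) (use c E in auto)
    also have "\<dots> = (\<rho> y * (\<rho> x * E)) * \<sigma> (inv\<^bsub>G\<^esub> x)"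
      unfolding s' by (subst assoc_mult_mat[OF c(1) c(2) E]) (rule refl)
    also have "\<dots> = \<rho> y * ?M x"
      by (rule assoc_mult_mat[OF c(1) _ c(5)]) (use c E in auto)
    finally show ?thesis by simp
  qed
  have L: "?L $$ (i, j) = (\<Sum>x\<in>carrier G. (\<rho> y * ?M x) $$ (i, j))" if ij: "i < d" "j < e" for i j
  proof -
    have "?L $$ (i, j) = (\<Sum>k<d. \<rho> y $$ (i, k) * (\<Sum>x\<in>carrier G. ?M x $$ (k, j)))"
      using ij r[OF y] T by (simp add: scalar_prod_def atLeast0LessThan average_intertwiner_def)
    also have "\<dots> = (\<Sum>x\<in>carrier G. \<Sum>k<d. \<rho> y $$ (i, k) * ?M x $$ (k, j))"
      by (subst sum.swap) (simp add: sum_distrib_left)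
    also have "\<dots> = (\<Sum>x\<in>carrier G. (\<rho> y * ?M x) $$ (i, j))"
    proof (rule sum.cong[OF refl])
      fix x assume x: "x \<in> carrier G"
      show "(\<Sum>k<d. \<rho> y $$ (i, k) * ?M x $$ (k, j)) = (\<rho> y * ?M x) $$ (i, j)"
        by (rule index_mult_mat_sum[OF r[OF y] M[OF x] ij, symmetric])
    qed
    finally show ?thesis .
  qed
  have R: "?R $$ (i, j) = (\<Sum>x\<in>carrier G. (?M x * \<sigma> y) $$ (i, j))" if ij: "i < d" "j < e" for i j
  proof -
    have "?R $$ (i, j) = (\<Sum>k<e. (\<Sum>x\<in>carrier G. ?M x $$ (i, k)) * \<sigma> y $$ (k, j))"
      using ij s[OF y] T by (simp add: scalar_prod_def atLeast0LessThan average_intertwiner_def)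
    also have "\<dots> = (\<Sum>x\<in>carrier G. \<Sum>k<e. ?M x $$ (i, k) * \<sigma> y $$ (k, j))"
      by (subst sum.swap) (simp add: sum_distrib_right)
    also have "\<dots> = (\<Sum>x\<in>carrier G. (?M x * \<sigma> y) $$ (i, j))"
    proof (rule sum.cong[OF refl])
      fix x assume x: "x \<in> carrier G"
      show "(\<Sum>k<e. ?M x $$ (i, k) * \<sigma> y $$ (k, j)) = (?M x * \<sigma> y) $$ (i, j)"
        by (rule index_mult_mat_sum[OF M[OF x] s[OF y] ij, symmetric])
    qed
    finally show ?thesis .
  qed
  show ?thesis
  proof (rule eq_matI)
    fix i j assume "i < dim_row ?R" "j < dim_col ?R"
    then have ij: "i < d" "j < e" using T s[OF y] by auto
    have "?L $$ (i, j) = (\<Sum>x\<in>carrier G. (?M (y \<otimes>\<^bsub>G\<^esub> x) * \<sigma> y) $$ (i, j))"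
      unfolding L[OF ij] by (rule sum.cong[OF refl]) (simp only: conj)
    also have "\<dots> = (\<Sum>x\<in>carrier G. (?M x * \<sigma> y) $$ (i, j))"
    proof (rule sum.reindex_bij_betw[where h = "\<lambda>x. y \<otimes>\<^bsub>G\<^esub> x"])
      show "bij_betw (\<lambda>x. y \<otimes>\<^bsub>G\<^esub> x) (carrier G) (carrier G)"
        using y by (intro bij_betwI[where g = "\<lambda>x. inv\<^bsub>G\<^esub> y \<otimes>\<^bsub>G\<^esub> x"]) (auto simp: G.m_assoc[symmetric])
    qed
    also have "\<dots> = ?R $$ (i, j)" using R[OF ij] by simp
    finally show "?L $$ (i, j) = ?R $$ (i, j)" .
  qed (use T r[OF y] s[OF y] in auto)
qed

text \<open>Coefficients of either sign are allowed because the determinants below are alternating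
  sums of permutation characters. Agreement is asked on the carrier only, where irreducible
  characters carry information.\<close>

definition virtual_character :: "('g, 'm) monoid_scheme \<Rightarrow> ('g \<Rightarrow> complex) \<Rightarrow> bool"
  where "virtual_character G \<phi> \<longleftrightarrow> (\<exists>S m. finite S \<and> S \<subseteq> irreducible_characters G \<and>
    (\<forall>x\<in>carrier G. \<phi> x = (\<Sum>\<chi>\<in>S. of_int (m \<chi>) * \<chi> x)))"

lemma virtual_character_zero: "virtual_character G (\<lambda>x. 0)"
  unfolding virtual_character_def by (intro exI[of _ "{}"]) auto

lemma virtual_character_irreducible:
  "\<chi> \<in> irreducible_characters G \<Longrightarrow> virtual_character G \<chi>"
  unfolding virtual_character_def by (intro exI[of _ "{\<chi>}"] exI[of _ "\<lambda>_. 1"]) auto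

lemma virtual_character_cong:
  assumes "virtual_character G \<phi>" "\<And>x. x \<in> carrier G \<Longrightarrow> \<phi> x = \<psi> x"
  shows "virtual_character G \<psi>"
  using assms unfolding virtual_character_def by metis

lemma virtual_character_add:
  assumes "virtual_character G \<phi>" "virtual_character G \<psi>"
  shows "virtual_character G (\<lambda>x. \<phi> x + \<psi> x)"
proof -
  obtain S m where S: "finite S" "S \<subseteq> irreducible_characters G"
    "\<And>x. x \<in> carrier G \<Longrightarrow> \<phi> x = (\<Sum>\<chi>\<in>S. of_int (m \<chi>) * \<chi> x)"
    using assms(1) unfolding virtual_character_def by blast
  obtain T l where T: "finite T" "T \<subseteq> irreducible_characters G"
    "\<And>x. x \<in> carrier G \<Longrightarrow> \<psi> x = (\<Sum>\<chi>\<in>T. of_int (l \<chi>) * \<chi> x)"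
    using assms(2) unfolding virtual_character_def by blast
  let ?k = "\<lambda>\<chi>. (if \<chi> \<in> S then m \<chi> else 0) + (if \<chi> \<in> T then l \<chi> else 0)"
  have "\<phi> x + \<psi> x = (\<Sum>\<chi>\<in>S \<union> T. of_int (?k \<chi>) * \<chi> x)" if x: "x \<in> carrier G" for x
  proof -
    have "(\<Sum>\<chi>\<in>S. of_int (m \<chi>) * \<chi> x) = (\<Sum>\<chi>\<in>S \<union> T. of_int (if \<chi> \<in> S then m \<chi> else 0) * \<chi> x)"
      using S T by (intro sum.mono_neutral_cong_left) auto
    moreover have "(\<Sum>\<chi>\<in>T. of_int (l \<chi>) * \<chi> x) = (\<Sum>\<chi>\<in>S \<union> T. of_int (if \<chi> \<in> T then l \<chi> else 0) * \<chi> x)"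
      using S T by (intro sum.mono_neutral_cong_left) auto
    ultimately have "\<phi> x + \<psi> x = (\<Sum>\<chi>\<in>S \<union> T. of_int (if \<chi> \<in> S then m \<chi> else 0) * \<chi> x +
        of_int (if \<chi> \<in> T then l \<chi> else 0) * \<chi> x)"
      unfolding sum.distrib by (simp only: S(3)[OF x] T(3)[OF x])
    then show ?thesis by (simp only: of_int_add distrib_right)
  qed
  then show ?thesis
    unfolding virtual_character_def using S T
    by (intro exI[of _ "S \<union> T"] exI[of _ ?k]) auto
qed

lemma virtual_character_scale:
  assumes "virtual_character G \<phi>"
  shows "virtual_character G (\<lambda>x. of_int c * \<phi> x)"
proof -
  obtain S m where S: "finite S" "S \<subseteq> irreducible_characters G"
    "\<And>x. x \<in> carrier G \<Longrightarrow> \<phi> x = (\<Sum>\<chi>\<in>S. of_int (m \<chi>) * \<chi> x)"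
    using assms(1) unfolding virtual_character_def by blast
  then show ?thesis unfolding virtual_character_def
    by (intro exI[of _ S] exI[of _ "\<lambda>\<chi>. c * m \<chi>"]) (auto simp: sum_distrib_left mult.assoc)
qed

lemma virtual_character_sum:
  "finite I \<Longrightarrow> (\<And>i. i \<in> I \<Longrightarrow> virtual_character G (\<phi> i)) \<Longrightarrow> virtual_character G (\<lambda>x. \<Sum>i\<in>I. \<phi> i x)"
  by (induction I rule: finite_induct) (auto intro: virtual_character_zero virtual_character_add)

text \<open>Induction on the dimension. An invariant subspace makes all matrices block triangular,
  and the trace sees only the diagonal blocks, which are the actions on the subspace and on the
  quotient. Thus an arbitrary complement does the job of an invariant one.\<close>

lemma mat_rep_character:
  assumes G: "group G" and "mat_rep G d \<rho>"
  shows "virtual_character G (\<lambda>x. mat_trace (\<rho> x))"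
  using assms(2)
proof (induction d arbitrary: \<rho> rule: less_induct)
  case (less d)
  have r: "\<rho> x \<in> carrier_mat d d" if "x \<in> carrier G" for x
    using less.prems that by (auto simp: mat_rep_def)
  consider "d = 0" | "irreducible_rep G d \<rho>"
    | W where "d > 0" "invariant_subspace G d \<rho> W" "W \<noteq> {0\<^sub>v d}" "W \<noteq> carrier_vec d"
    using less.prems irreducible_rep_iff[OF G] by blast
  then show ?case
  proof cases
    case 1
    have "mat_trace (\<rho> x) = 0" if "x \<in> carrier G" for x
      using r[OF that] 1 by (auto simp: mat_trace_def)
    then show ?thesis using virtual_character_cong[OF virtual_character_zero] by metis
  next
    case 2
    then have "restrict (\<lambda>x. mat_trace (\<rho> x)) (carrier G) \<in> irreducible_characters G"
      by (auto simp: irreducible_characters_def)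
    from virtual_character_cong[OF virtual_character_irreducible[OF this]]
    show ?thesis by simp
  next
    case (3 W)
    obtain r J K J' K' where rd: "r \<le> d" and J: "J \<in> carrier_mat d r" and K: "K \<in> carrier_mat r d"
      and J': "J' \<in> carrier_mat d (d - r)" and K': "K' \<in> carrier_mat (d - r) d"
      and KJ: "K * J = 1\<^sub>m r" and KJ': "K' * J' = 1\<^sub>m (d - r)" and K'J: "K' * J = 0\<^sub>m (d - r) r"
      and JK: "J * K + J' * K' = 1\<^sub>m d" and W: "W = {J *\<^sub>v v |v. v \<in> carrier_vec r}"
      using subspace_split[of W d] 3(2) unfolding invariant_subspace_def by blast
    have K'W: "K' *\<^sub>v w = 0\<^sub>v (d - r)" if w: "w \<in> W" for w
    proof -
      obtain v where v: "w = J *\<^sub>v v" "v \<in> carrier_vec r" using w unfolding W by blast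
      have "0\<^sub>m (d - r) r *\<^sub>v v = 0\<^sub>v (d - r)" using v(2) by (intro eq_vecI) auto
      then show ?thesis using assoc_mult_mat_vec[OF K' J v(2)] K'J v(1) by simp
    qed
    have "r > 0"
    proof (rule ccontr)
      assume "\<not> 0 < r"
      then have r0: "r = 0" by simp
      have "J *\<^sub>v v = 0\<^sub>v d" if "v \<in> carrier_vec r" for v
        using J that r0 by (intro eq_vecI) (auto simp: scalar_prod_def)
      then have "W = {0\<^sub>v d}" unfolding W by (auto intro!: exI[of _ "0\<^sub>v r"])
      then show False using 3 by simp
    qed
    have "r < d"
    proof (rule ccontr)
      assume "\<not> r < d"
      then have rd': "r = d" using rd by simp
      have "J' * K' = 0\<^sub>m d d" using J' K' rd' by (intro eq_matI) (auto simp: scalar_prod_def)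
      then have JK1: "J * K = 1\<^sub>m d" using JK J K by auto
      have "carrier_vec d \<subseteq> W"
      proof
        fix v :: "complex vec" assume v: "v \<in> carrier_vec d"
        then have "J *\<^sub>v (K *\<^sub>v v) = v" using assoc_mult_mat_vec[OF J K v] JK1 by simp
        then show "v \<in> W" using K v unfolding W by (intro CollectI exI[of _ "K *\<^sub>v v"]) auto
      qed
      moreover have "W \<subseteq> carrier_vec d" using J unfolding W by auto
      ultimately show False using 3 by auto
    qed
    \<comment> \<open>Invariance of \<open>W\<close>: the block that maps \<open>W\<close> into the
      complement is zero.\<close>
    have K'rJ: "K' * (\<rho> x * J) = 0\<^sub>m (d - r) r" if x: "x \<in> carrier G" for x
    proof (rule eq_matI)
      fix i j assume "i < dim_row (0\<^sub>m (d - r) r :: complex mat)" "j < dim_col (0\<^sub>m (d - r) r :: complex mat)"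
      then have ij: "i < d - r" "j < r" by auto
      have "J *\<^sub>v unit_vec r j \<in> W" unfolding W by auto
      then have "\<rho> x *\<^sub>v (J *\<^sub>v unit_vec r j) \<in> W"
        using 3(2) x unfolding invariant_subspace_def by blast
      then have "K' *\<^sub>v (\<rho> x *\<^sub>v (J *\<^sub>v unit_vec r j)) = 0\<^sub>v (d - r)" by (rule K'W)
      moreover have "(K' * (\<rho> x * J)) *\<^sub>v unit_vec r j = K' *\<^sub>v (\<rho> x *\<^sub>v (J *\<^sub>v unit_vec r j))"
        using assoc_mult_mat_vec[OF K', of "\<rho> x * J" r "unit_vec r j"]
          assoc_mult_mat_vec[OF r[OF x] J, of "unit_vec r j"] r[OF x] J by simp
      moreover have "((K' * (\<rho> x * J)) *\<^sub>v unit_vec r j) $ i = (K' * (\<rho> x * J)) $$ (i, j)"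
        using K' J r[OF x] ij by (simp add: scalar_prod_right_unit)
      ultimately show "(K' * (\<rho> x * J)) $$ (i, j) = 0\<^sub>m (d - r) r $$ (i, j)"
        using ij by simp
    qed (use K' J in auto)
    \<comment> \<open>\<open>\<rho>1\<close> is the action on \<open>W\<close>,
      \<open>\<rho>2\<close> the action on the quotient by \<open>W\<close>.\<close>
    define \<rho>1 where "\<rho>1 x = K * (\<rho> x * J)" for x
    define \<rho>2 where "\<rho>2 x = K' * (\<rho> x * J')" for x
    have \<rho>1c: "\<rho>1 x \<in> carrier_mat r r" and \<rho>2c: "\<rho>2 x \<in> carrier_mat (d - r) (d - r)"
      if "x \<in> carrier G" for x
      using r[OF that] J K J' K' by (auto simp: \<rho>1_def \<rho>2_def)
    have prod: "\<rho> (x \<otimes>\<^bsub>G\<^esub> y) = \<rho> x * \<rho> y" "\<rho> x * \<rho> y = (\<rho> x * J) * (K * \<rho> y) + (\<rho> x * J') * (K' * \<rho> y)"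
      if x: "x \<in> carrier G" and y: "y \<in> carrier G" for x y
    proof -
      note c = r[OF x] r[OF y]
      show "\<rho> (x \<otimes>\<^bsub>G\<^esub> y) = \<rho> x * \<rho> y" using less.prems x y by (auto simp: mat_rep_def)
      have "\<rho> x * \<rho> y = \<rho> x * ((J * K + J' * K') * \<rho> y)" using JK c by simp
      also have "(J * K + J' * K') * \<rho> y = J * K * \<rho> y + J' * K' * \<rho> y"
        by (rule add_mult_distrib_mat) (use J K J' K' c in auto)
      also have "\<rho> x * (J * K * \<rho> y + J' * K' * \<rho> y) = \<rho> x * (J * K * \<rho> y) + \<rho> x * (J' * K' * \<rho> y)"
        by (rule mult_add_distrib_mat) (use J K J' K' c in auto)
      also have "\<rho> x * (J * K * \<rho> y) = (\<rho> x * J) * (K * \<rho> y)"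
        using assoc_mult_mat[OF J K c(2)] assoc_mult_mat[OF c(1) J, of "K * \<rho> y" d] K c by simp
      also have "\<rho> x * (J' * K' * \<rho> y) = (\<rho> x * J') * (K' * \<rho> y)"
        using assoc_mult_mat[OF J' K' c(2)] assoc_mult_mat[OF c(1) J', of "K' * \<rho> y" d] K' c by simp
      finally show "\<rho> x * \<rho> y = (\<rho> x * J) * (K * \<rho> y) + (\<rho> x * J') * (K' * \<rho> y)" .
    qed
    \<comment> \<open>Inserts \<open>J * K + J' * K' = 1\<close> between the two factors. For each
      diagonal block, one of the two resulting terms contains the zero block.\<close>
    have sandwich: "A * ((\<rho> x * \<rho> y) * B) =
        (A * (\<rho> x * J)) * (K * (\<rho> y * B)) + (A * (\<rho> x * J')) * (K' * (\<rho> y * B))"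
      if x: "x \<in> carrier G" and y: "y \<in> carrier G" and A: "A \<in> carrier_mat a d" and B: "B \<in> carrier_mat d a"
      for x y A B a
    proof -
      note c = r[OF x] r[OF y]
      have "(\<rho> x * \<rho> y) * B = (\<rho> x * J) * (K * \<rho> y) * B + (\<rho> x * J') * (K' * \<rho> y) * B"
        unfolding prod(2)[OF x y] by (rule add_mult_distrib_mat) (use J K J' K' c B in auto)
      also have "(\<rho> x * J) * (K * \<rho> y) * B = (\<rho> x * J) * (K * (\<rho> y * B))"
        using assoc_mult_mat[of "\<rho> x * J" d r "K * \<rho> y" d B a] assoc_mult_mat[OF K c(2) B] J K c B by simp
      also have "(\<rho> x * J') * (K' * \<rho> y) * B = (\<rho> x * J') * (K' * (\<rho> y * B))"
        using assoc_mult_mat[of "\<rho> x * J'" d "d - r" "K' * \<rho> y" d B a] assoc_mult_mat[OF K' c(2) B] J' K' c B by simp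
      finally have "A * ((\<rho> x * \<rho> y) * B) = A * ((\<rho> x * J) * (K * (\<rho> y * B)) + (\<rho> x * J') * (K' * (\<rho> y * B)))"
        by simp
      also have "\<dots> = A * ((\<rho> x * J) * (K * (\<rho> y * B))) + A * ((\<rho> x * J') * (K' * (\<rho> y * B)))"
        by (rule mult_add_distrib_mat) (use A J K J' K' c B in auto)
      also have "A * ((\<rho> x * J) * (K * (\<rho> y * B))) = (A * (\<rho> x * J)) * (K * (\<rho> y * B))"
        by (rule assoc_mult_mat[symmetric]) (use A J K c B in auto)
      also have "A * ((\<rho> x * J') * (K' * (\<rho> y * B))) = (A * (\<rho> x * J')) * (K' * (\<rho> y * B))"
        by (rule assoc_mult_mat[symmetric]) (use A J' K' c B in auto)
      finally show ?thesis .
    qed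
    have one: "\<rho> \<one>\<^bsub>G\<^esub> = 1\<^sub>m d" using less.prems by (auto simp: mat_rep_def)
    have m1: "mat_rep G r \<rho>1"
      unfolding mat_rep_def
    proof (intro conjI ballI)
      fix x y assume x: "x \<in> carrier G" and y: "y \<in> carrier G"
      have "\<rho>1 (x \<otimes>\<^bsub>G\<^esub> y) = \<rho>1 x * \<rho>1 y + (K * (\<rho> x * J')) * (K' * (\<rho> y * J))"
        unfolding \<rho>1_def prod(1)[OF x y] by (rule sandwich[OF x y K J])
      then show "\<rho>1 (x \<otimes>\<^bsub>G\<^esub> y) = \<rho>1 x * \<rho>1 y"
        using K'rJ[OF y] right_mult_zero_mat[of "K * (\<rho> x * J')" r "d - r" r] K J' r[OF x] \<rho>1c[OF x] \<rho>1c[OF y]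
        by simp
    qed (use \<rho>1c one J KJ in \<open>auto simp: \<rho>1_def\<close>)
    have m2: "mat_rep G (d - r) \<rho>2"
      unfolding mat_rep_def
    proof (intro conjI ballI)
      fix x y assume x: "x \<in> carrier G" and y: "y \<in> carrier G"
      have "\<rho>2 (x \<otimes>\<^bsub>G\<^esub> y) = (K' * (\<rho> x * J)) * (K * (\<rho> y * J')) + \<rho>2 x * \<rho>2 y"
        unfolding \<rho>2_def prod(1)[OF x y] by (rule sandwich[OF x y K' J'])
      then show "\<rho>2 (x \<otimes>\<^bsub>G\<^esub> y) = \<rho>2 x * \<rho>2 y"
        using K'rJ[OF x] left_mult_zero_mat[of "K * (\<rho> y * J')" r "d - r" "d - r"] K J' r[OF y] \<rho>2c[OF x] \<rho>2c[OF y]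
        by simp
    qed (use \<rho>2c one J' KJ' in \<open>auto simp: \<rho>2_def\<close>)
    have tr: "mat_trace (\<rho>1 x) + mat_trace (\<rho>2 x) = mat_trace (\<rho> x)" if x: "x \<in> carrier G" for x
    proof -
      note c = r[OF x]
      have "mat_trace (\<rho>1 x) = mat_trace ((\<rho> x * J) * K)"
        unfolding \<rho>1_def by (rule mat_trace_mult_comm[OF K]) (use J c in auto)
      moreover have "mat_trace (\<rho>2 x) = mat_trace ((\<rho> x * J') * K')"
        unfolding \<rho>2_def by (rule mat_trace_mult_comm[OF K']) (use J' c in auto)
      moreover have "\<rho> x = (\<rho> x * J) * K + (\<rho> x * J') * K'"
      proof -
        have "\<rho> x = \<rho> x * (J * K + J' * K')" using JK c by simp
        also have "\<dots> = \<rho> x * (J * K) + \<rho> x * (J' * K')"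
          by (rule mult_add_distrib_mat) (use J K J' K' c in auto)
        finally show ?thesis using assoc_mult_mat[OF c J K] assoc_mult_mat[OF c J' K'] by simp
      qed
      ultimately show ?thesis
        using mat_trace_add[of "(\<rho> x * J) * K" d "(\<rho> x * J') * K'"] J K J' K' c by auto
    qed
    show ?thesis
      using virtual_character_cong[OF virtual_character_add[OF
          less.IH[OF \<open>r < d\<close> m1] less.IH[of "d - r" \<rho>2]]] m2 \<open>r > 0\<close> \<open>d > 0\<close> tr by auto
  qed
qed

text \<open>If \<open>E\<close> is the matrix unit with its 1 at \<open>(i, k)\<close>, the
  \<open>(i, k)\<close> entry of \<open>\<rho> x * E * \<sigma> (inv x)\<close> is the product of
  the diagonal entries \<open>\<rho> x $$ (i, i)\<close> and
  \<open>\<sigma> (inv x) $$ (k, k)\<close>. Summing over \<open>i\<close> and \<open>k\<close>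
  gives the product of the traces.\<close>

lemma trace_product_average:
  assumes r: "\<And>x. x \<in> carrier G \<Longrightarrow> \<rho> x \<in> carrier_mat d d"
    and s: "\<And>x. x \<in> carrier G \<Longrightarrow> \<sigma> (inv\<^bsub>G\<^esub> x) \<in> carrier_mat e e"
  shows "(\<Sum>x\<in>carrier G. mat_trace (\<rho> x) * mat_trace (\<sigma> (inv\<^bsub>G\<^esub> x))) = (\<Sum>i<d. \<Sum>k<e.
    average_intertwiner G \<rho> d \<sigma> e (mat d e (\<lambda>(a, b). if a = i \<and> b = k then 1 else 0)) $$ (i, k))"
proof -
  let ?E = "\<lambda>i k. mat d e (\<lambda>(a, b). if a = i \<and> b = k then 1 else (0 :: complex))"
  have ent: "(A * ?E i k * B) $$ (i, k) = A $$ (i, i) * B $$ (k, k)"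
    if A: "A \<in> carrier_mat d d" and B: "B \<in> carrier_mat e e" and ik: "i < d" "k < e" for A B i k
  proof -
    have E: "?E i k \<in> carrier_mat d e" by simp
    have AE: "(A * ?E i k) $$ (i, b) = (if b = k then A $$ (i, i) else 0)" if "b < e" for b
    proof -
      have "(A * ?E i k) $$ (i, b) = (\<Sum>a<d. A $$ (i, a) * ?E i k $$ (a, b))"
        by (rule index_mult_mat_sum[OF A E ik(1) that])
      also have "\<dots> = (\<Sum>a<d. if a = i then (if b = k then A $$ (i, i) else 0) else 0)"
        using that by (intro sum.cong) auto
      also have "\<dots> = (if b = k then A $$ (i, i) else 0)" using ik by (simp add: sum.delta)
      finally show ?thesis .
    qed
    have "(A * ?E i k * B) $$ (i, k) = (\<Sum>b<e. (A * ?E i k) $$ (i, b) * B $$ (b, k))"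
      by (rule index_mult_mat_sum[OF _ B ik]) (use A in auto)
    also have "\<dots> = (\<Sum>b<e. if b = k then A $$ (i, i) * B $$ (k, k) else 0)"
      by (intro sum.cong) (auto simp: AE)
    also have "\<dots> = A $$ (i, i) * B $$ (k, k)" using ik by (simp add: sum.delta)
    finally show ?thesis .
  qed
  have "(\<Sum>x\<in>carrier G. mat_trace (\<rho> x) * mat_trace (\<sigma> (inv\<^bsub>G\<^esub> x))) =
      (\<Sum>x\<in>carrier G. \<Sum>i<d. \<Sum>k<e. (\<rho> x * ?E i k * \<sigma> (inv\<^bsub>G\<^esub> x)) $$ (i, k))"
  proof (rule sum.cong[OF refl])
    fix x assume x: "x \<in> carrier G"
    show "mat_trace (\<rho> x) * mat_trace (\<sigma> (inv\<^bsub>G\<^esub> x)) =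
        (\<Sum>i<d. \<Sum>k<e. (\<rho> x * ?E i k * \<sigma> (inv\<^bsub>G\<^esub> x)) $$ (i, k))"
      using r[OF x] s[OF x] by (simp add: mat_trace_def sum_product ent[OF r[OF x] s[OF x]] del: index_mult_mat)
  qed
  also have "\<dots> = (\<Sum>i<d. \<Sum>k<e. \<Sum>x\<in>carrier G. (\<rho> x * ?E i k * \<sigma> (inv\<^bsub>G\<^esub> x)) $$ (i, k))"
    by (subst sum.swap, rule sum.cong[OF refl], subst sum.swap, rule refl)
  also have "\<dots> = (\<Sum>i<d. \<Sum>k<e. average_intertwiner G \<rho> d \<sigma> e (?E i k) $$ (i, k))"
  proof (intro sum.cong refl)
    fix i k assume "i \<in> {..<d}" "k \<in> {..<e}"
    then show "(\<Sum>x\<in>carrier G. (\<rho> x * ?E i k * \<sigma> (inv\<^bsub>G\<^esub> x)) $$ (i, k)) =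
        average_intertwiner G \<rho> d \<sigma> e (?E i k) $$ (i, k)"
      by (simp add: average_intertwiner_def del: index_mult_mat)
  qed
  finally show ?thesis .
qed

text \<open>\<open>\<psi> (inv x)\<close> stands in for the complex conjugate. Schur's lemma is
  applied to the averages of the matrix units: for different characters they are 0, for equal ones
  they are scalar.\<close>

lemma irreducible_characters_orthogonal:
  assumes G: "group G" and fin: "finite (carrier G)"
    and \<chi>: "\<chi> \<in> irreducible_characters G" and \<psi>: "\<psi> \<in> irreducible_characters G"
  shows "(\<Sum>x\<in>carrier G. \<chi> x * \<psi> (inv\<^bsub>G\<^esub> x)) = (if \<chi> = \<psi> then of_nat (card (carrier G)) else 0)"
proof -
  interpret G: group G by fact
  let ?E = "\<lambda>d e i k. mat d e (\<lambda>(a, b). if a = i \<and> b = k then 1 else (0 :: complex))"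
  obtain d \<rho> where \<rho>: "irreducible_rep G d \<rho>" "\<chi> = restrict (\<lambda>x. mat_trace (\<rho> x)) (carrier G)"
    using \<chi> by (auto simp: irreducible_characters_def)
  obtain e \<sigma> where \<sigma>: "irreducible_rep G e \<sigma>" "\<psi> = restrict (\<lambda>x. mat_trace (\<sigma> x)) (carrier G)"
    using \<psi> by (auto simp: irreducible_characters_def)
  have mr: "mat_rep G d \<rho>" "mat_rep G e \<sigma>" and d: "d > 0"
    using \<rho>(1) \<sigma>(1) irreducible_rep_iff[OF G] by blast+
  have r: "\<rho> x \<in> carrier_mat d d" and s: "\<sigma> x \<in> carrier_mat e e" if "x \<in> carrier G" for x
    using mr that by (auto simp: mat_rep_def)
  show ?thesis
  proof (cases "\<chi> = \<psi>")
    case False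
    have z: "average_intertwiner G \<rho> d \<sigma> e (?E d e i k) = 0\<^sub>m d e" for i k
    proof (rule ccontr)
      assume "average_intertwiner G \<rho> d \<sigma> e (?E d e i k) \<noteq> 0\<^sub>m d e"
      then have "mat_trace (\<rho> x) = mat_trace (\<sigma> x)" if "x \<in> carrier G" for x
        using intertwiner_trace[OF G \<rho>(1) \<sigma>(1) _ average_intertwiner_commutes[OF G mr, of "?E d e i k"] _ that]
        by (simp add: average_intertwiner_def)
      then show False using False \<rho>(2) \<sigma>(2) by (auto simp: restrict_def)
    qed
    have "(\<Sum>x\<in>carrier G. \<chi> x * \<psi> (inv\<^bsub>G\<^esub> x)) =
        (\<Sum>x\<in>carrier G. mat_trace (\<rho> x) * mat_trace (\<sigma> (inv\<^bsub>G\<^esub> x)))"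
      by (intro sum.cong) (auto simp: \<rho>(2) \<sigma>(2))
    also have "\<dots> = 0"
      using trace_product_average[of G \<rho> d \<sigma> e] r s by (simp add: z)
    finally show ?thesis using False by simp
  next
    case True
    let ?T = "\<lambda>i k. average_intertwiner G \<rho> d \<rho> d (?E d d i k)"
    \<comment> \<open>The average is \<open>c\<close> times the identity, and its trace
      \<open>d * c\<close> is the group order times the trace of the matrix unit.\<close>
    have T: "?T i k $$ (i, k) = (if i = k then of_nat (card (carrier G)) / of_nat d else 0)"
      if ik: "i < d" "k < d" for i k
    proof -
      have E: "?E d d i k \<in> carrier_mat d d" by simp
      have Tc: "?T i k \<in> carrier_mat d d" by (simp add: average_intertwiner_def)
      obtain c where c: "?T i k = c \<cdot>\<^sub>m 1\<^sub>m d"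
        using mat_commutes_scalar[OF G \<rho>(1) Tc average_intertwiner_commutes[OF G mr(1) mr(1) E]] by blast
      have "of_nat d * c = mat_trace (?T i k)"
        by (simp add: c mat_trace_def)
      also have "\<dots> = (\<Sum>x\<in>carrier G. mat_trace (\<rho> x * ?E d d i k * \<rho> (inv\<^bsub>G\<^esub> x)))"
      proof -
        have "mat_trace (?T i k) = (\<Sum>j<d. \<Sum>x\<in>carrier G. (\<rho> x * ?E d d i k * \<rho> (inv\<^bsub>G\<^esub> x)) $$ (j, j))"
          by (simp add: mat_trace_def average_intertwiner_def del: index_mult_mat)
        also have "\<dots> = (\<Sum>x\<in>carrier G. \<Sum>j<d. (\<rho> x * ?E d d i k * \<rho> (inv\<^bsub>G\<^esub> x)) $$ (j, j))"
          by (rule sum.swap)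
        also have "\<dots> = (\<Sum>x\<in>carrier G. mat_trace (\<rho> x * ?E d d i k * \<rho> (inv\<^bsub>G\<^esub> x)))"
        proof (rule sum.cong[OF refl])
          fix x assume "x \<in> carrier G"
          from r[OF this] show "(\<Sum>j<d. (\<rho> x * ?E d d i k * \<rho> (inv\<^bsub>G\<^esub> x)) $$ (j, j)) =
              mat_trace (\<rho> x * ?E d d i k * \<rho> (inv\<^bsub>G\<^esub> x))"
            by (simp add: mat_trace_def del: index_mult_mat(1))
        qed
        finally show ?thesis .
      qed
      also have "\<dots> = (\<Sum>x\<in>carrier G. mat_trace (?E d d i k))"
      proof (rule sum.cong[OF refl])
        fix x assume x: "x \<in> carrier G"
        have "mat_trace (\<rho> x * ?E d d i k * \<rho> (inv\<^bsub>G\<^esub> x)) = mat_trace (\<rho> (inv\<^bsub>G\<^esub> x) * (\<rho> x * ?E d d i k))"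
          by (rule mat_trace_mult_comm[of _ d d]) (use r[OF x] r[of "inv\<^bsub>G\<^esub> x"] x in auto)
        also have "\<rho> (inv\<^bsub>G\<^esub> x) * (\<rho> x * ?E d d i k) = (\<rho> (inv\<^bsub>G\<^esub> x) * \<rho> x) * ?E d d i k"
          using r[OF x] r[of "inv\<^bsub>G\<^esub> x"] x by (intro assoc_mult_mat[of _ d d _ d _ d, symmetric]) auto
        also have "\<rho> (inv\<^bsub>G\<^esub> x) * \<rho> x = 1\<^sub>m d"
          using mr(1) x unfolding mat_rep_def by (metis G.inv_closed G.l_inv)
        finally show "mat_trace (\<rho> x * ?E d d i k * \<rho> (inv\<^bsub>G\<^esub> x)) = mat_trace (?E d d i k)" by simp
      qed
      also have "mat_trace (?E d d i k) = (\<Sum>j<d. if j = i then (if i = k then 1 else 0) else 0)"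
        by (auto simp: mat_trace_def intro!: sum.cong)
      also have "\<dots> = (if i = k then 1 else 0)" using ik by (simp add: sum.delta)
      finally have "of_nat d * c = (if i = k then of_nat (card (carrier G)) else 0)" by auto
      then have "c = (if i = k then of_nat (card (carrier G)) / of_nat d else 0)"
        using d by (auto simp: field_simps split: if_splits)
      then show ?thesis using c ik by simp
    qed
    have "(\<Sum>x\<in>carrier G. \<chi> x * \<psi> (inv\<^bsub>G\<^esub> x)) =
        (\<Sum>x\<in>carrier G. mat_trace (\<rho> x) * mat_trace (\<rho> (inv\<^bsub>G\<^esub> x)))"
      unfolding True[symmetric] by (intro sum.cong) (auto simp: \<rho>(2))
    also have "\<dots> = (\<Sum>i<d. \<Sum>k<d. ?T i k $$ (i, k))"
      using trace_product_average[of G \<rho> d \<rho> d] r by simp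
    also have "\<dots> = (\<Sum>i<d. \<Sum>k<d. if i = k then of_nat (card (carrier G)) / of_nat d else 0)"
      by (intro sum.cong refl) (simp add: T)
    also have "\<dots> = of_nat (card (carrier G))" using d by (simp add: sum.delta)
    finally show ?thesis using True by simp
  qed
qed

lemma virtual_character_inner:
  assumes G: "group G" and fin: "finite (carrier G)" and S: "finite S" "S \<subseteq> irreducible_characters G"
    and \<phi>: "\<And>x. x \<in> carrier G \<Longrightarrow> \<phi> x = (\<Sum>\<chi>\<in>S. of_int (m \<chi>) * \<chi> x)"
    and \<psi>: "\<And>x. x \<in> carrier G \<Longrightarrow> \<psi> x = (\<Sum>\<chi>\<in>S. of_int (l \<chi>) * \<chi> x)"
  shows "(\<Sum>x\<in>carrier G. \<phi> x * \<psi> (inv\<^bsub>G\<^esub> x)) = of_nat (card (carrier G)) * of_int (\<Sum>\<chi>\<in>S. m \<chi> * l \<chi>)"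
proof -
  interpret G: group G by fact
  have "(\<Sum>x\<in>carrier G. \<phi> x * \<psi> (inv\<^bsub>G\<^esub> x)) =
      (\<Sum>x\<in>carrier G. \<Sum>\<chi>\<in>S. \<Sum>\<theta>\<in>S. of_int (m \<chi>) * of_int (l \<theta>) * (\<chi> x * \<theta> (inv\<^bsub>G\<^esub> x)))"
    by (intro sum.cong refl) (simp add: \<phi> \<psi> sum_product mult_ac)
  also have "\<dots> = (\<Sum>\<chi>\<in>S. \<Sum>\<theta>\<in>S. of_int (m \<chi>) * of_int (l \<theta>) * (\<Sum>x\<in>carrier G. \<chi> x * \<theta> (inv\<^bsub>G\<^esub> x)))"
    unfolding sum_distrib_left by (subst sum.swap, rule sum.cong[OF refl], subst sum.swap, rule refl)
  also have "\<dots> = (\<Sum>\<chi>\<in>S. \<Sum>\<theta>\<in>S. if \<chi> = \<theta> then of_int (m \<chi>) * of_int (l \<theta>) * of_nat (card (carrier G)) else 0)"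
    using S by (intro sum.cong refl) (auto simp: irreducible_characters_orthogonal[OF G fin] subset_iff)
  also have "\<dots> = of_nat (card (carrier G)) * of_int (\<Sum>\<chi>\<in>S. m \<chi> * l \<chi>)"
    using S(1) by (simp add: sum.delta sum_distrib_left mult_ac)
  finally show ?thesis .
qed

lemma sum_squares_eq_1D:
  fixes m :: "'a \<Rightarrow> int"
  assumes "finite S" "(\<Sum>x\<in>S. m x * m x) = 1"
  obtains a where "a \<in> S" "m a * m a = 1" "\<And>x. x \<in> S \<Longrightarrow> x \<noteq> a \<Longrightarrow> m x = 0"
proof -
  obtain a where a: "a \<in> S" "m a \<noteq> 0"
  proof -
    have "\<not> (\<forall>a\<in>S. m a = 0)"
    proof
      assume "\<forall>a\<in>S. m a = 0"
      then have "(\<Sum>x\<in>S. m x * m x) = 0" by (intro sum.neutral) simp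
      then show False using assms(2) by simp
    qed
    then show thesis using that by blast
  qed
  have s: "m a * m a + (\<Sum>x\<in>S - {a}. m x * m x) = 1"
    using assms a by (simp add: sum.remove)
  have n: "(\<Sum>x\<in>S - {a}. m x * m x) \<ge> 0" by (intro sum_nonneg) auto
  have "m a * m a \<noteq> 0" "m a * m a \<ge> 0" using a by simp_all
  then have p: "m a * m a \<ge> 1" by linarith
  have z: "(\<Sum>x\<in>S - {a}. m x * m x) = 0" using s n p by linarith
  then have "\<And>x. x \<in> S \<Longrightarrow> x \<noteq> a \<Longrightarrow> m x = 0"
    using assms(1) by (subst (asm) sum_nonneg_eq_0_iff) auto
  then show thesis using that a s z by auto
qed

text \<open>The squared coefficients sum to 1, so exactly one irreducible character occurs, with
  coefficient 1 or -1. Recording \<open>e \<noteq> 0\<close> is enough to transfer zeros.\<close>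

lemma norm_1_irreducible:
  assumes G: "group G" and fin: "finite (carrier G)" and \<phi>: "virtual_character G \<phi>"
    and norm: "(\<Sum>x\<in>carrier G. \<phi> x * \<phi> (inv\<^bsub>G\<^esub> x)) = of_nat (card (carrier G))"
  obtains \<chi> e where "\<chi> \<in> irreducible_characters G" "e \<noteq> 0"
    "\<And>x. x \<in> carrier G \<Longrightarrow> \<phi> x = of_int e * \<chi> x"
proof -
  interpret G: group G by fact
  obtain S m where S: "finite S" "S \<subseteq> irreducible_characters G"
    "\<And>x. x \<in> carrier G \<Longrightarrow> \<phi> x = (\<Sum>\<chi>\<in>S. of_int (m \<chi>) * \<chi> x)"
    using \<phi> unfolding virtual_character_def by blast
  have "card (carrier G) > 0" using fin G.one_closed by (auto simp: card_gt_0_iff)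
  moreover have "of_nat (card (carrier G)) * of_int (\<Sum>\<chi>\<in>S. m \<chi> * m \<chi>) = (of_nat (card (carrier G)) :: complex)"
    using virtual_character_inner[OF G fin S(1,2) S(3) S(3)] norm by simp
  ultimately have "of_int (\<Sum>\<chi>\<in>S. m \<chi> * m \<chi>) = (1 :: complex)" by simp
  then have "(\<Sum>\<chi>\<in>S. m \<chi> * m \<chi>) = 1" using of_int_eq_1_iff by blast
  then obtain \<chi> where \<chi>: "\<chi> \<in> S" "m \<chi> * m \<chi> = 1" "\<And>x. x \<in> S \<Longrightarrow> x \<noteq> \<chi> \<Longrightarrow> m x = 0"
    using sum_squares_eq_1D[OF S(1)] by metis
  have "\<phi> x = of_int (m \<chi>) * \<chi> x" if "x \<in> carrier G" for x
    using S(1) \<chi> by (subst S(3)[OF that], subst sum.remove[OF S(1) \<chi>(1)]) auto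
  moreover have "m \<chi> \<noteq> 0" using \<chi>(2) by auto
  ultimately show thesis using that \<chi>(1) S(2) by blast
qed

lemma vanishing_if_norm_1:
  assumes G: "group G" and fin: "finite (carrier G)" and \<phi>: "virtual_character G \<phi>"
    and norm: "(\<Sum>x\<in>carrier G. \<phi> x * \<phi> (inv\<^bsub>G\<^esub> x)) = of_nat (card (carrier G))"
    and g: "g \<in> carrier G" "\<phi> g = 0"
  shows "vanishing G g"
proof -
  obtain \<chi> e where \<chi>: "\<chi> \<in> irreducible_characters G" "e \<noteq> 0"
    "\<And>x. x \<in> carrier G \<Longrightarrow> \<phi> x = of_int e * \<chi> x"
    using norm_1_irreducible[OF G fin \<phi> norm] by blast
  then have "\<chi> g = 0" using g by simp
  then show ?thesis using \<chi>(1) g(1) by (auto simp: vanishing_def)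
qed

text \<open>Serves for a character of A_5 that is not irreducible, where norm 1 cannot be
  invoked.\<close>

lemma exists_constituent:
  assumes G: "group G" and fin: "finite (carrier G)" and \<phi>: "virtual_character G \<phi>"
    and x: "x \<in> carrier G" "\<phi> x \<noteq> 0"
  obtains \<chi> where "\<chi> \<in> irreducible_characters G" "(\<Sum>x\<in>carrier G. \<phi> x * \<chi> (inv\<^bsub>G\<^esub> x)) \<noteq> 0"
proof -
  interpret G: group G by fact
  obtain S m where S: "finite S" "S \<subseteq> irreducible_characters G"
    "\<And>x. x \<in> carrier G \<Longrightarrow> \<phi> x = (\<Sum>\<chi>\<in>S. of_int (m \<chi>) * \<chi> x)"
    using \<phi> unfolding virtual_character_def by blast
  have "\<exists>\<chi>\<in>S. m \<chi> \<noteq> 0"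
  proof (rule ccontr)
    assume "\<not> ?thesis"
    then have "\<phi> x = 0" unfolding S(3)[OF x(1)] by simp
    then show False using x(2) by simp
  qed
  then obtain \<chi> where \<chi>: "\<chi> \<in> S" "m \<chi> \<noteq> 0" by blast
  have "\<chi> x = (\<Sum>\<theta>\<in>S. of_int (if \<theta> = \<chi> then 1 else 0) * \<theta> x)" for x
  proof -
    have "(\<Sum>\<theta>\<in>S. of_int (if \<theta> = \<chi> then 1 else 0) * \<theta> x) = (\<Sum>\<theta>\<in>S. if \<theta> = \<chi> then \<chi> x else 0)"
      by (intro sum.cong) auto
    then show ?thesis using S(1) \<chi>(1) by (simp add: sum.delta)
  qed
  from virtual_character_inner[OF G fin S this]
  have "(\<Sum>x\<in>carrier G. \<phi> x * \<chi> (inv\<^bsub>G\<^esub> x)) =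
      of_nat (card (carrier G)) * of_int (\<Sum>\<theta>\<in>S. m \<theta> * (if \<theta> = \<chi> then 1 else 0))" by blast
  also have "(\<Sum>\<theta>\<in>S. m \<theta> * (if \<theta> = \<chi> then 1 else 0)) = (\<Sum>\<theta>\<in>S. if \<theta> = \<chi> then m \<chi> else 0)"
    by (intro sum.cong) auto
  also have "\<dots> = m \<chi>" using S(1) \<chi>(1) by (simp add: sum.delta)
  finally have "(\<Sum>x\<in>carrier G. \<phi> x * \<chi> (inv\<^bsub>G\<^esub> x)) = of_nat (card (carrier G)) * of_int (m \<chi>)" .
  moreover have "card (carrier G) > 0" using fin G.one_closed by (auto simp: card_gt_0_iff)
  ultimately show thesis using that[of \<chi>] \<chi> S(2) by auto
qed

lemma irreducible_character_conjugate:
  assumes G: "group G" and \<chi>: "\<chi> \<in> irreducible_characters G" and g: "g \<in> carrier G" and h: "h \<in> carrier G"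
  shows "\<chi> (h \<otimes>\<^bsub>G\<^esub> g \<otimes>\<^bsub>G\<^esub> inv\<^bsub>G\<^esub> h) = \<chi> g"
proof -
  interpret G: group G by fact
  obtain d \<rho> where \<rho>: "irreducible_rep G d \<rho>" "\<chi> = restrict (\<lambda>x. mat_trace (\<rho> x)) (carrier G)"
    using \<chi> by (auto simp: irreducible_characters_def)
  have mr: "mat_rep G d \<rho>" using \<rho>(1) irreducible_rep_iff[OF G] by blast
  have c: "\<rho> x \<in> carrier_mat d d" if "x \<in> carrier G" for x using mr that by (auto simp: mat_rep_def)
  have m: "\<rho> (x \<otimes>\<^bsub>G\<^esub> y) = \<rho> x * \<rho> y" if "x \<in> carrier G" "y \<in> carrier G" for x y
    using mr that by (auto simp: mat_rep_def)
  have hi: "inv\<^bsub>G\<^esub> h \<in> carrier G" using h by simp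
  have "mat_trace (\<rho> (h \<otimes>\<^bsub>G\<^esub> g \<otimes>\<^bsub>G\<^esub> inv\<^bsub>G\<^esub> h)) = mat_trace (\<rho> (h \<otimes>\<^bsub>G\<^esub> g) * \<rho> (inv\<^bsub>G\<^esub> h))"
    using m g h hi by simp
  also have "\<dots> = mat_trace (\<rho> (inv\<^bsub>G\<^esub> h) * \<rho> (h \<otimes>\<^bsub>G\<^esub> g))"
    using c[OF hi] c[of "h \<otimes>\<^bsub>G\<^esub> g"] g h by (intro mat_trace_mult_comm[of _ d d]) simp_all
  also have "\<rho> (inv\<^bsub>G\<^esub> h) * \<rho> (h \<otimes>\<^bsub>G\<^esub> g) = \<rho> (inv\<^bsub>G\<^esub> h \<otimes>\<^bsub>G\<^esub> (h \<otimes>\<^bsub>G\<^esub> g))"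
    using m[OF hi, of "h \<otimes>\<^bsub>G\<^esub> g"] g h by simp
  also have "inv\<^bsub>G\<^esub> h \<otimes>\<^bsub>G\<^esub> (h \<otimes>\<^bsub>G\<^esub> g) = g" using g h by (simp add: G.m_assoc[symmetric])
  finally show ?thesis using \<rho>(2) g h by simp
qed

text \<open>The trace of a permutation matrix counts fixed points.\<close>

lemma virtual_character_permutation:
  assumes G: "group G" and fin: "finite \<Omega>"
    and cl: "\<And>x \<omega>. x \<in> carrier G \<Longrightarrow> \<omega> \<in> \<Omega> \<Longrightarrow> act x \<omega> \<in> \<Omega>"
    and mult: "\<And>x y \<omega>. x \<in> carrier G \<Longrightarrow> y \<in> carrier G \<Longrightarrow> \<omega> \<in> \<Omega> \<Longrightarrow> act (x \<otimes>\<^bsub>G\<^esub> y) \<omega> = act x (act y \<omega>)"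
    and one: "\<And>\<omega>. \<omega> \<in> \<Omega> \<Longrightarrow> act \<one>\<^bsub>G\<^esub> \<omega> = \<omega>"
  shows "virtual_character G (\<lambda>x. of_nat (card {\<omega>\<in>\<Omega>. act x \<omega> = \<omega>}))"
proof -
  define d where "d = card \<Omega>"
  obtain e where e: "bij_betw e {..<d} \<Omega>"
    using ex_bij_betw_nat_finite[OF fin] by (auto simp: d_def atLeast0LessThan)
  have e\<Omega>: "e i \<in> \<Omega>" if "i < d" for i using e that by (auto simp: bij_betw_def)
  have einj: "e i = e j \<longleftrightarrow> i = j" if "i < d" "j < d" for i j
    using e that by (auto simp: bij_betw_def inj_on_def)
  define \<rho> where "\<rho> x = mat d d (\<lambda>(i, j). if e i = act x (e j) then 1 else (0 :: complex))" for x
  have "mat_rep G d \<rho>"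
    unfolding mat_rep_def
  proof (intro conjI ballI)
    fix x y assume x: "x \<in> carrier G" and y: "y \<in> carrier G"
    show "\<rho> (x \<otimes>\<^bsub>G\<^esub> y) = \<rho> x * \<rho> y"
    proof (rule eq_matI)
      fix i j assume "i < dim_row (\<rho> x * \<rho> y)" "j < dim_col (\<rho> x * \<rho> y)"
      then have ij: "i < d" "j < d" by (auto simp: \<rho>_def)
      obtain l where l: "l < d" "e l = act y (e j)"
        using e cl[OF y e\<Omega>[OF ij(2)]] by (auto simp: bij_betw_def)
      have "(\<rho> x * \<rho> y) $$ (i, j) = (\<Sum>k<d. \<rho> x $$ (i, k) * \<rho> y $$ (k, j))"
        by (rule index_mult_mat_sum[of _ d d _ d]) (use ij in \<open>auto simp: \<rho>_def\<close>)
      also have "\<dots> = (\<Sum>k<d. if k = l then \<rho> x $$ (i, l) else 0)"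
        by (intro sum.cong) (use ij l in \<open>auto simp: \<rho>_def l(2)[symmetric] einj\<close>)
      also have "\<dots> = \<rho> x $$ (i, l)" using l by (simp add: sum.delta)
      also have "\<dots> = \<rho> (x \<otimes>\<^bsub>G\<^esub> y) $$ (i, j)"
        using ij l mult[OF x y e\<Omega>[OF ij(2)]] by (simp add: \<rho>_def)
      finally show "\<rho> (x \<otimes>\<^bsub>G\<^esub> y) $$ (i, j) = (\<rho> x * \<rho> y) $$ (i, j)" by simp
    qed (auto simp: \<rho>_def)
  next
    show "\<rho> \<one>\<^bsub>G\<^esub> = 1\<^sub>m d"
      by (intro eq_matI) (auto simp: \<rho>_def one e\<Omega> einj)
  qed (auto simp: \<rho>_def)
  moreover have "mat_trace (\<rho> x) = of_nat (card {\<omega>\<in>\<Omega>. act x \<omega> = \<omega>})" for x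
  proof -
    have "mat_trace (\<rho> x) = (\<Sum>i<d. if act x (e i) = e i then 1 else 0)"
      by (auto simp: mat_trace_def \<rho>_def intro!: sum.cong)
    also have "\<dots> = (\<Sum>\<omega>\<in>\<Omega>. if act x \<omega> = \<omega> then 1 else 0)"
      by (rule sum.reindex_bij_betw[OF e])
    also have "\<dots> = of_nat (card {\<omega>\<in>\<Omega>. act x \<omega> = \<omega>})"
      using fin by (simp add: sum.If_cases Int_def)
    finally show ?thesis .
  qed
  ultimately show ?thesis
    using mat_rep_character[OF G, of d \<rho>] by simp
qed

section \<open>Frobenius' virtual characters of symmetric groups\<close>

text \<open>Ordered set partitions with block sizes \<open>\<alpha>\<close>, that is, the cosets of
  a Young subgroup. The sizes are integers because they arise as differences
  \<open>\<beta> i - w i\<close>.\<close>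

definition colorings :: "'a set \<Rightarrow> nat \<Rightarrow> (nat \<Rightarrow> int) \<Rightarrow> ('a \<Rightarrow> nat) set"
  where "colorings S k \<alpha> = {c \<in> S \<rightarrow>\<^sub>E {..<k}. \<forall>i<k. int (card {x\<in>S. c x = i}) = \<alpha> i}"

text \<open>As a function of \<open>p\<close>, its cardinality is the permutation character induced
  from the Young subgroup.\<close>

definition fixed_colorings :: "'a set \<Rightarrow> ('a \<Rightarrow> 'a) \<Rightarrow> nat \<Rightarrow> (nat \<Rightarrow> int) \<Rightarrow> ('a \<Rightarrow> nat) set"
  where "fixed_colorings S p k \<alpha> = {c \<in> colorings S k \<alpha>. \<forall>x\<in>S. c (p x) = c x}"

text \<open>If the \<open>\<beta> i\<close> are distinct and nonnegative with sum \<open>n + k (k - 1) / 2\<close>, this is, up to sign, the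
  irreducible character of \<open>S\<^sub>n\<close> of the partition whose \<open>\<beta>\<close>-set (set of beads) they form: it is the
  Jacobi-Trudi determinant in the permutation characters on colourings. Negative class sizes
  contribute 0 because there are no such colourings.\<close>

definition frobenius_char :: "'a set \<Rightarrow> ('a \<Rightarrow> 'a) \<Rightarrow> nat \<Rightarrow> (nat \<Rightarrow> int) \<Rightarrow> int"
  where "frobenius_char S p k \<beta> = (\<Sum>w | w permutes {..<k}.
    sign w * int (card (fixed_colorings S p k (\<lambda>i. \<beta> i - int (w i)))))"

section \<open>Alternation in the beads and removal of a cycle\<close>

lemma finite_colorings: "finite S \<Longrightarrow> finite (colorings S k \<alpha>)"
  unfolding colorings_def by (rule finite_subset[of _ "S \<rightarrow>\<^sub>E {..<k}"]) (auto intro: finite_PiE)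

lemma finite_fixed_colorings: "finite S \<Longrightarrow> finite (fixed_colorings S p k \<alpha>)"
  unfolding fixed_colorings_def by (simp add: finite_colorings)

lemma fixed_colorings_cong:
  "(\<And>i. i < k \<Longrightarrow> \<alpha> i = \<alpha>' i) \<Longrightarrow> fixed_colorings S p k \<alpha> = fixed_colorings S p k \<alpha>'"
  unfolding fixed_colorings_def colorings_def by auto

lemma frobenius_char_cong:
  "(\<And>i. i < k \<Longrightarrow> \<beta> i = \<beta>' i) \<Longrightarrow> frobenius_char S p k \<beta> = frobenius_char S p k \<beta>'"
  unfolding frobenius_char_def
  by (intro sum.cong refl arg_cong2[of _ _ _ _ "(*)"] arg_cong[of _ _ int] arg_cong[of _ _ card] fixed_colorings_cong) simp

lemma fixed_colorings_neg:
  "i < k \<Longrightarrow> \<alpha> i < 0 \<Longrightarrow> fixed_colorings S p k \<alpha> = {}"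
  unfolding fixed_colorings_def colorings_def by force

lemma frobenius_char_neg:
  assumes "i < k" "\<beta> i < 0"
  shows "frobenius_char S p k \<beta> = 0"
  unfolding frobenius_char_def using assms
  by (intro sum.neutral ballI) (simp add: fixed_colorings_neg[of i])

lemma card_fixed_colorings_permute:
  assumes p: "p ` S \<subseteq> S" and t: "t permutes {..<k}"
  shows "card (fixed_colorings S p k (\<alpha> \<circ> t)) = card (fixed_colorings S p k \<alpha>)"
proof (rule bij_betw_same_card)
  have tk: "t i < k \<longleftrightarrow> i < k" for i using permutes_in_image[OF t, of i] by simp
  have tinv: "inv' t permutes {..<k}" using t by (rule permutes_inv)
  have tik: "inv' t i < k \<longleftrightarrow> i < k" for i using permutes_in_image[OF tinv, of i] by simp
  have t1: "t (inv' t i) = i" "inv' t (t i) = i" for i using permutes_inverses[OF t] by auto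
  show "bij_betw (\<lambda>c. restrict (t \<circ> c) S) (fixed_colorings S p k (\<alpha> \<circ> t)) (fixed_colorings S p k \<alpha>)"
  proof (rule bij_betwI[where g = "\<lambda>c. restrict (inv' t \<circ> c) S"])
    show "(\<lambda>c. restrict (t \<circ> c) S) \<in> fixed_colorings S p k (\<alpha> \<circ> t) \<rightarrow> fixed_colorings S p k \<alpha>"
    proof
      fix c assume c: "c \<in> fixed_colorings S p k (\<alpha> \<circ> t)"
      have "int (card {x\<in>S. restrict (t \<circ> c) S x = i}) = \<alpha> i" if "i < k" for i
      proof -
        have "{x\<in>S. restrict (t \<circ> c) S x = i} = {x\<in>S. c x = inv' t i}" using t1 by auto
        then show ?thesis using c that tik[of i] t1 by (simp add: fixed_colorings_def colorings_def)
      qed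
      then show "restrict (t \<circ> c) S \<in> fixed_colorings S p k \<alpha>"
        using c p tk by (auto simp: fixed_colorings_def colorings_def image_subset_iff)
    qed
    show "(\<lambda>c. restrict (inv' t \<circ> c) S) \<in> fixed_colorings S p k \<alpha> \<rightarrow> fixed_colorings S p k (\<alpha> \<circ> t)"
    proof
      fix c assume c: "c \<in> fixed_colorings S p k \<alpha>"
      have "int (card {x\<in>S. restrict (inv' t \<circ> c) S x = i}) = \<alpha> (t i)" if "i < k" for i
      proof -
        have "{x\<in>S. restrict (inv' t \<circ> c) S x = i} = {x\<in>S. c x = t i}" using t1 by auto
        then show ?thesis using c that tk[of i] t1 by (simp add: fixed_colorings_def colorings_def)
      qed
      then show "restrict (inv' t \<circ> c) S \<in> fixed_colorings S p k (\<alpha> \<circ> t)"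
        using c p tik by (auto simp: fixed_colorings_def colorings_def image_subset_iff)
    qed
  qed (auto simp: fixed_colorings_def colorings_def t1 fun_eq_iff PiE_def extensional_def)
qed

text \<open>A determinant is alternating in its rows: shift the summation variable by
  \<open>t\<close> and rename the colours.\<close>

lemma frobenius_char_permute:
  assumes p: "p ` S \<subseteq> S" and t: "t permutes {..<k}"
  shows "frobenius_char S p k (\<beta> \<circ> t) = sign t * frobenius_char S p k \<beta>"
proof -
  have t1: "inv' t (t i) = i" "t (inv' t i) = i" for i using permutes_inverses[OF t] by auto
  have "frobenius_char S p k (\<beta> \<circ> t) = (\<Sum>w | w permutes {..<k}.
      sign (w \<circ> t) * int (card (fixed_colorings S p k (\<lambda>i. \<beta> (t i) - int (w (t i))))))"
    unfolding frobenius_char_def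
    by (subst sum_permutations_compose_right[OF t]) simp
  also have "\<dots> = (\<Sum>w | w permutes {..<k}.
      sign t * (sign w * int (card (fixed_colorings S p k (\<lambda>i. \<beta> i - int (w i))))))"
  proof (intro sum.cong refl)
    fix w assume "w \<in> {w. w permutes {..<k}}"
    then have w: "w permutes {..<k}" by simp
    have "sign (w \<circ> t) = sign w * sign t"
      using w t by (intro sign_compose) (auto simp: permutation_permutes)
    then show "sign (w \<circ> t) * int (card (fixed_colorings S p k (\<lambda>i. \<beta> (t i) - int (w (t i))))) =
        sign t * (sign w * int (card (fixed_colorings S p k (\<lambda>i. \<beta> i - int (w i)))))"
      using card_fixed_colorings_permute[OF p t, of "\<lambda>i. \<beta> i - int (w i)"] by (simp add: o_def)
  qed
  finally show ?thesis by (simp add: frobenius_char_def sum_distrib_left)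
qed

text \<open>A determinant with two equal rows; in terms of beads, two of them collide.\<close>

lemma frobenius_char_repeated:
  assumes p: "p ` S \<subseteq> S" and ij: "i < k" "j < k" "i \<noteq> j" "\<beta> i = \<beta> j"
  shows "frobenius_char S p k \<beta> = 0"
proof -
  have t: "transpose i j permutes {..<k}" using ij by (auto intro: permutes_swap_id)
  have "\<beta> \<circ> transpose i j = \<beta>" using ij by (auto simp: fun_eq_iff transpose_def)
  then have "frobenius_char S p k \<beta> = - frobenius_char S p k \<beta>"
    using frobenius_char_permute[OF p t, of \<beta>] ij by (simp add: sign_swap_id)
  then show ?thesis by simp
qed

text \<open>A colouring fixed by \<open>p\<close> is constant on the orbit \<open>C\<close>. If
  \<open>C\<close> has colour \<open>i\<close>, deleting \<open>C\<close> lowers the size of class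
  \<open>i\<close> and of no other class.\<close>

lemma card_fixed_colorings_orbit:
  assumes S: "finite S" and C: "C \<subseteq> S" "a \<in> C"
    and pC: "\<And>x. x \<in> C \<Longrightarrow> p x \<in> C" and pD: "\<And>x. x \<in> S - C \<Longrightarrow> p x \<in> S - C"
    and orb: "\<And>x. x \<in> C \<Longrightarrow> \<exists>m. x = (p ^^ m) a"
  shows "card (fixed_colorings S p k \<alpha>) =
    (\<Sum>i<k. card (fixed_colorings (S - C) p k (\<alpha>(i := \<alpha> i - int (card C)))))"
proof -
  let ?F = "fixed_colorings S p k \<alpha>"
  have const: "c x = c a" if c: "c \<in> ?F" and x: "x \<in> C" for c x
  proof -
    have "(p ^^ m) a \<in> C \<and> c ((p ^^ m) a) = c a" for m
    proof (induction m)
      case (Suc m)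
      then show ?case using c pC C by (auto simp: fixed_colorings_def)
    qed (use C in auto)
    then show ?thesis using orb[OF x] by metis
  qed
  have fC: "finite C" using C S finite_subset by blast
  have part: "?F = (\<Union>i\<in>{..<k}. {c\<in>?F. c a = i})"
    using C by (auto simp: fixed_colorings_def colorings_def PiE_def Pi_def)
  have "card ?F = (\<Sum>i<k. card {c\<in>?F. c a = i})"
    by (subst part, rule card_UN_disjoint) (auto simp: finite_fixed_colorings[OF S])
  also have "\<dots> = (\<Sum>i<k. card (fixed_colorings (S - C) p k (\<alpha>(i := \<alpha> i - int (card C)))))"
  proof (rule sum.cong[OF refl])
    fix i assume "i \<in> {..<k}"
    then have i: "i < k" by simp
    let ?\<alpha> = "\<alpha>(i := \<alpha> i - int (card C))"
    have "bij_betw (\<lambda>c. restrict c (S - C)) {c\<in>?F. c a = i} (fixed_colorings (S - C) p k ?\<alpha>)"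
    proof (rule bij_betwI[where g = "\<lambda>c x. if x \<in> C then i else c x"])
      show "(\<lambda>c. restrict c (S - C)) \<in> {c\<in>?F. c a = i} \<rightarrow> fixed_colorings (S - C) p k ?\<alpha>"
      proof
        fix c assume "c \<in> {c\<in>?F. c a = i}"
        then have c: "c \<in> ?F" and ca: "c a = i" by auto
        have "int (card {x\<in>S - C. restrict c (S - C) x = j}) = ?\<alpha> j" if j: "j < k" for j
        proof -
          have r: "{x\<in>S - C. restrict c (S - C) x = j} = {x\<in>S - C. c x = j}" by auto
          have e: "{x\<in>S. c x = j} = {x\<in>S - C. c x = j} \<union> (if j = i then C else {})"
            using const[OF c] ca C by auto
          have "card {x\<in>S. c x = j} = card {x\<in>S - C. c x = j} + (if j = i then card C else 0)"
            unfolding e using S fC by (subst card_Un_disjoint) auto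
          moreover have "int (card {x\<in>S. c x = j}) = \<alpha> j"
            using c j by (simp add: fixed_colorings_def colorings_def)
          ultimately show ?thesis unfolding r by (auto split: if_splits)
        qed
        then show "restrict c (S - C) \<in> fixed_colorings (S - C) p k ?\<alpha>"
          using c pD by (auto simp: fixed_colorings_def colorings_def PiE_def Pi_def)
      qed
      show "(\<lambda>c x. if x \<in> C then i else c x) \<in> fixed_colorings (S - C) p k ?\<alpha> \<rightarrow> {c\<in>?F. c a = i}"
      proof
        fix c assume c: "c \<in> fixed_colorings (S - C) p k ?\<alpha>"
        let ?c = "\<lambda>x. if x \<in> C then i else c x"
        have "int (card {x\<in>S. ?c x = j}) = \<alpha> j" if j: "j < k" for j
        proof -
          have e: "{x\<in>S. ?c x = j} = {x\<in>S - C. c x = j} \<union> (if j = i then C else {})"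
            using C by auto
          have "card {x\<in>S. ?c x = j} = card {x\<in>S - C. c x = j} + (if j = i then card C else 0)"
            unfolding e using S fC by (subst card_Un_disjoint) auto
          moreover have "int (card {x\<in>S - C. c x = j}) = ?\<alpha> j"
            using c j by (simp add: fixed_colorings_def colorings_def)
          ultimately show ?thesis by (auto split: if_splits)
        qed
        moreover have "?c \<in> S \<rightarrow>\<^sub>E {..<k}"
          using c i C by (auto simp: fixed_colorings_def colorings_def PiE_def Pi_def extensional_def)
        ultimately show "?c \<in> {c\<in>?F. c a = i}"
          using c pC pD C by (auto simp: fixed_colorings_def colorings_def)
      qed
      show "(\<lambda>x. if x \<in> C then i else restrict c (S - C) x) = c" if "c \<in> {c\<in>?F. c a = i}" for c
      proof
        fix x show "(if x \<in> C then i else restrict c (S - C) x) = c x"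
          using that const[of c x] by (auto simp: fixed_colorings_def colorings_def PiE_def extensional_def)
      qed
      show "restrict (\<lambda>x. if x \<in> C then i else c x) (S - C) = c" if "c \<in> fixed_colorings (S - C) p k ?\<alpha>" for c
        using that by (auto simp: fixed_colorings_def colorings_def PiE_def extensional_def fun_eq_iff)
    qed
    then show "card {c\<in>?F. c a = i} = card (fixed_colorings (S - C) p k ?\<alpha>)"
      by (rule bij_betw_same_card)
  qed
  finally show ?thesis .
qed

text \<open>The Murnaghan-Nakayama rule on beads. Lowering class \<open>i\<close> does not interfere
  with \<open>w\<close>, so it passes through the determinant and lowers \<open>\<beta> i\<close>.
  Moves to a negative or an occupied position will drop out by \<open>frobenius_char_neg\<close> and
  \<open>frobenius_char_repeated\<close>.\<close>

lemma frobenius_char_orbit: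
  assumes "finite S" "C \<subseteq> S" "a \<in> C"
    "\<And>x. x \<in> C \<Longrightarrow> p x \<in> C" "\<And>x. x \<in> S - C \<Longrightarrow> p x \<in> S - C" "\<And>x. x \<in> C \<Longrightarrow> \<exists>m. x = (p ^^ m) a"
  shows "frobenius_char S p k \<beta> = (\<Sum>i<k. frobenius_char (S - C) p k (\<beta>(i := \<beta> i - int (card C))))"
proof -
  have e: "(\<lambda>i. \<beta> i - int (w i))(i := \<beta> i - int (w i) - int (card C)) =
      (\<lambda>j. (\<beta>(i := \<beta> i - int (card C))) j - int (w j))" for w i
    by auto
  have c: "int (card (fixed_colorings S p k (\<lambda>i. \<beta> i - int (w i)))) = (\<Sum>i<k. int (card (fixed_colorings (S - C) p k
      (\<lambda>j. (\<beta>(i := \<beta> i - int (card C))) j - int (w j)))))" for w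
    using card_fixed_colorings_orbit[of S C a p k "\<lambda>i. \<beta> i - int (w i)", OF assms] unfolding e by simp
  show ?thesis
    unfolding frobenius_char_def c sum_distrib_left by (rule sum.swap)
qed

section \<open>Inner products of the permutation characters on colourings\<close>

lemma exists_function_of_type:
  assumes S: "finite S" and K: "finite K" and M: "(\<Sum>c\<in>K. M c) = card S"
  shows "\<exists>e\<in>S \<rightarrow>\<^sub>E K. \<forall>c\<in>K. card {x\<in>S. e x = c} = M c"
proof -
  let ?T = "Sigma K (\<lambda>c. {..<M c})"
  have "card ?T = card S" using K M by simp
  moreover have "finite ?T" using K by auto
  ultimately obtain h where h: "bij_betw h S ?T"
    using S finite_same_card_bij by metis
  let ?e = "restrict (fst \<circ> h) S"
  have hT: "h x \<in> ?T" if "x \<in> S" for x using h that by (auto simp: bij_betw_def)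
  then have "fst (h x) \<in> K" if "x \<in> S" for x using that by fastforce
  then have "?e \<in> S \<rightarrow>\<^sub>E K" by auto
  moreover have "card {x\<in>S. ?e x = c} = M c" if "c \<in> K" for c
  proof -
    have "h ` {x\<in>S. ?e x = c} = {c} \<times> {..<M c}"
    proof
      show "h ` {x\<in>S. ?e x = c} \<subseteq> {c} \<times> {..<M c}"
      proof
        fix y assume "y \<in> h ` {x\<in>S. ?e x = c}"
        then obtain x where x: "x \<in> S" "fst (h x) = c" "y = h x" by auto
        then show "y \<in> {c} \<times> {..<M c}" using hT[OF x(1)] by (cases "h x") auto
      qed
      show "{c} \<times> {..<M c} \<subseteq> h ` {x\<in>S. ?e x = c}"
      proof
        fix y assume y: "y \<in> {c} \<times> {..<M c}"
        then have "y \<in> h ` S" using h that by (auto simp: bij_betw_def)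
        then obtain x where x: "x \<in> S" "y = h x" by blast
        have "fst (h x) = c" using y x(2) by force
        then have "x \<in> {x\<in>S. ?e x = c}" using x(1) by simp
        then show "y \<in> h ` {x\<in>S. ?e x = c}" using x(2) by blast
      qed
    qed
    moreover have "inj_on h {x\<in>S. ?e x = c}" using h by (auto simp: bij_betw_def inj_on_def)
    ultimately have "card {x\<in>S. ?e x = c} = card ({c} \<times> {..<M c})"
      using card_image[of h "{x\<in>S. ?e x = c}"] by simp
    then show ?thesis by (simp add: card_cartesian_product)
  qed
  ultimately show ?thesis by blast
qed

lemma exists_permutation_of_functions:
  assumes S: "finite S" and e: "e \<in> S \<rightarrow>\<^sub>E K" and e': "e' \<in> S \<rightarrow>\<^sub>E K"
    and eq: "\<And>c. c \<in> K \<Longrightarrow> card {x\<in>S. e x = c} = card {x\<in>S. e' x = c}"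
  shows "\<exists>q. q permutes S \<and> (\<forall>x\<in>S. e (q x) = e' x)"
proof -
  have "\<forall>c\<in>K. \<exists>h. bij_betw h {x\<in>S. e' x = c} {x\<in>S. e x = c}"
    using eq S by (intro ballI finite_same_card_bij) auto
  then obtain h where h: "\<And>c. c \<in> K \<Longrightarrow> bij_betw (h c) {x\<in>S. e' x = c} {x\<in>S. e x = c}" by metis
  define q where "q x = (if x \<in> S then h (e' x) x else x)" for x
  have q1: "q x \<in> S \<and> e (q x) = e' x" if "x \<in> S" for x
  proof -
    have "e' x \<in> K" using e' that by auto
    from h[OF this] have "h (e' x) x \<in> {y\<in>S. e y = e' x}" using that by (auto simp: bij_betw_def)
    then show ?thesis using that by (simp add: q_def)
  qed
  have "inj_on q S"
  proof (rule inj_onI)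
    fix x y assume x: "x \<in> S" and y: "y \<in> S" and q: "q x = q y"
    have "e' x = e' y" using q1[OF x] q1[OF y] q by simp
    moreover have "inj_on (h (e' x)) {z\<in>S. e' z = e' x}"
      using h[of "e' x"] e' x by (auto simp: bij_betw_def)
    ultimately show "x = y" using q x y by (auto simp: q_def inj_on_def)
  qed
  moreover from this have "q ` S = S" using endo_inj_surj[OF S, of q] q1 by auto
  ultimately have "q permutes S"
    by (intro bij_imp_permutes) (auto simp: bij_betw_def q_def)
  then show ?thesis using q1 by blast
qed

text \<open>Burnside's orbit count for the transitive action on the functions of one type. The
  stabilizer of \<open>e\<close> has as many elements as the set of permutations carrying
  \<open>e0\<close> to \<open>e\<close>, and these sets partition the whole group.\<close>

lemma sum_fixed_functions_of_type:
  assumes S: "finite S" and K: "finite K" and M: "(\<Sum>c\<in>K. M c) = card S"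
  shows "(\<Sum>p | p permutes S. card {e\<in>S \<rightarrow>\<^sub>E K. (\<forall>c\<in>K. card {x\<in>S. e x = c} = M c) \<and> (\<forall>x\<in>S. e (p x) = e x)})
    = fact (card S)"
proof -
  define E where "E = {e\<in>S \<rightarrow>\<^sub>E K. \<forall>c\<in>K. card {x\<in>S. e x = c} = M c}"
  let ?P = "{p. p permutes S}"
  have fE: "finite E"
    unfolding E_def by (rule finite_subset[of _ "S \<rightarrow>\<^sub>E K"]) (use S K in \<open>auto intro: finite_PiE\<close>)
  have fP: "finite ?P" using S by (rule finite_permutations)
  obtain e0 where e0: "e0 \<in> E" using exists_function_of_type[OF S K M] by (auto simp: E_def)
  have same: "card {p\<in>?P. \<forall>x\<in>S. e (p x) = e x} = card {q\<in>?P. \<forall>x\<in>S. e0 (q x) = e x}" if e: "e \<in> E" for e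
  proof -
    obtain q where q: "q permutes S" "\<forall>x\<in>S. e0 (q x) = e x"
      using exists_permutation_of_functions[OF S, of e0 K e] e0 e by (auto simp: E_def)
    have qi: "inv' q permutes S" using q(1) by (rule permutes_inv)
    have q1: "q (inv' q x) = x" "inv' q (q x) = x" for x using permutes_inverses[OF q(1)] by auto
    have "bij_betw (\<lambda>p. q \<circ> p) {p\<in>?P. \<forall>x\<in>S. e (p x) = e x} {r\<in>?P. \<forall>x\<in>S. e0 (r x) = e x}"
    proof (rule bij_betwI[where g = "\<lambda>r. inv' q \<circ> r"])
      show "(\<lambda>p. q \<circ> p) \<in> {p\<in>?P. \<forall>x\<in>S. e (p x) = e x} \<rightarrow> {r\<in>?P. \<forall>x\<in>S. e0 (r x) = e x}"
        using q by (auto intro: permutes_compose simp: permutes_in_image)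
      show "(\<lambda>r. inv' q \<circ> r) \<in> {r\<in>?P. \<forall>x\<in>S. e0 (r x) = e x} \<rightarrow> {p\<in>?P. \<forall>x\<in>S. e (p x) = e x}"
      proof
        fix r assume r: "r \<in> {r\<in>?P. \<forall>x\<in>S. e0 (r x) = e x}"
        have "e (inv' q (r x)) = e x" if "x \<in> S" for x
        proof -
          have "inv' q (r x) \<in> S" using that r qi by (auto simp: permutes_in_image)
          then have "e (inv' q (r x)) = e0 (q (inv' q (r x)))" using q(2) by auto
          also have "\<dots> = e x" using r that q1 by auto
          finally show ?thesis .
        qed
        then show "inv' q \<circ> r \<in> {p\<in>?P. \<forall>x\<in>S. e (p x) = e x}"
          using r qi by (auto intro: permutes_compose)
      qed
    qed (auto simp: q1 fun_eq_iff)
    then show ?thesis by (rule bij_betw_same_card)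
  qed
  have into: "\<exists>e\<in>E. \<forall>x\<in>S. e0 (q x) = e x" if q: "q permutes S" for q
  proof
    have "card {x\<in>S. restrict (e0 \<circ> q) S x = c} = M c" if c: "c \<in> K" for c
    proof -
      have "q ` {x\<in>S. restrict (e0 \<circ> q) S x = c} = {x\<in>S. e0 x = c}"
      proof
        show "q ` {x\<in>S. restrict (e0 \<circ> q) S x = c} \<subseteq> {x\<in>S. e0 x = c}"
          using q by (auto simp: permutes_in_image)
        show "{x\<in>S. e0 x = c} \<subseteq> q ` {x\<in>S. restrict (e0 \<circ> q) S x = c}"
        proof
          fix y assume y: "y \<in> {x\<in>S. e0 x = c}"
          obtain x where "y = q x" "x \<in> S" using y permutes_image[OF q] by auto
          then show "y \<in> q ` {x\<in>S. restrict (e0 \<circ> q) S x = c}" using y by auto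
        qed
      qed
      then have "card {x\<in>S. restrict (e0 \<circ> q) S x = c} = card {x\<in>S. e0 x = c}"
        using card_image[OF permutes_inj_on[OF q], of "{x\<in>S. restrict (e0 \<circ> q) S x = c}"] by (simp only:)
      then show ?thesis using e0 c by (simp add: E_def)
    qed
    then show "restrict (e0 \<circ> q) S \<in> E"
      using e0 q by (auto simp: E_def permutes_in_image)
  qed auto
  have "(\<Sum>p\<in>?P. card {e\<in>S \<rightarrow>\<^sub>E K. (\<forall>c\<in>K. card {x\<in>S. e x = c} = M c) \<and> (\<forall>x\<in>S. e (p x) = e x)})
      = (\<Sum>p\<in>?P. \<Sum>e\<in>E. if \<forall>x\<in>S. e (p x) = e x then 1 else 0)"
  proof (rule sum.cong[OF refl])
    fix p
    have "{e\<in>S \<rightarrow>\<^sub>E K. (\<forall>c\<in>K. card {x\<in>S. e x = c} = M c) \<and> (\<forall>x\<in>S. e (p x) = e x)} = {e\<in>E. \<forall>x\<in>S. e (p x) = e x}"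
      by (auto simp: E_def)
    then show "card {e\<in>S \<rightarrow>\<^sub>E K. (\<forall>c\<in>K. card {x\<in>S. e x = c} = M c) \<and> (\<forall>x\<in>S. e (p x) = e x)} =
        (\<Sum>e\<in>E. if \<forall>x\<in>S. e (p x) = e x then 1 else 0)"
      using fE by (simp add: sum.If_cases Int_def)
  qed
  also have "\<dots> = (\<Sum>e\<in>E. card {p\<in>?P. \<forall>x\<in>S. e (p x) = e x})"
    by (subst sum.swap) (use fP in \<open>simp add: sum.If_cases Int_def\<close>)
  also have "\<dots> = (\<Sum>e\<in>E. card {q\<in>?P. \<forall>x\<in>S. e0 (q x) = e x})"
    by (rule sum.cong[OF refl same])
  also have "\<dots> = card (\<Union>e\<in>E. {q\<in>?P. \<forall>x\<in>S. e0 (q x) = e x})"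
  proof (rule card_UN_disjoint[symmetric])
    show "\<forall>e\<in>E. \<forall>e'\<in>E. e \<noteq> e' \<longrightarrow>
        {q\<in>?P. \<forall>x\<in>S. e0 (q x) = e x} \<inter> {q\<in>?P. \<forall>x\<in>S. e0 (q x) = e' x} = {}"
    proof (intro ballI impI equals0I)
      fix e e' q assume "e \<in> E" "e' \<in> E" "e \<noteq> e'"
        and "q \<in> {q\<in>?P. \<forall>x\<in>S. e0 (q x) = e x} \<inter> {q\<in>?P. \<forall>x\<in>S. e0 (q x) = e' x}"
      then have "e = e'" by (intro PiE_ext[of e S "\<lambda>_. K" e']) (auto simp: E_def)
      then show False using \<open>e \<noteq> e'\<close> by simp
    qed
  qed (use fE fP in auto)
  also have "(\<Union>e\<in>E. {q\<in>?P. \<forall>x\<in>S. e0 (q x) = e x}) = ?P"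
    using into by auto
  also have "card ?P = fact (card S)" using card_permutations[OF refl S] .
  finally show ?thesis .
qed

text \<open>Contingency tables. They index the double cosets of two Young subgroups, so their number
  is the inner product of the two permutation characters.\<close>

definition margin_matrices :: "nat \<Rightarrow> (nat \<Rightarrow> int) \<Rightarrow> (nat \<Rightarrow> int) \<Rightarrow> (nat \<times> nat \<Rightarrow> nat) set"
  where "margin_matrices k \<alpha> \<beta> = {M \<in> ({..<k} \<times> {..<k}) \<rightarrow>\<^sub>E UNIV.
    (\<forall>i<k. int (\<Sum>j<k. M (i, j)) = \<alpha> i) \<and> (\<forall>j<k. int (\<Sum>i<k. M (i, j)) = \<beta> j)}"

lemma finite_margin_matrices: "finite (margin_matrices k \<alpha> \<beta>)"
proof (rule finite_subset)
  show "margin_matrices k \<alpha> \<beta> \<subseteq> (\<Pi>\<^sub>E x\<in>{..<k} \<times> {..<k}. {..nat (\<alpha> (fst x))})"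
  proof
    fix M assume M: "M \<in> margin_matrices k \<alpha> \<beta>"
    have "M (i, j) \<le> nat (\<alpha> i)" if "i < k" "j < k" for i j
    proof -
      have "M (i, j) \<le> (\<Sum>j<k. M (i, j))" using that by (intro member_le_sum) auto
      moreover have "int (\<Sum>j<k. M (i, j)) = \<alpha> i" using M that by (simp add: margin_matrices_def)
      ultimately show ?thesis by linarith
    qed
    then show "M \<in> (\<Pi>\<^sub>E x\<in>{..<k} \<times> {..<k}. {..nat (\<alpha> (fst x))})"
      using M by (auto simp: margin_matrices_def PiE_def)
  qed
qed (auto intro: finite_PiE)

lemma sum_margin_matrix:
  assumes "M \<in> margin_matrices k \<alpha> \<beta>"
  shows "int (\<Sum>x\<in>{..<k} \<times> {..<k}. M x) = (\<Sum>i<k. \<alpha> i)"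
proof -
  have "(\<Sum>x\<in>{..<k} \<times> {..<k}. M x) = (\<Sum>i<k. \<Sum>j<k. M (i, j))"
    by (simp add: sum.cartesian_product)
  then have "int (\<Sum>x\<in>{..<k} \<times> {..<k}. M x) = (\<Sum>i<k. int (\<Sum>j<k. M (i, j)))" by simp
  also have "\<dots> = (\<Sum>i<k. \<alpha> i)"
    by (rule sum.cong[OF refl]) (use assms in \<open>simp add: margin_matrices_def\<close>)
  finally show ?thesis .
qed

text \<open>A pair of colourings is one colouring by pairs of colours. Its type is a matrix with
  margins \<open>\<alpha>\<close> and \<open>\<beta>\<close>, and for each such matrix the orbit
  count contributes \<open>fact (card S)\<close>.\<close>

lemma sum_card_fixed_colorings_product:
  assumes S: "finite S" and \<alpha>: "(\<Sum>i<k. \<alpha> i) = int (card S)"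
  shows "(\<Sum>p | p permutes S. card (fixed_colorings S p k \<alpha>) * card (fixed_colorings S p k \<beta>)) =
    fact (card S) * card (margin_matrices k \<alpha> \<beta>)"
proof -
  let ?K = "{..<k} \<times> {..<k}"
  let ?E = "\<lambda>p M. {e\<in>S \<rightarrow>\<^sub>E ?K. (\<forall>c\<in>?K. card {x\<in>S. e x = c} = M c) \<and> (\<forall>x\<in>S. e (p x) = e x)}"
  have fE: "finite (?E p M)" for p M
    by (rule finite_subset[of _ "S \<rightarrow>\<^sub>E ?K"]) (use S in \<open>auto intro: finite_PiE\<close>)
  have rows: "(\<Sum>j<k. card {x\<in>S. e x = (i, j)}) = card {x\<in>S. fst (e x) = i}"
    and cols: "(\<Sum>i<k. card {x\<in>S. e x = (i, j)}) = card {x\<in>S. snd (e x) = j}"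
    if e: "e \<in> S \<rightarrow> ?K" for e i j
  proof -
    have "{x\<in>S. fst (e x) = i} = (\<Union>j<k. {x\<in>S. e x = (i, j)})"
      using e by (fastforce simp: Pi_def)
    also have "card \<dots> = (\<Sum>j<k. card {x\<in>S. e x = (i, j)})"
      by (rule card_UN_disjoint) (use S in auto)
    finally show "(\<Sum>j<k. card {x\<in>S. e x = (i, j)}) = card {x\<in>S. fst (e x) = i}" by simp
    have "{x\<in>S. snd (e x) = j} = (\<Union>i<k. {x\<in>S. e x = (i, j)})"
      using e by (fastforce simp: Pi_def)
    also have "card \<dots> = (\<Sum>i<k. card {x\<in>S. e x = (i, j)})"
      by (rule card_UN_disjoint) (use S in auto)
    finally show "(\<Sum>i<k. card {x\<in>S. e x = (i, j)}) = card {x\<in>S. snd (e x) = j}" by simp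
  qed
  have "card (fixed_colorings S p k \<alpha>) * card (fixed_colorings S p k \<beta>) = (\<Sum>M\<in>margin_matrices k \<alpha> \<beta>. card (?E p M))"
    if p: "p permutes S" for p
  proof -
    have pS: "p x \<in> S \<longleftrightarrow> x \<in> S" for x using p by (rule permutes_in_image)
    let ?h = "\<lambda>(c, d). restrict (\<lambda>x. (c x, d x)) S"
    have "bij_betw ?h (fixed_colorings S p k \<alpha> \<times> fixed_colorings S p k \<beta>) (\<Union>M\<in>margin_matrices k \<alpha> \<beta>. ?E p M)"
    proof (rule bij_betwI[where g = "\<lambda>e. (restrict (fst \<circ> e) S, restrict (snd \<circ> e) S)"])
      show "?h \<in> fixed_colorings S p k \<alpha> \<times> fixed_colorings S p k \<beta> \<rightarrow> (\<Union>M\<in>margin_matrices k \<alpha> \<beta>. ?E p M)"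
      proof
        fix cd assume "cd \<in> fixed_colorings S p k \<alpha> \<times> fixed_colorings S p k \<beta>"
        then obtain c d where cd: "cd = (c, d)" "c \<in> fixed_colorings S p k \<alpha>" "d \<in> fixed_colorings S p k \<beta>" by auto
        let ?e = "restrict (\<lambda>x. (c x, d x)) S"
        have e: "?e \<in> S \<rightarrow>\<^sub>E ?K" using cd by (auto simp: fixed_colorings_def colorings_def)
        then have e': "?e \<in> S \<rightarrow> ?K" unfolding PiE_def by (rule IntD1)
        let ?M = "restrict (\<lambda>y. card {x\<in>S. ?e x = y}) ?K"
        have f: "{x\<in>S. fst (?e x) = i} = {x\<in>S. c x = i}" "{x\<in>S. snd (?e x) = i} = {x\<in>S. d x = i}" for i by auto
        have R: "(\<Sum>j<k. card {x\<in>S. ?e x = (i, j)}) = card {x\<in>S. c x = i}" for i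
          using rows[OF e', of i] unfolding f .
        have C: "(\<Sum>i<k. card {x\<in>S. ?e x = (i, j)}) = card {x\<in>S. d x = j}" for j
          using cols[OF e', of j] unfolding f .
        have Mij: "?M (i, j) = card {x\<in>S. ?e x = (i, j)}" if "i < k" "j < k" for i j
          using that by (intro restrict_apply') auto
        have "int (\<Sum>j<k. ?M (i, j)) = \<alpha> i" if "i < k" for i
        proof -
          have "(\<Sum>j<k. ?M (i, j)) = card {x\<in>S. c x = i}"
            unfolding R[symmetric] using that by (intro sum.cong refl Mij) auto
          then show ?thesis using cd that by (simp add: fixed_colorings_def colorings_def)
        qed
        moreover have "int (\<Sum>i<k. ?M (i, j)) = \<beta> j" if "j < k" for j
        proof -
          have "(\<Sum>i<k. ?M (i, j)) = card {x\<in>S. d x = j}"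
            unfolding C[symmetric] using that by (intro sum.cong refl Mij) auto
          then show ?thesis using cd that by (simp add: fixed_colorings_def colorings_def)
        qed
        ultimately have "?M \<in> margin_matrices k \<alpha> \<beta>"
          unfolding margin_matrices_def by (intro CollectI conjI allI impI restrict_PiE_iff[THEN iffD2]) auto
        moreover have "?e \<in> ?E p ?M" using e cd pS by (auto simp: fixed_colorings_def)
        ultimately show "?h cd \<in> (\<Union>M\<in>margin_matrices k \<alpha> \<beta>. ?E p M)" unfolding cd(1) prod.case by blast
      qed
      show "(\<lambda>e. (restrict (fst \<circ> e) S, restrict (snd \<circ> e) S)) \<in> (\<Union>M\<in>margin_matrices k \<alpha> \<beta>. ?E p M) \<rightarrow>
          fixed_colorings S p k \<alpha> \<times> fixed_colorings S p k \<beta>"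
      proof
        fix e assume "e \<in> (\<Union>M\<in>margin_matrices k \<alpha> \<beta>. ?E p M)"
        then obtain M where M: "M \<in> margin_matrices k \<alpha> \<beta>" and e: "e \<in> ?E p M" by blast
        have e': "e \<in> S \<rightarrow> ?K" using e by auto
        have c: "card {x\<in>S. e x = (i, j)} = M (i, j)" if "i < k" "j < k" for i j using e that by auto
        have f: "{x\<in>S. restrict (fst \<circ> e) S x = i} = {x\<in>S. fst (e x) = i}"
          "{x\<in>S. restrict (snd \<circ> e) S x = i} = {x\<in>S. snd (e x) = i}" for i by auto
        have 1: "int (card {x\<in>S. fst (e x) = i}) = \<alpha> i" if "i < k" for i
        proof -
          have "int (\<Sum>j<k. M (i, j)) = \<alpha> i" using M that unfolding margin_matrices_def by blast
          moreover have "(\<Sum>j<k. M (i, j)) = card {x\<in>S. fst (e x) = i}" using rows[OF e', of i] that c by simp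
          ultimately show ?thesis by metis
        qed
        have 2: "int (card {x\<in>S. snd (e x) = i}) = \<beta> i" if "i < k" for i
        proof -
          have "int (\<Sum>j<k. M (j, i)) = \<beta> i" using M that unfolding margin_matrices_def by blast
          moreover have "(\<Sum>j<k. M (j, i)) = card {x\<in>S. snd (e x) = i}" using cols[OF e', of i] that c by simp
          ultimately show ?thesis by metis
        qed
        have "restrict (fst \<circ> e) S \<in> fixed_colorings S p k \<alpha>"
          unfolding fixed_colorings_def colorings_def mem_Collect_eq f
          using e e' pS 1 by (auto simp: Pi_def mem_Times_iff)
        moreover have "restrict (snd \<circ> e) S \<in> fixed_colorings S p k \<beta>"
          unfolding fixed_colorings_def colorings_def mem_Collect_eq f
          using e e' pS 2 by (auto simp: Pi_def mem_Times_iff)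
        ultimately show "(restrict (fst \<circ> e) S, restrict (snd \<circ> e) S) \<in> fixed_colorings S p k \<alpha> \<times> fixed_colorings S p k \<beta>" by simp
      qed
    qed (auto simp: fixed_colorings_def colorings_def PiE_def extensional_def fun_eq_iff)
    from bij_betw_same_card[OF this]
    have "card (fixed_colorings S p k \<alpha>) * card (fixed_colorings S p k \<beta>) = card (\<Union>M\<in>margin_matrices k \<alpha> \<beta>. ?E p M)"
      by (simp only: card_cartesian_product)
    also have "\<dots> = (\<Sum>M\<in>margin_matrices k \<alpha> \<beta>. card (?E p M))"
    proof (rule card_UN_disjoint)
      show "\<forall>M\<in>margin_matrices k \<alpha> \<beta>. \<forall>M'\<in>margin_matrices k \<alpha> \<beta>. M \<noteq> M' \<longrightarrow> ?E p M \<inter> ?E p M' = {}"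
      proof (intro ballI impI equals0I)
        fix M M' e assume "M \<in> margin_matrices k \<alpha> \<beta>" "M' \<in> margin_matrices k \<alpha> \<beta>" "M \<noteq> M'"
          and "e \<in> ?E p M \<inter> ?E p M'"
        then have "M = M'"
          by (intro PiE_ext[of M ?K "\<lambda>_. UNIV" M']) (auto simp: margin_matrices_def)
        then show False using \<open>M \<noteq> M'\<close> by simp
      qed
    qed (use finite_margin_matrices fE in auto)
    finally show ?thesis .
  qed
  then have "(\<Sum>p | p permutes S. card (fixed_colorings S p k \<alpha>) * card (fixed_colorings S p k \<beta>)) =
      (\<Sum>p | p permutes S. \<Sum>M\<in>margin_matrices k \<alpha> \<beta>. card (?E p M))" by simp
  also have "\<dots> = (\<Sum>M\<in>margin_matrices k \<alpha> \<beta>. \<Sum>p | p permutes S. card (?E p M))" by (rule sum.swap)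
  also have "\<dots> = (\<Sum>M\<in>margin_matrices k \<alpha> \<beta>. fact (card S))"
  proof (rule sum.cong[OF refl])
    fix M assume "M \<in> margin_matrices k \<alpha> \<beta>"
    then have "(\<Sum>c\<in>?K. M c) = card S" using sum_margin_matrix \<alpha> by (metis of_nat_eq_iff)
    then show "(\<Sum>p | p permutes S. card (?E p M)) = fact (card S)"
      using sum_fixed_functions_of_type[OF S, of ?K M] by simp
  qed
  also have "\<dots> = fact (card S) * card (margin_matrices k \<alpha> \<beta>)" by simp
  finally show ?thesis .
qed

lemma sum_of_bool_le: "(b::nat) \<le> B \<Longrightarrow> (\<Sum>l=1..B. of_bool (l \<le> b)) = (of_nat b :: 'a :: semiring_1)"
proof -
  assume "b \<le> B"
  then have "{1..B} \<inter> {l. l \<le> b} = {1..b}" by auto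
  then show ?thesis by (simp add: sum_of_bool_eq)
qed

text \<open>Subtract \<open>l\<close> from the entry \<open>(i, j)\<close>.\<close>

lemma card_margin_matrices_ge:
  assumes l: "l \<ge> 1" and ij: "i < k" "j < k"
  shows "card {M\<in>margin_matrices k \<alpha> \<beta>. l \<le> M (i, j)} =
    card (margin_matrices k (\<alpha>(i := \<alpha> i - int l)) (\<beta>(j := \<beta> j - int l)))"
proof (rule bij_betw_same_card)
  let ?N = "margin_matrices k (\<alpha>(i := \<alpha> i - int l)) (\<beta>(j := \<beta> j - int l))"
  have row: "int (\<Sum>b<k. (M((i, j) := m)) (a, b)) = int (\<Sum>b<k. M (a, b)) + (if a = i then int m - int (M (i, j)) else 0)"
    for M :: "nat \<times> nat \<Rightarrow> nat" and m a
  proof (cases "a = i")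
    case True
    then show ?thesis using ij by (simp add: sum.remove[of "{..<k}" j])
  qed simp
  have col: "int (\<Sum>a<k. (M((i, j) := m)) (a, b)) = int (\<Sum>a<k. M (a, b)) + (if b = j then int m - int (M (i, j)) else 0)"
    for M :: "nat \<times> nat \<Rightarrow> nat" and m b
  proof (cases "b = j")
    case True
    then show ?thesis using ij by (simp add: sum.remove[of "{..<k}" i])
  qed simp
  show "bij_betw (\<lambda>M. M((i, j) := M (i, j) - l)) {M\<in>margin_matrices k \<alpha> \<beta>. l \<le> M (i, j)} ?N"
  proof (rule bij_betwI[where g = "\<lambda>M. M((i, j) := M (i, j) + l)"])
    show "(\<lambda>M. M((i, j) := M (i, j) - l)) \<in> {M\<in>margin_matrices k \<alpha> \<beta>. l \<le> M (i, j)} \<rightarrow> ?N"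
    proof
      fix M assume "M \<in> {M\<in>margin_matrices k \<alpha> \<beta>. l \<le> M (i, j)}"
      then have M: "M \<in> margin_matrices k \<alpha> \<beta>" and lM: "l \<le> M (i, j)" by auto
      then have r: "int (\<Sum>b<k. M (a, b)) = \<alpha> a" and c: "int (\<Sum>b<k. M (b, a)) = \<beta> a"
        if "a < k" for a using that unfolding margin_matrices_def by blast+
      show "M((i, j) := M (i, j) - l) \<in> ?N"
        unfolding margin_matrices_def
      proof (intro CollectI conjI allI impI)
        show "M((i, j) := M (i, j) - l) \<in> {..<k} \<times> {..<k} \<rightarrow>\<^sub>E UNIV"
          using M ij by (auto simp: margin_matrices_def PiE_def extensional_def)
      qed (use lM in \<open>simp_all add: row col r c of_nat_diff del: of_nat_sum fun_upd_apply, simp_all\<close>)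
    qed
    show "(\<lambda>M. M((i, j) := M (i, j) + l)) \<in> ?N \<rightarrow> {M\<in>margin_matrices k \<alpha> \<beta>. l \<le> M (i, j)}"
    proof
      fix M assume M: "M \<in> ?N"
      then have r: "int (\<Sum>b<k. M (a, b)) = (\<alpha>(i := \<alpha> i - int l)) a" and c: "int (\<Sum>b<k. M (b, a)) = (\<beta>(j := \<beta> j - int l)) a"
        if "a < k" for a using that unfolding margin_matrices_def by blast+
      have "M((i, j) := M (i, j) + l) \<in> margin_matrices k \<alpha> \<beta>"
        unfolding margin_matrices_def
      proof (intro CollectI conjI allI impI)
        show "M((i, j) := M (i, j) + l) \<in> {..<k} \<times> {..<k} \<rightarrow>\<^sub>E UNIV"
          using M ij by (auto simp: margin_matrices_def PiE_def extensional_def)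
      qed (simp_all add: row col r c del: of_nat_sum fun_upd_apply, simp_all)
      then show "M((i, j) := M (i, j) + l) \<in> {M\<in>margin_matrices k \<alpha> \<beta>. l \<le> M (i, j)}" by simp
    qed
  qed (auto simp: fun_eq_iff)
qed

text \<open>Double counting of the sum of all entries of all matrices: every matrix has total
  \<open>n\<close>, and an entry \<open>b\<close> is the number of \<open>l \<ge> 1\<close> with
  \<open>l \<le> b\<close>. In generating functions, the degree operator multiplies the Cauchy
  kernel by the sum over l of p_l(x) p_l(y), with power sums p_l. \<open>B\<close> is an arbitrary
  cutoff beyond the largest entry.\<close>

lemma card_margin_matrices_recursion:
  assumes \<alpha>: "(\<Sum>i<k. \<alpha> i) = int n" and B: "n \<le> B"
  shows "n * card (margin_matrices k \<alpha> \<beta>) = (\<Sum>l=1..B. \<Sum>i<k. \<Sum>j<k.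
    card (margin_matrices k (\<alpha>(i := \<alpha> i - int l)) (\<beta>(j := \<beta> j - int l))))"
proof -
  let ?A = "margin_matrices k \<alpha> \<beta>" and ?K = "{..<k} \<times> {..<k}"
  have total: "(\<Sum>x\<in>?K. M x) = n" if "M \<in> ?A" for M
    using sum_margin_matrix[OF that] \<alpha> by linarith
  have le: "M x \<le> B" if "M \<in> ?A" "x \<in> ?K" for M x
  proof -
    have "M x \<le> (\<Sum>x\<in>?K. M x)" using that by (intro member_le_sum) auto
    then show ?thesis using total[OF that(1)] B by simp
  qed
  have "n * card ?A = (\<Sum>M\<in>?A. \<Sum>x\<in>?K. M x)"
    using total by simp
  also have "\<dots> = (\<Sum>M\<in>?A. \<Sum>x\<in>?K. \<Sum>l=1..B. of_bool (l \<le> M x))"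
  proof (intro sum.cong refl)
    fix M x assume "M \<in> ?A" "x \<in> ?K"
    then show "M x = (\<Sum>l=1..B. of_bool (l \<le> M x))"
      using sum_of_bool_le[OF le, where 'a = nat] by simp
  qed
  also have "\<dots> = (\<Sum>x\<in>?K. \<Sum>l=1..B. \<Sum>M\<in>?A. of_bool (l \<le> M x))"
    by (subst sum.swap, rule sum.cong[OF refl], rule sum.swap)
  also have "\<dots> = (\<Sum>x\<in>?K. \<Sum>l=1..B. card {M\<in>?A. l \<le> M x})"
    using finite_margin_matrices by (simp add: sum_of_bool_eq Int_def)
  also have "\<dots> = (\<Sum>l=1..B. \<Sum>x\<in>?K. card {M\<in>?A. l \<le> M x})" by (rule sum.swap)
  also have "\<dots> = (\<Sum>l=1..B. \<Sum>i<k. \<Sum>j<k. card {M\<in>?A. l \<le> M (i, j)})"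
    by (simp add: sum.cartesian_product)
  also have "\<dots> = (\<Sum>l=1..B. \<Sum>i<k. \<Sum>j<k.
      card (margin_matrices k (\<alpha>(i := \<alpha> i - int l)) (\<beta>(j := \<beta> j - int l))))"
    by (intro sum.cong refl card_margin_matrices_ge) auto
  finally show ?thesis .
qed

text \<open>The coefficient of x^\<beta> y^\<gamma> in the product of the Vandermonde determinants
  in x and in y with the Cauchy kernel, the product of all 1 / (1 - x_i y_j). For
  \<open>\<beta>\<close> of the right total it is the normalized inner product of two Frobenius
  characters over the symmetric group.\<close>

definition frobenius_gram :: "nat \<Rightarrow> (nat \<Rightarrow> int) \<Rightarrow> (nat \<Rightarrow> int) \<Rightarrow> int"
  where "frobenius_gram k \<beta> \<gamma> = (\<Sum>w | w permutes {..<k}. \<Sum>v | v permutes {..<k}. sign w * sign v *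
    int (card (margin_matrices k (\<lambda>i. \<beta> i - int (w i)) (\<lambda>i. \<gamma> i - int (v i)))))"

text \<open>The coefficient of x^\<beta> y^\<gamma> in det (1 / (1 - x_i y_j)), so that equality
  with \<open>frobenius_gram\<close> is Cauchy's determinant identity. For distinct nonnegative
  \<open>\<beta> i\<close> it is the sign of the rearrangement if \<open>\<gamma>\<close> rearranges
  \<open>\<beta>\<close>, and 0 otherwise.\<close>

definition signed_matching :: "nat \<Rightarrow> (nat \<Rightarrow> int) \<Rightarrow> (nat \<Rightarrow> int) \<Rightarrow> int"
  where "signed_matching k \<beta> \<gamma> = (\<Sum>t | t permutes {..<k}. sign t * of_bool (\<forall>a<k. \<beta> a = \<gamma> (t a) \<and> \<beta> a \<ge> 0))"

section \<open>Cauchy's determinant identity by recursion\<close>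

lemma sum_permuted: "w permutes {..<k} \<Longrightarrow> (\<Sum>i<k. int (w i)) = (\<Sum>i<k. int i)"
  by (rule sum.permute[symmetric, of w, unfolded o_def])

lemma double_sum_lessThan: "2 * (\<Sum>i<k. int i) = int k * (int k - 1)"
  by (induction k) (auto simp: algebra_simps)

text \<open>All the row margins \<open>\<beta> i - w i\<close> have the same total \<open>n\<close>,
  whatever \<open>w\<close> is, so the recursion for the matrices is simply summed with
  signs.\<close>

lemma frobenius_gram_recursion:
  assumes \<beta>: "2 * (\<Sum>i<k. \<beta> i) = 2 * int n + int k * (int k - 1)" and B: "n \<le> B"
  shows "int n * frobenius_gram k \<beta> \<gamma> = (\<Sum>l=1..B. \<Sum>i<k. \<Sum>j<k.
    frobenius_gram k (\<beta>(i := \<beta> i - int l)) (\<gamma>(j := \<gamma> j - int l)))"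
proof -
  let ?P = "{w. w permutes {..<k}}"
  let ?N = "\<lambda>\<alpha> \<alpha>'. int (card (margin_matrices k \<alpha> \<alpha>'))"
  have e: "(\<lambda>i. \<beta> i - int (w i))(i := \<beta> i - int (w i) - int l) = (\<lambda>a. (\<beta>(i := \<beta> i - int l)) a - int (w a))"
    for w i l and \<beta> :: "nat \<Rightarrow> int" by auto
  have N: "int n * ?N (\<lambda>i. \<beta> i - int (w i)) (\<lambda>i. \<gamma> i - int (v i)) = (\<Sum>l=1..B. \<Sum>i<k. \<Sum>j<k.
      ?N (\<lambda>a. (\<beta>(i := \<beta> i - int l)) a - int (w a)) (\<lambda>a. (\<gamma>(j := \<gamma> j - int l)) a - int (v a)))"
    if w: "w permutes {..<k}" for w v
  proof -
    have "(\<Sum>i<k. \<beta> i - int (w i)) = int n"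
      using \<beta> double_sum_lessThan[of k] by (simp add: sum_subtractf sum_permuted[OF w])
    from arg_cong[OF card_margin_matrices_recursion[OF this B, of "\<lambda>i. \<gamma> i - int (v i)"], of int]
    show ?thesis unfolding e of_nat_mult of_nat_sum .
  qed
  have "int n * frobenius_gram k \<beta> \<gamma> = (\<Sum>w\<in>?P. \<Sum>v\<in>?P. sign w * sign v *
      (int n * ?N (\<lambda>i. \<beta> i - int (w i)) (\<lambda>i. \<gamma> i - int (v i))))"
    unfolding frobenius_gram_def sum_distrib_left by (intro sum.cong refl) (simp add: mult_ac)
  also have "\<dots> = (\<Sum>w\<in>?P. \<Sum>v\<in>?P. \<Sum>l=1..B. \<Sum>i<k. \<Sum>j<k. sign w * sign v *
      ?N (\<lambda>a. (\<beta>(i := \<beta> i - int l)) a - int (w a)) (\<lambda>a. (\<gamma>(j := \<gamma> j - int l)) a - int (v a)))"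
    by (intro sum.cong refl) (simp add: N sum_distrib_left)
  also have "\<dots> = (\<Sum>l=1..B. \<Sum>i<k. \<Sum>j<k. \<Sum>w\<in>?P. \<Sum>v\<in>?P. sign w * sign v *
      ?N (\<lambda>a. (\<beta>(i := \<beta> i - int l)) a - int (w a)) (\<lambda>a. (\<gamma>(j := \<gamma> j - int l)) a - int (v a)))"
  proof -
    have sw: "(\<Sum>w\<in>?P. \<Sum>v\<in>?P. \<Sum>x\<in>A. f w v x) = (\<Sum>x\<in>A. \<Sum>w\<in>?P. \<Sum>v\<in>?P. f w v x)"
      for f :: "_ \<Rightarrow> _ \<Rightarrow> nat \<Rightarrow> int" and A
    proof -
      have "(\<Sum>w\<in>?P. \<Sum>v\<in>?P. \<Sum>x\<in>A. f w v x) = (\<Sum>w\<in>?P. \<Sum>x\<in>A. \<Sum>v\<in>?P. f w v x)"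
        by (intro sum.cong refl sum.swap)
      also have "\<dots> = (\<Sum>x\<in>A. \<Sum>w\<in>?P. \<Sum>v\<in>?P. f w v x)" by (rule sum.swap)
      finally show ?thesis .
    qed
    show ?thesis by (simp only: sw)
  qed
  finally show ?thesis unfolding frobenius_gram_def .
qed

text \<open>Substitute \<open>j = t i'\<close>. The terms with \<open>i' = i\<close> count the
  \<open>l\<close> up to \<open>\<beta> i\<close> and give the sum of \<open>\<beta>\<close> as a
  factor. Each unordered pair of different \<open>i\<close>, \<open>i'\<close> contributes the
  factor -1, and this loss of k (k - 1) / 2 turns the sum of \<open>\<beta>\<close> into
  \<open>n\<close>.\<close>

lemma signed_matching_recursion:
  assumes \<beta>: "2 * (\<Sum>i<k. \<beta> i) = 2 * n + int k * (int k - 1)" and B: "\<And>i. i < k \<Longrightarrow> \<beta> i \<le> int B"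
  shows "n * signed_matching k \<beta> \<gamma> = (\<Sum>l=1..B. \<Sum>i<k. \<Sum>j<k.
    signed_matching k (\<beta>(i := \<beta> i - int l)) (\<gamma>(j := \<gamma> j - int l)))"
proof -
  let ?P = "{w. w permutes {..<k}}"
  \<comment> \<open>\<open>E t\<close>: \<open>t\<close> matches \<open>\<beta>\<close> with
    \<open>\<gamma>\<close>. \<open>Q t i i' l\<close>: it does so after lowering
    \<open>\<beta> i\<close> and \<open>\<gamma> (t i')\<close> by \<open>l\<close>.
    \<open>P i i' t\<close>: it matches outside \<open>i\<close> and \<open>i'\<close>, where only
    the sums agree. \<open>f i i' t\<close>: for \<open>i \<noteq> i'\<close>, \<open>Q\<close>
    holds for the only candidate \<open>l = \<beta> i - \<gamma> (t i)\<close>.\<close>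
  define E where "E t \<longleftrightarrow> (\<forall>a<k. \<beta> a = \<gamma> (t a) \<and> \<beta> a \<ge> 0)" for t
  define Q where "Q t i i' l \<longleftrightarrow> (\<forall>a<k. (\<beta>(i := \<beta> i - int l)) a = (\<gamma>(t i' := \<gamma> (t i') - int l)) (t a) \<and>
    (\<beta>(i := \<beta> i - int l)) a \<ge> 0)" for t i i' l
  define P where "P i i' t \<longleftrightarrow> (\<forall>a<k. a \<noteq> i \<and> a \<noteq> i' \<longrightarrow> \<beta> a = \<gamma> (t a) \<and> \<beta> a \<ge> 0) \<and>
    \<beta> i + \<beta> i' = \<gamma> (t i) + \<gamma> (t i') \<and> \<beta> i \<ge> 0 \<and> \<beta> i' \<ge> 0" for i i' t
  define f where "f i i' t \<longleftrightarrow> P i i' t \<and> 0 \<le> \<gamma> (t i) \<and> \<gamma> (t i) < \<beta> i" for i i' t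
  have fP: "finite ?P" by (simp add: finite_permutations)
  have tinj: "t a = t b \<longleftrightarrow> a = b" if "t permutes {..<k}" for t a b
    using permutes_inj[OF that] by (auto simp: inj_def)
  have diag: "(\<Sum>l=1..B. of_bool (Q t i i l)) = \<beta> i * of_bool (E t)" if t: "t permutes {..<k}" and i: "i < k" for t i
  proof (cases "E t")
    case True
    from True[unfolded E_def, rule_format, OF i]
    have b: "0 \<le> \<beta> i" and g: "\<gamma> (t i) = \<beta> i" by simp_all
    have "Q t i i l \<longleftrightarrow> l \<le> nat (\<beta> i)" for l
    proof
      assume "Q t i i l"
      from this[unfolded Q_def, rule_format, OF i] have "int l \<le> \<beta> i" by simp
      then show "l \<le> nat (\<beta> i)" by linarith
    next
      assume l: "l \<le> nat (\<beta> i)"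
      show "Q t i i l"
        unfolding Q_def
      proof (intro allI impI)
        fix a assume a: "a < k"
        show "(\<beta>(i := \<beta> i - int l)) a = (\<gamma>(t i := \<gamma> (t i) - int l)) (t a) \<and> (\<beta>(i := \<beta> i - int l)) a \<ge> 0"
          using True[unfolded E_def, rule_format, OF a] g b l by (cases "a = i") (simp_all add: tinj[OF t])
      qed
    qed
    then have "(\<Sum>l=1..B. of_bool (Q t i i l)) = (\<Sum>l=1..B. of_bool (l \<le> nat (\<beta> i)) :: int)"
      by (intro sum.cong) auto
    also have "\<dots> = int (nat (\<beta> i))" using B[OF i] by (intro sum_of_bool_le) simp
    finally show ?thesis using b True by simp
  next
    case False
    have "\<not> Q t i i l" if "l \<in> {1..B}" for l
    proof
      assume q: "Q t i i l"
      have "\<beta> a = \<gamma> (t a) \<and> \<beta> a \<ge> 0" if a: "a < k" for a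
        using q[unfolded Q_def, rule_format, OF a] by (cases "a = i") (auto simp: tinj[OF t])
      then show False using False unfolding E_def by blast
    qed
    then show ?thesis using False by simp
  qed
  have off: "(\<Sum>l=1..B. of_bool (Q t i i' l)) = (of_bool (f i i' t) :: int)"
    if t: "t permutes {..<k}" and i: "i < k" "i' < k" "i \<noteq> i'" for t i i'
  proof -
    have Qf: "Q t i i' l \<longleftrightarrow> f i i' t \<and> l = nat (\<beta> i - \<gamma> (t i))" if l: "l \<in> {1..B}" for l
    proof
      assume q: "Q t i i' l"
      have c1: "\<beta> a = \<gamma> (t a) \<and> \<beta> a \<ge> 0" if a: "a < k" "a \<noteq> i" "a \<noteq> i'" for a
        using q[unfolded Q_def, rule_format, OF a(1)] a by (simp add: tinj[OF t])
      have c2: "\<beta> i - int l = \<gamma> (t i)" "\<beta> i - int l \<ge> 0"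
        using q[unfolded Q_def, rule_format, OF i(1)] i by (simp_all add: tinj[OF t])
      have c3: "\<beta> i' = \<gamma> (t i') - int l" "\<beta> i' \<ge> 0"
        using q[unfolded Q_def, rule_format, OF i(2)] i by (simp_all add: tinj[OF t])
      have "P i i' t" unfolding P_def
      proof (intro conjI)
        show "\<forall>a<k. a \<noteq> i \<and> a \<noteq> i' \<longrightarrow> \<beta> a = \<gamma> (t a) \<and> 0 \<le> \<beta> a" using c1 by blast
      qed (use c2 c3 in linarith)+
      moreover have "0 \<le> \<gamma> (t i)" "\<gamma> (t i) < \<beta> i" "l = nat (\<beta> i - \<gamma> (t i))" using c2 l by auto
      ultimately show "f i i' t \<and> l = nat (\<beta> i - \<gamma> (t i))" by (simp add: f_def)
    next
      assume fl: "f i i' t \<and> l = nat (\<beta> i - \<gamma> (t i))"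
      then have il: "int l = \<beta> i - \<gamma> (t i)" by (simp add: f_def)
      have ii: "\<beta> i + \<beta> i' = \<gamma> (t i) + \<gamma> (t i')" "0 \<le> \<gamma> (t i)" "0 \<le> \<beta> i'" using fl by (simp_all add: f_def P_def)
      show "Q t i i' l"
        unfolding Q_def
      proof (intro allI impI)
        fix a assume a: "a < k"
        consider "a = i" | "a = i'" | "a \<noteq> i" "a \<noteq> i'" by blast
        then show "(\<beta>(i := \<beta> i - int l)) a = (\<gamma>(t i' := \<gamma> (t i') - int l)) (t a) \<and> (\<beta>(i := \<beta> i - int l)) a \<ge> 0"
        proof cases
          case 3
          then have "\<beta> a = \<gamma> (t a) \<and> 0 \<le> \<beta> a" using fl a unfolding f_def P_def by blast
          moreover have "(\<beta>(i := \<beta> i - int l)) a = \<beta> a" "(\<gamma>(t i' := \<gamma> (t i') - int l)) (t a) = \<gamma> (t a)"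
            using 3 by (simp_all add: tinj[OF t])
          ultimately show ?thesis by metis
        qed (use i il ii in \<open>simp_all add: tinj[OF t]\<close>)
      qed
    qed
    have "(\<Sum>l=1..B. of_bool (Q t i i' l)) = (\<Sum>l=1..B. if l = nat (\<beta> i - \<gamma> (t i)) then of_bool (f i i' t) else (0 :: int))"
      by (intro sum.cong refl) (auto simp: Qf)
    also have "\<dots> = of_bool (f i i' t)"
      using B[OF i(1)] by (auto simp: sum.delta f_def)
    finally show ?thesis .
  qed
  \<comment> \<open>The three summands are the cases that \<open>\<gamma> (t i)\<close> is less
    than, greater than or equal to \<open>\<beta> i\<close>. Their union is symmetric in
    \<open>t i\<close> and \<open>t i'\<close>, so composing \<open>t\<close> with the transposition
    of \<open>i\<close> and \<open>i'\<close> reverses the signed sum.\<close>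
  have cancel: "(\<Sum>t\<in>?P. sign t * (of_bool (f i i' t) + of_bool (f i' i t) + of_bool (E t))) = 0"
    if i: "i < k" "i' < k" "i \<noteq> i'" for i i'
  proof -
    let ?s = "transpose i i'"
    let ?h = "\<lambda>t. of_bool (P i i' t \<and> 0 \<le> \<gamma> (t i) \<and> 0 \<le> \<gamma> (t i')) :: int"
    have s: "?s permutes {..<k}" using i by (auto intro: permutes_swap_id)
    have h: "of_bool (f i i' t) + of_bool (f i' i t) + of_bool (E t) = ?h t" for t
    proof -
      have Ed: "E t \<longleftrightarrow> P i i' t \<and> 0 \<le> \<gamma> (t i) \<and> 0 \<le> \<gamma> (t i') \<and> \<beta> i = \<gamma> (t i)"
        using i by (auto simp: E_def P_def)
      have fd: "f i i' t \<longleftrightarrow> P i i' t \<and> 0 \<le> \<gamma> (t i) \<and> 0 \<le> \<gamma> (t i') \<and> \<gamma> (t i) < \<beta> i"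
        by (auto simp: f_def P_def)
      have fd': "f i' i t \<longleftrightarrow> P i i' t \<and> 0 \<le> \<gamma> (t i) \<and> 0 \<le> \<gamma> (t i') \<and> \<gamma> (t i) > \<beta> i"
        by (auto simp: f_def P_def)
      show ?thesis unfolding Ed fd fd' by auto
    qed
    have hs: "?h (t \<circ> ?s) = ?h t" for t
    proof -
      have "P i i' (t \<circ> ?s) \<longleftrightarrow> P i i' t" by (auto simp: P_def transpose_def)
      then show ?thesis by (auto simp: transpose_def)
    qed
    have "(\<Sum>t\<in>?P. sign t * ?h t) = (\<Sum>t\<in>?P. sign (t \<circ> ?s) * ?h (t \<circ> ?s))"
      by (rule sum_permutations_compose_right[OF s])
    also have "\<dots> = (\<Sum>t\<in>?P. - (sign t * ?h t))"
    proof (intro sum.cong refl)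
      fix t assume "t \<in> ?P"
      then have "sign (t \<circ> ?s) = - sign t"
        using s i by (subst sign_compose) (auto simp: permutation_permutes sign_swap_id)
      then show "sign (t \<circ> ?s) * ?h (t \<circ> ?s) = - (sign t * ?h t)" unfolding hs by simp
    qed
    finally have "(\<Sum>t\<in>?P. sign t * ?h t) = 0" by (simp add: sum_negf)
    then show ?thesis unfolding h .
  qed
  define Y where "Y i i' = (\<Sum>t\<in>?P. sign t * of_bool (f i i' t))" for i i'
  have Y: "Y i i' + Y i' i = - signed_matching k \<beta> \<gamma>" if "i < k" "i' < k" "i \<noteq> i'" for i i'
    using cancel[OF that] by (simp add: Y_def signed_matching_def E_def distrib_left sum.distrib)
  have offsum: "2 * (\<Sum>i<k. \<Sum>i'\<in>{..<k} - {i}. Y i i') = - (int k * (int k - 1)) * signed_matching k \<beta> \<gamma>"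
  proof -
    have sw: "(\<Sum>i<k. \<Sum>i'\<in>{..<k} - {i}. Y i i') = (\<Sum>i<k. \<Sum>i'\<in>{..<k} - {i}. Y i' i)"
    proof -
      have "(\<Sum>i<k. \<Sum>i'\<in>{..<k} - {i}. g i i') = (\<Sum>i<k. \<Sum>i'<k. if i = i' then 0 else g i i')"
        for g :: "nat \<Rightarrow> nat \<Rightarrow> int"
      proof (rule sum.cong[OF refl])
        fix i show "(\<Sum>i'\<in>{..<k} - {i}. g i i') = (\<Sum>i'<k. if i = i' then 0 else g i i')"
          by (rule sum.mono_neutral_cong_left) auto
      qed
      note r = this
      show ?thesis unfolding r by (subst sum.swap) (intro sum.cong refl, auto)
    qed
    have "2 * (\<Sum>i<k. \<Sum>i'\<in>{..<k} - {i}. Y i i') = (\<Sum>i<k. \<Sum>i'\<in>{..<k} - {i}. Y i i') + (\<Sum>i<k. \<Sum>i'\<in>{..<k} - {i}. Y i' i)"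
      using sw by simp
    also have "\<dots> = (\<Sum>i<k. \<Sum>i'\<in>{..<k} - {i}. Y i i' + Y i' i)" by (simp add: sum.distrib)
    also have "\<dots> = (\<Sum>i<k. \<Sum>i'\<in>{..<k} - {i}. - signed_matching k \<beta> \<gamma>)"
      by (intro sum.cong refl Y) auto
    also have "\<dots> = - (int k * (int k - 1)) * signed_matching k \<beta> \<gamma>"
      by (cases k) (auto simp: card_Diff_singleton)
    finally show ?thesis .
  qed
  have "(\<Sum>l=1..B. \<Sum>i<k. \<Sum>j<k. signed_matching k (\<beta>(i := \<beta> i - int l)) (\<gamma>(j := \<gamma> j - int l)))
      = (\<Sum>l=1..B. \<Sum>i<k. \<Sum>t\<in>?P. \<Sum>i'<k. sign t * of_bool (Q t i i' l))"
  proof (intro sum.cong refl)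
    fix l i
    have "(\<Sum>j<k. signed_matching k (\<beta>(i := \<beta> i - int l)) (\<gamma>(j := \<gamma> j - int l))) =
      (\<Sum>t\<in>?P. \<Sum>j<k. sign t * of_bool (\<forall>a<k. (\<beta>(i := \<beta> i - int l)) a = (\<gamma>(j := \<gamma> j - int l)) (t a) \<and> (\<beta>(i := \<beta> i - int l)) a \<ge> 0))"
      unfolding signed_matching_def by (rule sum.swap)
    also have "\<dots> = (\<Sum>t\<in>?P. \<Sum>i'<k. sign t * of_bool (Q t i i' l))"
    proof (rule sum.cong[OF refl])
      fix t assume "t \<in> ?P"
      then have "bij_betw t {..<k} {..<k}" by (simp add: permutes_imp_bij)
      from sum.reindex_bij_betw[OF this, symmetric]
      show "(\<Sum>j<k. sign t * of_bool (\<forall>a<k. (\<beta>(i := \<beta> i - int l)) a = (\<gamma>(j := \<gamma> j - int l)) (t a) \<and> (\<beta>(i := \<beta> i - int l)) a \<ge> 0))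
        = (\<Sum>i'<k. sign t * of_bool (Q t i i' l))"
        unfolding Q_def .
    qed
    finally show "(\<Sum>j<k. signed_matching k (\<beta>(i := \<beta> i - int l)) (\<gamma>(j := \<gamma> j - int l))) =
      (\<Sum>t\<in>?P. \<Sum>i'<k. sign t * of_bool (Q t i i' l))" .
  qed
  also have "\<dots> = (\<Sum>i<k. \<Sum>t\<in>?P. \<Sum>i'<k. sign t * (\<Sum>l=1..B. of_bool (Q t i i' l)))"
    unfolding sum_distrib_left
    by (subst sum.swap, rule sum.cong[OF refl], subst sum.swap, rule sum.cong[OF refl], rule sum.swap)
  also have "\<dots> = (\<Sum>i<k. \<Sum>t\<in>?P. sign t * (\<beta> i * of_bool (E t)) + (\<Sum>i'\<in>{..<k} - {i}. sign t * of_bool (f i i' t)))"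
  proof (intro sum.cong refl)
    fix i t assume "i \<in> {..<k}" "t \<in> ?P"
    then have i: "i < k" and t: "t permutes {..<k}" by auto
    show "(\<Sum>i'<k. sign t * (\<Sum>l=1..B. of_bool (Q t i i' l))) =
        sign t * (\<beta> i * of_bool (E t)) + (\<Sum>i'\<in>{..<k} - {i}. sign t * of_bool (f i i' t))"
    proof -
      have "(\<Sum>i'<k. sign t * (\<Sum>l=1..B. of_bool (Q t i i' l))) = sign t * (\<Sum>l=1..B. of_bool (Q t i i l)) +
          (\<Sum>i'\<in>{..<k} - {i}. sign t * (\<Sum>l=1..B. of_bool (Q t i i' l)))"
        by (rule sum.remove) (use i in simp_all)
      also have "(\<Sum>i'\<in>{..<k} - {i}. sign t * (\<Sum>l=1..B. of_bool (Q t i i' l))) =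
          (\<Sum>i'\<in>{..<k} - {i}. sign t * of_bool (f i i' t))"
      proof (rule sum.cong[OF refl])
        fix i' assume "i' \<in> {..<k} - {i}"
        then have "i' < k" "i \<noteq> i'" by auto
        from off[OF t i this] show "sign t * (\<Sum>l=1..B. of_bool (Q t i i' l)) = sign t * of_bool (f i i' t)"
          by (simp only:)
      qed
      finally show ?thesis by (simp only: diag[OF t i])
    qed
  qed
  also have "\<dots> = (\<Sum>i<k. \<beta> i) * signed_matching k \<beta> \<gamma> + (\<Sum>i<k. \<Sum>i'\<in>{..<k} - {i}. Y i i')"
  proof -
    have "(\<Sum>t\<in>?P. sign t * (\<beta> i * of_bool (E t))) = \<beta> i * signed_matching k \<beta> \<gamma>" for i
      unfolding signed_matching_def E_def sum_distrib_left by (intro sum.cong refl) simp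
    moreover have "(\<Sum>t\<in>?P. \<Sum>i'\<in>{..<k} - {i}. sign t * of_bool (f i i' t)) = (\<Sum>i'\<in>{..<k} - {i}. Y i i')" for i
      unfolding Y_def by (rule sum.swap)
    ultimately show ?thesis by (simp add: sum.distrib sum_distrib_right)
  qed
  finally have T: "(\<Sum>l=1..B. \<Sum>i<k. \<Sum>j<k. signed_matching k (\<beta>(i := \<beta> i - int l)) (\<gamma>(j := \<gamma> j - int l))) =
    (\<Sum>i<k. \<beta> i) * signed_matching k \<beta> \<gamma> + (\<Sum>i<k. \<Sum>i'\<in>{..<k} - {i}. Y i i')" (is "?T = ?b * ?D + ?y") .
  have "2 * ?T = (2 * ?b) * ?D + 2 * ?y" using T by simp
  also have "\<dots> = 2 * (n * ?D)" unfolding \<beta> offsum by (simp add: algebra_simps)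
  finally show ?thesis by simp
qed

lemma sum_nat_set_ge:
  assumes "finite A" "card A = k"
  shows "\<Sum>{..<k} \<le> \<Sum>A \<and> (\<Sum>A = \<Sum>{..<k} \<longrightarrow> A = {..<(k::nat)})"
  using assms
proof (induction k arbitrary: A)
  case (Suc k)
  define m where "m = Max A"
  have ne: "A \<noteq> {}" using Suc.prems by auto
  have m: "m \<in> A" using Suc.prems ne by (simp add: m_def)
  have "A \<subseteq> {..m}" using Suc.prems by (auto simp: m_def)
  then have "Suc k \<le> card {..m}" using Suc.prems card_mono[of "{..m}" A] by simp
  then have km: "k \<le> m" by simp
  have c: "finite (A - {m})" "card (A - {m}) = k" using Suc.prems m by auto
  have s: "\<Sum>A = m + \<Sum>(A - {m})" using Suc.prems m by (simp add: sum.remove)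
  show ?case
  proof
    show "\<Sum>{..<Suc k} \<le> \<Sum>A" using Suc.IH[OF c] s km by simp
    show "\<Sum>A = \<Sum>{..<Suc k} \<longrightarrow> A = {..<Suc k}"
    proof
      assume "\<Sum>A = \<Sum>{..<Suc k}"
      then have "\<Sum>(A - {m}) = \<Sum>{..<k}" "m = k" using Suc.IH[OF c] s km by auto
      then have e: "A - {m} = {..<k}" "m = k" using Suc.IH[OF c] by blast+
      have "A = insert m (A - {m})" using m by blast
      also have "\<dots> = insert m {..<k}" using e(1) by (rule arg_cong)
      also have "\<dots> = {..<Suc k}" using e(2) by (simp add: lessThan_Suc)
      finally show "A = {..<Suc k}" .
    qed
  qed
qed simp

lemma signed_matching_repeated:
  assumes ij: "i < k" "j < k" "i \<noteq> j" "\<beta> i = \<beta> j"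
  shows "signed_matching k \<beta> \<gamma> = 0"
proof -
  let ?s = "transpose i j"
  let ?h = "\<lambda>t. of_bool (\<forall>a<k. \<beta> a = \<gamma> (t a) \<and> \<beta> a \<ge> 0) :: int"
  have s: "?s permutes {..<k}" using ij by (auto intro: permutes_swap_id)
  have b: "\<beta> (?s a) = \<beta> a" for a using ij by (auto simp: transpose_def)
  have sk: "?s a < k \<longleftrightarrow> a < k" for a using ij by (auto simp: transpose_def)
  have h: "?h (t \<circ> ?s) = ?h t" for t
  proof -
    have "(\<forall>a<k. \<beta> a = \<gamma> ((t \<circ> ?s) a) \<and> \<beta> a \<ge> 0) \<longleftrightarrow> (\<forall>a<k. \<beta> (?s a) = \<gamma> (t (?s a)) \<and> \<beta> (?s a) \<ge> 0)"
      by (simp add: b)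
    also have "\<dots> \<longleftrightarrow> (\<forall>a<k. \<beta> a = \<gamma> (t a) \<and> \<beta> a \<ge> 0)"
      by (metis sk transpose_involutory)
    finally show ?thesis by simp
  qed
  have "signed_matching k \<beta> \<gamma> = (\<Sum>t | t permutes {..<k}. sign (t \<circ> ?s) * ?h (t \<circ> ?s))"
    unfolding signed_matching_def by (rule sum_permutations_compose_right[OF s])
  also have "\<dots> = (\<Sum>t | t permutes {..<k}. - (sign t * ?h t))"
  proof (intro sum.cong refl)
    fix t assume "t \<in> {t. t permutes {..<k}}"
    then have "sign (t \<circ> ?s) = - sign t"
      using s ij by (subst sign_compose) (auto simp: permutation_permutes sign_swap_id)
    then show "sign (t \<circ> ?s) * ?h (t \<circ> ?s) = - (sign t * ?h t)" unfolding h by simp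
  qed
  also have "\<dots> = - signed_matching k \<beta> \<gamma>" by (simp add: sum_negf signed_matching_def)
  finally show ?thesis by simp
qed

lemma signed_matching_nonzeroD:
  assumes "signed_matching k \<beta> \<gamma> \<noteq> 0"
  shows "inj_on \<beta> {..<k}" "\<exists>t. t permutes {..<k} \<and> (\<forall>a<k. \<beta> a = \<gamma> (t a) \<and> \<beta> a \<ge> 0)"
proof -
  show "inj_on \<beta> {..<k}"
    using assms signed_matching_repeated[of _ k _ \<beta> \<gamma>] by (auto simp: inj_on_def)
  show "\<exists>t. t permutes {..<k} \<and> (\<forall>a<k. \<beta> a = \<gamma> (t a) \<and> \<beta> a \<ge> 0)"
  proof (rule ccontr)
    assume n: "\<not> ?thesis"
    have "signed_matching k \<beta> \<gamma> = 0"
      unfolding signed_matching_def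
    proof (rule sum.neutral, rule ballI)
      fix t assume "t \<in> {t. t permutes {..<k}}"
      then have "\<not> (\<forall>a<k. \<beta> a = \<gamma> (t a) \<and> \<beta> a \<ge> 0)" using n by blast
      then show "sign t * of_bool (\<forall>a<k. \<beta> a = \<gamma> (t a) \<and> \<beta> a \<ge> 0) = 0" by simp
    qed
    then show False using assms by simp
  qed
qed

lemma sum_distinct_nonneg:
  assumes inj: "inj_on \<beta> {..<k}" and nn: "\<forall>a<k. (\<beta> a :: int) \<ge> 0"
  shows "int k * (int k - 1) \<le> 2 * (\<Sum>i<k. \<beta> i)"
    "2 * (\<Sum>i<k. \<beta> i) = int k * (int k - 1) \<Longrightarrow> \<exists>w. w permutes {..<k} \<and> (\<forall>a<k. \<beta> a = int (w a))"
proof -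
  let ?A = "(nat \<circ> \<beta>) ` {..<k}"
  have inj': "inj_on (nat \<circ> \<beta>) {..<k}"
  proof (rule inj_onI)
    fix x y assume xy: "x \<in> {..<k}" "y \<in> {..<k}" "(nat \<circ> \<beta>) x = (nat \<circ> \<beta>) y"
    then have "\<beta> x = \<beta> y" using nn[rule_format, of x] nn[rule_format, of y] by (simp add: eq_nat_nat_iff)
    then show "x = y" using inj xy by (simp add: inj_on_def)
  qed
  have cA: "finite ?A" "card ?A = k" using card_image[OF inj'] by auto
  have sA: "int (\<Sum>?A) = (\<Sum>i<k. \<beta> i)"
  proof -
    have "\<Sum>?A = (\<Sum>i<k. nat (\<beta> i))" by (subst sum.reindex[OF inj']) simp
    then have "int (\<Sum>?A) = (\<Sum>i<k. int (nat (\<beta> i)))" by (simp only: of_nat_sum)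
    also have "\<dots> = (\<Sum>i<k. \<beta> i)" by (rule sum.cong[OF refl]) (use nn in simp)
    finally show ?thesis .
  qed
  have sk: "2 * int (\<Sum>{..<k}) = int k * (int k - 1)" using double_sum_lessThan[of k] by simp
  show "int k * (int k - 1) \<le> 2 * (\<Sum>i<k. \<beta> i)"
    using sum_nat_set_ge[OF cA] sA sk by linarith
  assume eq: "2 * (\<Sum>i<k. \<beta> i) = int k * (int k - 1)"
  then have "\<Sum>?A = \<Sum>{..<k}" using sA sk by linarith
  then have A: "?A = {..<k}" using sum_nat_set_ge[OF cA] by blast
  define w where "w a = (if a < k then nat (\<beta> a) else a)" for a
  have "w permutes {..<k}"
  proof (rule bij_imp_permutes)
    have "bij_betw (nat \<circ> \<beta>) {..<k} {..<k}" using inj' A by (simp add: bij_betw_def)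
    then show "bij_betw w {..<k} {..<k}"
      by (rule bij_betw_cong[THEN iffD1, rotated]) (simp add: w_def)
  qed (simp add: w_def)
  then show "\<exists>w. w permutes {..<k} \<and> (\<forall>a<k. \<beta> a = int (w a))"
    using nn by (intro exI[of _ w]) (simp add: w_def)
qed

lemma permutes_lessThan_eq:
  assumes "w permutes {..<k}" "v permutes {..<k}" "\<forall>a<k. w a = (v a :: nat)"
  shows "w = v"
proof
  fix a show "w a = v a"
    using assms by (cases "a < k") (auto simp: permutes_def)
qed

text \<open>Needed since the recursion also subtracts \<open>l > n\<close>. Both sides vanish: no
  matrix has a negative total, and distinct nonnegative values sum to at least 0 + 1 + ... + (k -
  1).\<close>

lemma frobenius_gram_neg:
  assumes \<beta>: "2 * (\<Sum>i<k. \<beta> i) = 2 * n + int k * (int k - 1)" and n: "n < 0"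
  shows "frobenius_gram k \<beta> \<gamma> = signed_matching k \<beta> \<gamma>"
proof -
  have "margin_matrices k (\<lambda>i. \<beta> i - int (w i)) \<alpha> = {}" if w: "w permutes {..<k}" for w \<alpha>
  proof (rule equals0I)
    fix M assume "M \<in> margin_matrices k (\<lambda>i. \<beta> i - int (w i)) \<alpha>"
    from sum_margin_matrix[OF this] have "0 \<le> (\<Sum>i<k. \<beta> i - int (w i))" by linarith
    then show False
      using \<beta> n double_sum_lessThan[of k] by (simp add: sum_subtractf sum_permuted[OF w])
  qed
  then have "frobenius_gram k \<beta> \<gamma> = 0" by (simp add: frobenius_gram_def)
  moreover have "signed_matching k \<beta> \<gamma> = 0"
  proof (rule ccontr)
    assume "signed_matching k \<beta> \<gamma> \<noteq> 0"
    from signed_matching_nonzeroD[OF this] have "int k * (int k - 1) \<le> 2 * (\<Sum>i<k. \<beta> i)"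
      by (intro sum_distinct_nonneg(1)) auto
    then show False using \<beta> n by simp
  qed
  ultimately show ?thesis by simp
qed

text \<open>Only the zero matrix has total 0. So both sides vanish unless \<open>\<beta>\<close> and
  \<open>\<gamma>\<close> both rearrange 0, ..., k - 1, and then both are the product of the two
  signs.\<close>

lemma frobenius_gram_0:
  assumes \<beta>: "2 * (\<Sum>i<k. \<beta> i) = int k * (int k - 1)"
  shows "frobenius_gram k \<beta> \<gamma> = signed_matching k \<beta> \<gamma>"
proof -
  let ?P = "{w. w permutes {..<k}}"
  have fP: "finite ?P" by (simp add: finite_permutations)
  have card: "int (card (margin_matrices k (\<lambda>i. \<beta> i - int (w i)) (\<lambda>i. \<gamma> i - int (v i)))) =
      of_bool ((\<forall>i<k. \<beta> i = int (w i)) \<and> (\<forall>i<k. \<gamma> i = int (v i)))" (is "int (card ?N) = of_bool ?R")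
    if w: "w permutes {..<k}" for w v
  proof -
    let ?Z = "restrict (\<lambda>x. 0 :: nat) ({..<k} \<times> {..<k})"
    have "(\<Sum>i<k. \<beta> i - int (w i)) = 0"
      using \<beta> double_sum_lessThan[of k] by (simp add: sum_subtractf sum_permuted[OF w])
    then have z: "M = ?Z" if M: "M \<in> ?N" for M
    proof -
      have "(\<Sum>x\<in>{..<k} \<times> {..<k}. M x) = 0"
        using sum_margin_matrix[OF M] \<open>(\<Sum>i<k. \<beta> i - int (w i)) = 0\<close> by linarith
      then have "\<forall>x\<in>{..<k} \<times> {..<k}. M x = 0" by (subst (asm) sum_eq_0_iff) auto
      then show ?thesis using M
        by (intro PiE_ext[of M "{..<k} \<times> {..<k}" "\<lambda>_. UNIV" ?Z]) (auto simp: margin_matrices_def)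
    qed
    have Z: "?Z \<in> ?N \<longleftrightarrow> ?R" by (auto simp: margin_matrices_def)
    show ?thesis
    proof (cases ?R)
      case True
      then have "?N = {?Z}" using z Z by blast
      then show ?thesis using True by simp
    next
      case False
      then have "?N = {}" using z Z by blast
      then show ?thesis using False by simp
    qed
  qed
  have gram: "frobenius_gram k \<beta> \<gamma> = (\<Sum>w\<in>?P. \<Sum>v\<in>?P. sign w * sign v *
      of_bool ((\<forall>i<k. \<beta> i = int (w i)) \<and> (\<forall>i<k. \<gamma> i = int (v i))))"
    unfolding frobenius_gram_def by (intro sum.cong refl) (simp add: card)
  show ?thesis
  proof (cases "(\<exists>w\<in>?P. \<forall>i<k. \<beta> i = int (w i)) \<and> (\<exists>v\<in>?P. \<forall>i<k. \<gamma> i = int (v i))")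
    case True
    then obtain w v where w: "w permutes {..<k}" "\<forall>i<k. \<beta> i = int (w i)"
      and v: "v permutes {..<k}" "\<forall>i<k. \<gamma> i = int (v i)" by auto
    have e: "(\<forall>i<k. \<theta> i = int (w' i)) \<longleftrightarrow> w' = u"
      if u: "u permutes {..<k}" "\<forall>i<k. \<theta> i = int (u i)" and w': "w' permutes {..<k}" for w' u \<theta>
    proof
      assume h: "\<forall>i<k. \<theta> i = int (w' i)"
      have "w' a = u a" if "a < k" for a
        using h[rule_format, OF that] u(2)[rule_format, OF that] by simp
      then show "w' = u" using permutes_lessThan_eq[OF w' u(1)] by blast
    next
      assume "w' = u"
      then show "\<forall>i<k. \<theta> i = int (w' i)" using u(2) by simp
    qed
    have "frobenius_gram k \<beta> \<gamma> = (\<Sum>w'\<in>?P. \<Sum>v'\<in>?P. if v' = v then (if w' = w then sign w * sign v else 0) else 0)"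
    proof (unfold gram, intro sum.cong refl)
      fix w' v' assume "w' \<in> ?P" "v' \<in> ?P"
      then have "w' permutes {..<k}" "v' permutes {..<k}" by simp_all
      note e[OF w this(1)] e[OF v this(2)]
      then show "sign w' * sign v' * of_bool ((\<forall>i<k. \<beta> i = int (w' i)) \<and> (\<forall>i<k. \<gamma> i = int (v' i))) =
          (if v' = v then (if w' = w then sign w * sign v else 0) else 0)"
        by (simp only:) simp
    qed
    also have "\<dots> = sign w * sign v" using fP w v by (simp add: sum.delta)
    finally have g: "frobenius_gram k \<beta> \<gamma> = sign w * sign v" .
    have vi: "inv' v permutes {..<k}" using v(1) by (rule permutes_inv)
    have vv: "v (inv' v a) = a" "inv' v (v a) = a" for a using permutes_inverses[OF v(1)] by auto
    have m: "(\<forall>a<k. \<beta> a = \<gamma> (t a) \<and> \<beta> a \<ge> 0) \<longleftrightarrow> t = inv' v \<circ> w" if t: "t permutes {..<k}" for t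
    proof -
      have "t a < k" if "a < k" for a using permutes_in_image[OF t, of a] that by simp
      then have "(\<forall>a<k. \<beta> a = \<gamma> (t a) \<and> \<beta> a \<ge> 0) \<longleftrightarrow> (\<forall>a<k. w a = v (t a))"
        using w(2) v(2) by auto
      also have "\<dots> \<longleftrightarrow> (\<forall>a<k. t a = (inv' v \<circ> w) a)" using vv by (metis comp_apply)
      also have "\<dots> \<longleftrightarrow> t = inv' v \<circ> w"
        using permutes_lessThan_eq[OF t permutes_compose[OF w(1) vi]] by auto
      finally show ?thesis .
    qed
    have "signed_matching k \<beta> \<gamma> = (\<Sum>t\<in>?P. if t = inv' v \<circ> w then sign (inv' v \<circ> w) else 0)"
      unfolding signed_matching_def by (intro sum.cong refl) (auto simp: m)
    also have "\<dots> = sign (inv' v \<circ> w)" using fP permutes_compose[OF w(1) vi] by (simp add: sum.delta)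
    also have "\<dots> = sign v * sign w"
    proof -
      have "permutation w" "permutation v" using w(1) v(1) by (auto simp: permutation_permutes)
      then show ?thesis by (simp add: sign_compose permutation_inverse sign_inverse)
    qed
    finally show ?thesis using g by (simp add: mult.commute)
  next
    case False
    have "frobenius_gram k \<beta> \<gamma> = 0"
      unfolding gram using False by (intro sum.neutral ballI) auto
    moreover have "signed_matching k \<beta> \<gamma> = 0"
    proof (rule ccontr)
      assume "signed_matching k \<beta> \<gamma> \<noteq> 0"
      from signed_matching_nonzeroD[OF this] obtain t where inj: "inj_on \<beta> {..<k}"
        and t: "t permutes {..<k}" "\<forall>a<k. \<beta> a = \<gamma> (t a) \<and> \<beta> a \<ge> 0" by blast
      obtain w where w: "w permutes {..<k}" "\<forall>a<k. \<beta> a = int (w a)"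
        using sum_distinct_nonneg(2)[OF inj _ \<beta>] t by blast
      have ti: "inv' t permutes {..<k}" using t(1) by (rule permutes_inv)
      have "\<gamma> a = int ((w \<circ> inv' t) a)" if "a < k" for a
      proof -
        have "inv' t a < k" using permutes_in_image[OF ti, of a] that by simp
        then show ?thesis using t(2) w(2) permutes_inverses(1)[OF t(1), of a] by (metis comp_apply)
      qed
      then have "\<exists>v\<in>?P. \<forall>i<k. \<gamma> i = int (v i)"
        using permutes_compose[OF ti w(1)] by blast
      then show False using False w by blast
    qed
    ultimately show ?thesis by simp
  qed
qed

text \<open>Both sides satisfy the same recursion, which takes a cycle of length \<open>l\<close> off \<open>\<beta>\<close> and off \<open>\<gamma>\<close>.\<close>

theorem frobenius_gram_eq:
  assumes "2 * (\<Sum>i<k. \<beta> i) = 2 * int n + int k * (int k - 1)"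
  shows "frobenius_gram k \<beta> \<gamma> = signed_matching k \<beta> \<gamma>"
  using assms
proof (induction n arbitrary: \<beta> \<gamma> rule: less_induct)
  case (less n)
  show ?case
  proof (cases "n = 0")
    case True
    then show ?thesis using less.prems by (intro frobenius_gram_0) simp
  next
    case False
    \<comment> \<open>One cutoff for both recursions: the first asks for at least \<open>n\<close>,
      the second for at least every \<open>\<beta> i\<close>.\<close>
    define B where "B = n + (\<Sum>i<k. nat \<bar>\<beta> i\<bar>)"
    have B: "\<beta> i \<le> int B" if "i < k" for i
    proof -
      have "nat \<bar>\<beta> i\<bar> \<le> (\<Sum>i<k. nat \<bar>\<beta> i\<bar>)" using that by (intro member_le_sum) auto
      then show ?thesis unfolding B_def of_nat_add by linarith
    qed
    have eq: "frobenius_gram k (\<beta>(i := \<beta> i - int l)) (\<gamma>(j := \<gamma> j - int l)) =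
        signed_matching k (\<beta>(i := \<beta> i - int l)) (\<gamma>(j := \<gamma> j - int l))"
      if l: "1 \<le> l" and i: "i < k" for l i j
    proof -
      have "(\<Sum>a<k. (\<beta>(i := \<beta> i - int l)) a) = (\<Sum>a<k. \<beta> a) - int l"
        using i by (simp add: sum.remove[of "{..<k}" i])
      then have s: "2 * (\<Sum>a<k. (\<beta>(i := \<beta> i - int l)) a) = 2 * (int n - int l) + int k * (int k - 1)"
        using less.prems by simp
      show ?thesis
      proof (cases "l \<le> n")
        case True
        then have n': "int n - int l = int (n - l)" by simp
        show ?thesis
          by (rule less.IH[OF _ s[unfolded n']]) (use l True in simp)
      next
        case False
        show ?thesis by (rule frobenius_gram_neg[OF s]) (use False in simp)
      qed
    qed
    have "int n * frobenius_gram k \<beta> \<gamma> = (\<Sum>l=1..B. \<Sum>i<k. \<Sum>j<k.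
        frobenius_gram k (\<beta>(i := \<beta> i - int l)) (\<gamma>(j := \<gamma> j - int l)))"
      by (rule frobenius_gram_recursion[OF less.prems]) (simp add: B_def)
    also have "\<dots> = (\<Sum>l=1..B. \<Sum>i<k. \<Sum>j<k.
        signed_matching k (\<beta>(i := \<beta> i - int l)) (\<gamma>(j := \<gamma> j - int l)))"
      by (intro sum.cong refl eq) auto
    also have "\<dots> = int n * signed_matching k \<beta> \<gamma>"
      by (rule signed_matching_recursion[symmetric]) (use less.prems B in auto)
    finally show ?thesis using False by simp
  qed
qed

section \<open>Orthonormality over the symmetric group and the sign twist\<close>

lemma sum_frobenius_char_product:
  assumes S: "finite S" and \<beta>: "2 * (\<Sum>i<k. \<beta> i) = 2 * int (card S) + int k * (int k - 1)"
  shows "(\<Sum>p | p permutes S. frobenius_char S p k \<beta> * frobenius_char S p k \<gamma>) =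
    fact (card S) * signed_matching k \<beta> \<gamma>"
proof -
  let ?W = "{w. w permutes {..<k}}" and ?P = "{p. p permutes S}"
  let ?c = "\<lambda>p \<beta> w. int (card (fixed_colorings S p k (\<lambda>i. \<beta> i - int (w i))))"
  have "(\<Sum>p\<in>?P. frobenius_char S p k \<beta> * frobenius_char S p k \<gamma>) =
      (\<Sum>p\<in>?P. \<Sum>w\<in>?W. \<Sum>v\<in>?W. sign w * sign v * (?c p \<beta> w * ?c p \<gamma> v))"
    unfolding frobenius_char_def sum_product by (intro sum.cong refl) (simp add: mult_ac)
  also have "\<dots> = (\<Sum>w\<in>?W. \<Sum>v\<in>?W. sign w * sign v * (\<Sum>p\<in>?P. ?c p \<beta> w * ?c p \<gamma> v))"
    unfolding sum_distrib_left by (subst sum.swap, rule sum.cong[OF refl], rule sum.swap)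
  also have "\<dots> = (\<Sum>w\<in>?W. \<Sum>v\<in>?W. sign w * sign v * (fact (card S) *
      int (card (margin_matrices k (\<lambda>i. \<beta> i - int (w i)) (\<lambda>i. \<gamma> i - int (v i))))))"
  proof (intro sum.cong refl arg_cong2[of _ _ _ _ "(*)"])
    fix w v assume "w \<in> ?W"
    then have w: "w permutes {..<k}" by simp
    have "(\<Sum>i<k. \<beta> i - int (w i)) = int (card S)"
      using \<beta> double_sum_lessThan[of k] by (simp add: sum_subtractf sum_permuted[OF w])
    from arg_cong[OF sum_card_fixed_colorings_product[OF S this, of "\<lambda>i. \<gamma> i - int (v i)"], of int]
    show "(\<Sum>p\<in>?P. ?c p \<beta> w * ?c p \<gamma> v) = fact (card S) *
        int (card (margin_matrices k (\<lambda>i. \<beta> i - int (w i)) (\<lambda>i. \<gamma> i - int (v i))))"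
      by simp
  qed
  also have "\<dots> = fact (card S) * frobenius_gram k \<beta> \<gamma>"
    unfolding frobenius_gram_def sum_distrib_left by (intro sum.cong refl) (simp add: mult_ac)
  finally show ?thesis using frobenius_gram_eq[OF \<beta>] by simp
qed

lemma signed_matching_self:
  assumes inj: "inj_on \<beta> {..<k}" and nn: "\<forall>a<k. \<beta> a \<ge> 0"
  shows "signed_matching k \<beta> \<beta> = 1"
proof -
  have "(\<forall>a<k. \<beta> a = \<beta> (t a) \<and> \<beta> a \<ge> 0) \<longleftrightarrow> t = id" if t: "t permutes {..<k}" for t
  proof
    assume h: "\<forall>a<k. \<beta> a = \<beta> (t a) \<and> \<beta> a \<ge> 0"
    have "t a = id a" if "a < k" for a
    proof -
      have "t a < k" using permutes_in_image[OF t, of a] that by simp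
      then show ?thesis using h that inj by (auto simp: inj_on_def)
    qed
    then show "t = id" using permutes_lessThan_eq[OF t permutes_id] by auto
  qed (use nn in auto)
  then have "signed_matching k \<beta> \<beta> = (\<Sum>t | t permutes {..<k}. if t = id then 1 else 0)"
    unfolding signed_matching_def by (intro sum.cong refl) auto
  then show ?thesis by (simp add: finite_permutations permutes_id)
qed

text \<open>Two points of the large colour class of \<open>c\<close> also share their colour under \<open>d\<close>, and the transposition
  of these points reverses signs in the stabilizer of \<open>(c, d)\<close>.\<close>

lemma sum_sign_card_fixed_colorings_product:
  assumes S: "finite S" and i: "i < k" and big: "\<alpha> i > int (card {j. j < k \<and> \<beta> j \<noteq> 0})"
  shows "(\<Sum>p | p permutes S. sign p * int (card (fixed_colorings S p k \<alpha>) * card (fixed_colorings S p k \<beta>))) = 0"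
proof -
  let ?P = "{p. p permutes S}"
  let ?C = "colorings S k \<alpha> \<times> colorings S k \<beta>"
  let ?fix = "\<lambda>p (c, d). (\<forall>x\<in>S. c (p x) = c x \<and> d (p x) = d x)"
  have fC: "finite ?C" using finite_colorings[OF S] by auto
  have fP: "finite ?P" using S by (rule finite_permutations)
  have "(\<Sum>p\<in>?P. sign p * int (card (fixed_colorings S p k \<alpha>) * card (fixed_colorings S p k \<beta>))) =
      (\<Sum>p\<in>?P. \<Sum>cd\<in>?C. sign p * of_bool (?fix p cd))"
  proof (rule sum.cong[OF refl])
    fix p
    have "fixed_colorings S p k \<alpha> \<times> fixed_colorings S p k \<beta> = {cd\<in>?C. ?fix p cd}"
      by (auto simp: fixed_colorings_def)
    then have "card (fixed_colorings S p k \<alpha>) * card (fixed_colorings S p k \<beta>) = card {cd\<in>?C. ?fix p cd}"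
      by (simp add: card_cartesian_product[symmetric])
    then show "sign p * int (card (fixed_colorings S p k \<alpha>) * card (fixed_colorings S p k \<beta>)) =
        (\<Sum>cd\<in>?C. sign p * of_bool (?fix p cd))"
      using fC by (simp add: sum_distrib_left[symmetric] sum_of_bool_eq Int_def)
  qed
  also have "\<dots> = (\<Sum>cd\<in>?C. \<Sum>p\<in>?P. sign p * of_bool (?fix p cd))" by (rule sum.swap)
  also have "\<dots> = 0"
  proof (rule sum.neutral, rule ballI)
    fix cd assume "cd \<in> ?C"
    then obtain c d where cd: "cd = (c, d)" "c \<in> colorings S k \<alpha>" "d \<in> colorings S k \<beta>" by auto
    \<comment> \<open>Pigeonhole: \<open>d\<close> takes only colours whose class size is nonzero,
      and class \<open>i\<close> of \<open>c\<close> has more points than there are such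
      colours.\<close>
    have "\<not> inj_on d {x\<in>S. c x = i}"
    proof
      assume "inj_on d {x\<in>S. c x = i}"
      moreover have "d ` {x\<in>S. c x = i} \<subseteq> {j. j < k \<and> \<beta> j \<noteq> 0}"
      proof
        fix j assume "j \<in> d ` {x\<in>S. c x = i}"
        then obtain x where x: "x \<in> S" "d x = j" by auto
        then have j: "j < k" using cd by (auto simp: colorings_def)
        have "card {x\<in>S. d x = j} \<noteq> 0" using x S by auto
        then show "j \<in> {j. j < k \<and> \<beta> j \<noteq> 0}" using cd(3) j by (auto simp: colorings_def)
      qed
      ultimately have "card {x\<in>S. c x = i} \<le> card {j. j < k \<and> \<beta> j \<noteq> 0}"
        by (intro card_inj_on_le) auto
      moreover have "int (card {x\<in>S. c x = i}) = \<alpha> i" using cd i by (simp add: colorings_def)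
      ultimately show False using big by simp
    qed
    then obtain x y where xy: "x \<in> S" "y \<in> S" "x \<noteq> y" "c x = c y" "d x = d y"
      by (auto simp: inj_on_def)
    let ?s = "transpose x y"
    have s: "?s permutes S" using xy by (auto intro: permutes_swap_id)
    have f: "?fix (p \<circ> ?s) cd \<longleftrightarrow> ?fix p cd" for p
    proof -
      have cs: "c (?s z) = c z" "d (?s z) = d z" "?s z \<in> S \<longleftrightarrow> z \<in> S" for z
        using xy by (auto simp: transpose_def)
      have "?fix (p \<circ> ?s) cd \<longleftrightarrow> (\<forall>z\<in>S. c (p (?s z)) = c (?s z) \<and> d (p (?s z)) = d (?s z))"
        by (simp add: cd(1) cs)
      also have "\<dots> \<longleftrightarrow> ?fix p cd" unfolding cd(1) prod.case by (metis cs(3) transpose_involutory)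
      finally show ?thesis .
    qed
    have "(\<Sum>p\<in>?P. sign p * of_bool (?fix p cd)) = (\<Sum>p\<in>?P. sign (p \<circ> ?s) * of_bool (?fix (p \<circ> ?s) cd))"
      by (rule sum_permutations_compose_right[OF s])
    also have "\<dots> = (\<Sum>p\<in>?P. - (sign p * of_bool (?fix p cd) :: int))"
    proof (intro sum.cong refl)
      fix p assume "p \<in> ?P"
      then have "sign (p \<circ> ?s) = - sign p"
        using s S xy by (subst sign_compose) (auto simp: permutation_permutes sign_swap_id)
      then show "sign (p \<circ> ?s) * of_bool (?fix (p \<circ> ?s) cd) = - (sign p * of_bool (?fix p cd))"
        unfolding f by simp
    qed
    finally show "(\<Sum>p\<in>?P. sign p * of_bool (?fix p cd)) = (0 :: int)" by (simp add: sum_negf)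
  qed
  finally show ?thesis .
qed

section \<open>Existence of cores\<close>

text \<open>The beads of an \<open>L\<close>-core of \<open>n\<close>. The last condition says that the first part exceeds the number of
  parts, hence that the partition differs from its conjugate and its character stays irreducible on
  the alternating group.\<close>

definition core_beads :: "nat \<Rightarrow> nat \<Rightarrow> nat set \<Rightarrow> bool"
  where "core_beads L n A \<longleftrightarrow> finite A \<and> \<Sum>A = n + \<Sum>{..<card A} \<and>
    (\<forall>b\<in>A. L \<le> b \<longrightarrow> b - L \<in> A) \<and> (\<exists>b\<in>A. 2 * card A \<le> b)"

text \<open>In terms of partitions: a box with sides \<open>c\<close> and \<open>N - c\<close>
  contains partitions of every size up to its area. In the induction step the new largest number is
  taken exactly when the surplus \<open>s\<close> cannot be reached without it.\<close>

lemma exists_subset_with_sum: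
  assumes "c \<le> N" "s \<le> c * (N - c)"
  shows "\<exists>R\<subseteq>{..<N}. card R = c \<and> \<Sum>R = s + \<Sum>{..<c::nat}"
  using assms
proof (induction N arbitrary: c s)
  case (Suc N)
  show ?case
  proof (cases "c \<le> N \<and> s \<le> c * (N - c)")
    case True
    then obtain R where "R \<subseteq> {..<N}" "card R = c" "\<Sum>R = s + \<Sum>{..<c}" using Suc.IH by blast
    then show ?thesis by (intro exI[of _ R]) auto
  next
    case False
    show ?thesis
    proof (cases c)
      case 0
      then show ?thesis using Suc.prems by auto
    next
      case (Suc d)
      \<comment> \<open>The share of the surplus that the element \<open>N\<close> uses up: it
        exceeds \<open>d\<close>, the largest element of the minimal set \<open>{..<c}\<close>, by
        \<open>e\<close>.\<close>
      define e where "e = N - d"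
      have dN: "N = d + e" using Suc.prems Suc by (simp add: e_def)
      have le: "e \<le> s"
      proof (cases e)
        case (Suc f)
        have "s > Suc d * f" using False \<open>c = Suc d\<close> dN Suc by auto
        then show ?thesis using Suc by simp
      qed simp
      have "s - e \<le> d * (N - d)" using Suc.prems Suc dN by simp
      then obtain R where R: "R \<subseteq> {..<N}" "card R = d" "\<Sum>R = (s - e) + \<Sum>{..<d}"
        using Suc.IH[of d "s - e"] dN by auto
      have fR: "finite R" "N \<notin> R" using R finite_subset by auto
      have "\<Sum>(insert N R) = s + \<Sum>{..<c}" using fR R Suc dN le by simp
      moreover have "card (insert N R) = c" using fR R Suc by simp
      moreover have "insert N R \<subseteq> {..<Suc N}" using R by auto
      ultimately show ?thesis by blast
    qed
  qed
qed auto

text \<open>With all beads below \<open>L\<close> none can move down by \<open>L\<close>, so every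
  such set is a core. The bead \<open>L - 1\<close> is forced in, to have one of size at least
  \<open>2 * k\<close>; it accounts for \<open>L - k\<close> of \<open>n\<close>, whence the lower
  bound. The other beads vary freely.\<close>

lemma exists_core_in_box:
  assumes k: "1 \<le> k" "2 * k < L" and n: "L \<le> n + k" "n \<le> k * (L - k)"
  shows "\<exists>A. core_beads L n A"
proof -
  define e where "e = L - k"
  have L: "L = k + e" and ke: "k < e" using k by (auto simp: e_def)
  obtain d where d: "k = Suc d" using k by (cases k) auto
  have "n - e \<le> d * (L - 1 - d)" using n d L by simp
  moreover have "d \<le> L - 1" using L d by simp
  ultimately obtain R where R: "R \<subseteq> {..<L - 1}" "card R = d" "\<Sum>R = (n - e) + \<Sum>{..<d}"
    using exists_subset_with_sum by blast
  have fR: "finite R" "L - 1 \<notin> R" using R finite_subset by auto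
  have c: "card (insert (L - 1) R) = k" using fR R d by simp
  have "core_beads L n (insert (L - 1) R)"
    unfolding core_beads_def c
  proof (intro conjI)
    show "\<Sum>(insert (L - 1) R) = n + \<Sum>{..<k}" using fR R d n L by simp
    show "\<forall>b\<in>insert (L - 1) R. L \<le> b \<longrightarrow> b - L \<in> insert (L - 1) R" using R(1) L ke by fastforce
    show "\<exists>b\<in>insert (L - 1) R. 2 * k \<le> b" using k by auto
  qed (use fR in simp)
  then show ?thesis by blast
qed

text \<open>The bead \<open>2 * L - 1\<close> sits one level above \<open>L - 1\<close>, and the
  others are below \<open>L - 1\<close>. Among the \<open>u + 1\<close> beads these two account for
  \<open>3 * L - 2 * u - 1\<close> of \<open>n\<close>. With \<open>u\<close> near L / 2 this
  reaches about 3 L / 2 beyond the area of the largest box.\<close>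

lemma exists_core_two_levels:
  assumes u: "1 \<le> u" "2 * u \<le> L" "4 \<le> L" and n: "3 * L \<le> n + 2 * u + 1" "n + u + 1 \<le> u * (L - u) + 2 * L"
  shows "\<exists>A. core_beads L n A"
proof -
  define e where "e = L - u"
  have L: "L = u + e" and ke: "u \<le> e" using u by (auto simp: e_def)
  obtain d where d: "u = Suc d" using u by (cases u) auto
  define s where "s = n + 2 * u + 1 - 3 * L"
  have s: "n + 2 * u + 1 = s + 3 * L" using n by (simp add: s_def)
  have "s \<le> d * (L - 1 - d)" using n s d L by (simp add: algebra_simps)
  moreover have "d \<le> L - 1" using L d by simp
  ultimately obtain R where R: "R \<subseteq> {..<L - 1}" "card R = d" "\<Sum>R = s + \<Sum>{..<d}"
    using exists_subset_with_sum by blast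
  let ?A = "insert (2 * L - 1) (insert (L - 1) R)"
  have fR: "finite R" "L - 1 \<notin> R" "2 * L - 1 \<notin> insert (L - 1) R" using R u finite_subset by fastforce+
  have c: "card ?A = Suc u" using fR R d by simp
  have "core_beads L n ?A"
    unfolding core_beads_def c
  proof (intro conjI)
    have "\<Sum>?A = (2 * L - 1) + (L - 1) + (s + \<Sum>{..<d})" using fR R by simp
    moreover have "\<Sum>{..<Suc u} = \<Sum>{..<d} + d + u" by (simp add: d)
    ultimately show "\<Sum>?A = n + \<Sum>{..<Suc u}" using s d u by simp
    show "\<forall>b\<in>?A. L \<le> b \<longrightarrow> b - L \<in> ?A"
    proof (intro ballI impI)
      fix b assume "b \<in> ?A" "L \<le> b"
      then have "b = 2 * L - 1" using R(1) u by auto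
      then have "b - L = L - 1" by simp
      then show "b - L \<in> ?A" by simp
    qed
    show "\<exists>b\<in>?A. 2 * Suc u \<le> b" using u by auto
  qed (use fR in simp)
  then show ?thesis by blast
qed

text \<open>Bounds the sum of prime powers up to \<open>L\<close> that belong to distinct primes greater than 3, since these
  are numbers coprime to 6.\<close>

primrec sum_coprime_6 :: "nat \<Rightarrow> nat"
  where "sum_coprime_6 0 = 0"
  | "sum_coprime_6 (Suc n) = sum_coprime_6 n + (if 4 \<le> n \<and> Suc n mod 6 \<in> {1, 5} then Suc n else 0)"

lemma sum_coprime_6_numeral:
  "sum_coprime_6 (numeral v) = sum_coprime_6 (pred_numeral v) +
    (if 4 \<le> (pred_numeral v :: nat) \<and> (numeral v :: nat) mod 6 \<in> {1, 5} then numeral v else 0)"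
  by (metis numeral_eq_Suc sum_coprime_6.simps(2))

lemma sum_coprime_6_small: "L \<le> 4 \<Longrightarrow> sum_coprime_6 L = 0"
  by (induction L) auto

lemma sum_coprime_6_ge:
  assumes "F \<subseteq> {5..L}" "\<forall>x\<in>F. x mod 6 \<in> {1, 5}"
  shows "\<Sum>F \<le> sum_coprime_6 L"
  using assms
proof (induction L arbitrary: F)
  case (Suc L)
  have fF: "finite F" using Suc.prems(1) finite_subset by blast
  have "\<Sum>(F - {Suc L}) \<le> sum_coprime_6 L"
    using Suc.prems by (intro Suc.IH) (auto simp: le_Suc_eq)
  moreover have "\<Sum>F \<le> \<Sum>(F - {Suc L}) + (if Suc L \<in> F then Suc L else 0)"
    using fF by (auto simp: sum.remove)
  moreover have "Suc L \<in> F \<Longrightarrow> 4 \<le> L \<and> Suc L mod 6 \<in> {1, 5}" using Suc.prems by auto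
  ultimately show ?case by (auto split: if_splits)
qed auto

text \<open>The added 1 restores the number 1, which \<open>sum_coprime_6\<close> leaves out. The
  block of six after \<open>6 * q\<close> then contributes \<open>12 * q + 6\<close>.\<close>

lemma sum_coprime_6_mult: "q \<ge> 1 \<Longrightarrow> sum_coprime_6 (6 * q) + 1 = 6 * q * q"
proof (induction q rule: nat_induct_at_least)
  case base
  then show ?case by (simp add: sum_coprime_6_numeral)
next
  case (Suc q)
  have m: "Suc (6 * q) mod 6 = 1" "Suc (Suc (6 * q)) mod 6 = 2" "Suc (Suc (Suc (6 * q))) mod 6 = 3"
    "Suc (Suc (Suc (Suc (6 * q)))) mod 6 = 4" "Suc (Suc (Suc (Suc (Suc (6 * q))))) mod 6 = 5"
    "Suc (Suc (Suc (Suc (Suc (Suc (6 * q)))))) mod 6 = 0" by presburger+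
  have "6 * Suc q = Suc (Suc (Suc (Suc (Suc (Suc (6 * q))))))" by simp
  then have "sum_coprime_6 (6 * Suc q) = sum_coprime_6 (6 * q) + (6 * q + 1) + (6 * q + 5)"
    using Suc.hyps by (simp only: sum_coprime_6.simps m) simp
  then show ?case using Suc.IH by (simp add: algebra_simps)
qed

lemma sum_coprime_6_le: "6 * sum_coprime_6 L \<le> L * L + 4 * L"
proof (cases "L < 6")
  case True
  then have "L \<in> {0, 1, 2, 3, 4, 5}" by auto
  then show ?thesis by (auto simp: sum_coprime_6_numeral)
next
  case False
  define q where "q = L div 6"
  have q: "q \<ge> 1" using False by (simp add: q_def)
  have m: "Suc (6 * q) mod 6 = 1" "Suc (Suc (6 * q)) mod 6 = 2" "Suc (Suc (Suc (6 * q))) mod 6 = 3"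
    "Suc (Suc (Suc (Suc (6 * q)))) mod 6 = 4" "Suc (Suc (Suc (Suc (Suc (6 * q))))) mod 6 = 5" by presburger+
  have s: "sum_coprime_6 (6 * q) + 1 = 6 * q * q" using sum_coprime_6_mult[OF q] .
  have "L = 6 * q + L mod 6" "L mod 6 < 6" by (auto simp: q_def)
  then consider "L = 6 * q" | "L = Suc (6 * q)" | "L = Suc (Suc (6 * q))" | "L = Suc (Suc (Suc (6 * q)))"
    | "L = Suc (Suc (Suc (Suc (6 * q))))" | "L = Suc (Suc (Suc (Suc (Suc (6 * q)))))" by linarith
  then show ?thesis
  proof cases
  qed (use s q in \<open>simp_all only: sum_coprime_6.simps m\<close>, (use s q in \<open>simp add: algebra_simps\<close>)+)
qed

text \<open>Entries \<open>(L, n, beads)\<close>, found by a computer search.\<close>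

definition small_cores :: "(nat \<times> nat \<times> nat list) list"
  where "small_cores =
    [(4, 5, [1, 5]),
     (4, 6, [1, 2, 6]),
     (4, 7, [2, 6]),
     (4, 8, [2, 3, 6]),
     (4, 9, [3, 7]),
     (4, 11, [1, 2, 5, 9]),
     (4, 12, [1, 5, 9]),
     (5, 5, [2, 4]),
     (5, 6, [3, 4]),
     (5, 7, [1, 2, 7]),
     (5, 8, [2, 7]),
     (5, 9, [2, 3, 7]),
     (5, 10, [3, 8]),
     (5, 11, [1, 4, 9]),
     (5, 12, [4, 9]),
     (5, 13, [3, 4, 9]),
     (5, 14, [2, 3, 7, 8]),
     (5, 15, [1, 6, 11]),
     (5, 16, [2, 4, 7, 9]),
     (5, 17, [1, 2, 3, 8, 13]),
     (6, 6, [3, 4]),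
     (6, 7, [3, 5]),
     (6, 8, [4, 5]),
     (6, 9, [2, 8]),
     (6, 10, [2, 3, 8]),
     (6, 11, [3, 9]),
     (6, 12, [2, 5, 8]),
     (6, 13, [4, 10]),
     (6, 14, [3, 4, 10]),
     (6, 15, [5, 11]),
     (6, 16, [4, 5, 10]),
     (6, 17, [4, 5, 11]),
     (7, 7, [3, 5]),
     (7, 8, [4, 5]),
     (7, 9, [4, 6]),
     (7, 10, [5, 6]),
     (7, 11, [3, 5, 6]),
     (7, 12, [3, 10]),
     (7, 13, [2, 5, 9]),
     (7, 14, [4, 11]),
     (7, 15, [3, 4, 11]),
     (7, 16, [5, 12]),
     (7, 17, [4, 5, 11]),
     (7, 18, [6, 13]),
     (7, 19, [3, 6, 13]),
     (7, 20, [5, 6, 12]),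
     (7, 21, [5, 6, 13]),
     (7, 22, [4, 5, 6, 13]),
     (7, 23, [1, 5, 8, 15]),
     (7, 24, [2, 9, 16]),
     (8, 28, [4, 5, 12, 13]),
     (8, 29, [2, 3, 11, 19]),
     (8, 30, [3, 11, 19]),
     (8, 31, [3, 4, 11, 19]),
     (8, 32, [5, 6, 13, 14]),
     (9, 34, [5, 6, 14, 15]),
     (9, 35, [3, 5, 12, 21]),
     (9, 36, [4, 13, 22]),
     (9, 37, [3, 7, 12, 21]),
     (9, 38, [6, 7, 15, 16]),
     (11, 47, [4, 8, 15, 26]),
     (11, 48, [6, 17, 28]),
     (11, 49, [5, 7, 16, 27]),
     (13, 62, [10, 11, 23, 24])]"

lemma small_cores_correct: "(L, n, xs) \<in> set small_cores \<Longrightarrow> core_beads L n (set xs)"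
proof -
  have "\<forall>(L, n, xs)\<in>set small_cores. core_beads L n (set xs)"
    unfolding small_cores_def by (simp add: core_beads_def lessThan_nat_numeral lessThan_Suc)
  then show "(L, n, xs) \<in> set small_cores \<Longrightarrow> core_beads L n (set xs)" by auto
qed

text \<open>For L from 4 to 7 the ranges end at \<open>2 * A + B + sum_coprime_6 L + 1\<close> with
  the largest possible powers A = 4 and B = 3, which is 12, 17, 17 and 24.\<close>

lemma small_core_4:
  assumes "5 \<le> n" "n \<le> 12" "n \<noteq> 10"
  shows "\<exists>A. core_beads 4 n A"
proof -
  have "n = 5 \<or> n = 6 \<or> n = 7 \<or> n = 8 \<or> n = 9 \<or> n = 11 \<or> n = 12" using assms by presburger
  then have "\<exists>xs. (4, n, xs) \<in> set small_cores"
    by (elim disjE) (simp_all add: small_cores_def)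
  then show ?thesis using small_cores_correct by blast
qed

lemma small_core_5:
  assumes "5 \<le> n" "n \<le> 17"
  shows "\<exists>A. core_beads 5 n A"
proof -
  have "n = 5 \<or> n = 6 \<or> n = 7 \<or> n = 8 \<or> n = 9 \<or> n = 10 \<or> n = 11 \<or> n = 12 \<or> n = 13 \<or> n = 14 \<or> n = 15 \<or> n = 16 \<or> n = 17" using assms by presburger
  then have "\<exists>xs. (5, n, xs) \<in> set small_cores"
    by (elim disjE) (simp_all add: small_cores_def)
  then show ?thesis using small_cores_correct by blast
qed

lemma small_core_6:
  assumes "6 \<le> n" "n \<le> 17"
  shows "\<exists>A. core_beads 6 n A"
proof -
  have "n = 6 \<or> n = 7 \<or> n = 8 \<or> n = 9 \<or> n = 10 \<or> n = 11 \<or> n = 12 \<or> n = 13 \<or> n = 14 \<or> n = 15 \<or> n = 16 \<or> n = 17" using assms by presburger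
  then have "\<exists>xs. (6, n, xs) \<in> set small_cores"
    by (elim disjE) (simp_all add: small_cores_def)
  then show ?thesis using small_cores_correct by blast
qed

lemma small_core_7:
  assumes "7 \<le> n" "n \<le> 24"
  shows "\<exists>A. core_beads 7 n A"
proof -
  have "n = 7 \<or> n = 8 \<or> n = 9 \<or> n = 10 \<or> n = 11 \<or> n = 12 \<or> n = 13 \<or> n = 14 \<or> n = 15 \<or> n = 16 \<or> n = 17 \<or> n = 18 \<or> n = 19 \<or> n = 20 \<or> n = 21 \<or> n = 22 \<or> n = 23 \<or> n = 24" using assms by presburger
  then have "\<exists>xs. (7, n, xs) \<in> set small_cores"
    by (elim disjE) (simp_all add: small_cores_def)
  then show ?thesis using small_cores_correct by blast
qed

lemma small_core_8:
  assumes "28 \<le> n" "n \<le> 32"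
  shows "\<exists>A. core_beads 8 n A"
proof -
  have "n = 28 \<or> n = 29 \<or> n = 30 \<or> n = 31 \<or> n = 32" using assms by presburger
  then have "\<exists>xs. (8, n, xs) \<in> set small_cores"
    by (elim disjE) (simp_all add: small_cores_def)
  then show ?thesis using small_cores_correct by blast
qed

lemma small_core_9:
  assumes "34 \<le> n" "n \<le> 38"
  shows "\<exists>A. core_beads 9 n A"
proof -
  have "n = 34 \<or> n = 35 \<or> n = 36 \<or> n = 37 \<or> n = 38" using assms by presburger
  then have "\<exists>xs. (9, n, xs) \<in> set small_cores"
    by (elim disjE) (simp_all add: small_cores_def)
  then show ?thesis using small_cores_correct by blast
qed

lemma small_core_11:
  assumes "47 \<le> n" "n \<le> 49"
  shows "\<exists>A. core_beads 11 n A"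
proof -
  have "n = 47 \<or> n = 48 \<or> n = 49" using assms by presburger
  then have "\<exists>xs. (11, n, xs) \<in> set small_cores"
    by (elim disjE) (simp_all add: small_cores_def)
  then show ?thesis using small_cores_correct by blast
qed

lemma small_core_13:
  assumes "62 \<le> n" "n \<le> 62"
  shows "\<exists>A. core_beads 13 n A"
proof -
  have "n = 62" using assms by presburger
  then have "\<exists>xs. (13, n, xs) \<in> set small_cores"
    by (simp add: small_cores_def)
  then show ?thesis using small_cores_correct by blast
qed

section \<open>Cores for every cycle length\<close>

lemma power2_bound:
  assumes "A = 2 ^ a" "A < 2 ^ Suc e" shows "A \<le> (2 ^ e :: nat)"
  using assms power_strict_increasing_iff[of "2 :: nat" a "Suc e"] by (simp add: power_increasing less_Suc_eq_le)

lemma power3_bound: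
  assumes "B = 0 \<or> (\<exists>b. B = 3 ^ b)" "B < 3 ^ Suc e" shows "B \<le> (3 ^ e :: nat)"
  using assms(1)
proof
  assume "\<exists>b. B = 3 ^ b"
  then obtain b where b: "B = 3 ^ b" by blast
  then have "b < Suc e" using assms(2) power_strict_increasing_iff[of "3 :: nat" b "Suc e"] by simp
  then show ?thesis unfolding b by (intro power_increasing) auto
qed simp

text \<open>In the application \<open>L\<close> is the length of the longest cycle, \<open>A\<close>
  the 2-part of the order and \<open>B\<close> its 3-part, or 0 if 3 does not divide the order. The
  bound on \<open>n\<close> grows like L^2 / 6 and the constructions reach L^2 / 4, so that the
  question is only how small \<open>L\<close> may be.\<close>

lemma exists_core:
  assumes L: "4 \<le> L" "5 \<le> n" "L \<le> n" and A: "A = 2 ^ a" "A \<le> L" and B: "B = 0 \<or> (\<exists>b. B = 3 ^ b)" "B \<le> L"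
    and n: "n \<le> 2 * A + B + sum_coprime_6 L + 1" and ex: "(L, n) \<noteq> (4, 10)"
  shows "\<exists>A. core_beads L n A"
proof -
  \<comment> \<open>A box with \<open>k = (L - 1) div 2\<close> serves the smaller \<open>n\<close>,
    two levels with \<open>u = L div 2\<close> the larger ones. The second case checks that there is
    no gap between them.\<close>
  have gen: ?thesis if L8: "8 \<le> L" and bnd: "n + L div 2 + 1 \<le> L div 2 * (L - L div 2) + 2 * L"
  proof (cases "n \<le> ((L - 1) div 2) * (L - (L - 1) div 2)")
    case True
    then show ?thesis using L8 L by (intro exists_core_in_box[of "(L - 1) div 2"]) auto
  next
    case False
    have "3 * L \<le> n + 2 * (L div 2) + 1"
    proof -
      define j where "j = L div 2"
      have j: "4 \<le> j" "L = 2 * j \<or> L = 2 * j + 1" using L8 by (auto simp: j_def)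
      show ?thesis
      proof (cases "L = 2 * j")
        case t: True
        then have f: "(L - 1) div 2 = j - 1" using j by simp
        obtain i where i: "j = i + 4" using j le_Suc_ex by (metis add.commute)
        have "n > (j - 1) * (j + 1)" using False t j f by (simp add: not_le)
        then show ?thesis using t i by (simp add: algebra_simps)
      next
        case t: False
        then have t': "L = 2 * j + 1" using j by simp
        obtain i where i: "j = i + 4" using j le_Suc_ex by (metis add.commute)
        have "n > j * (j + 1)" using False t' j by (simp add: not_le)
        then show ?thesis using t' i by (simp add: algebra_simps)
      qed
    qed
    then show ?thesis using L8 bnd by (intro exists_core_two_levels[of "L div 2"]) auto
  qed
  have A4: "L < 8 \<Longrightarrow> A \<le> 4" and A8: "L < 16 \<Longrightarrow> A \<le> 8" and A16: "L < 32 \<Longrightarrow> A \<le> 16"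
    using power2_bound[OF A(1), of 2] power2_bound[OF A(1), of 3] power2_bound[OF A(1), of 4] A(2) by auto
  have B3: "L < 9 \<Longrightarrow> B \<le> 3" and B9: "L < 27 \<Longrightarrow> B \<le> 9"
    using power3_bound[OF B(1), of 1] power3_bound[OF B(1), of 2] B(2) by auto
  show ?thesis
  \<comment> \<open>From 27 on the crude bounds \<open>A \<le> L\<close> and
    \<open>B \<le> L\<close> suffice. At 26 they would allow \<open>n\<close> up to 209 against a
    reach of 207, so below 27 the actual powers of 2 and 3 are used.\<close>
  proof (cases "L < 27")
    case False
    define j where "j = L div 2"
    have j: "13 \<le> j" "L = 2 * j \<or> L = 2 * j + 1" using False by (auto simp: j_def)
    have s: "6 * sum_coprime_6 L \<le> L * L + 4 * L" by (rule sum_coprime_6_le)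
    have "6 * n \<le> 6 * (2 * A + B + sum_coprime_6 L + 1)" using n by simp
    also have "\<dots> \<le> L * L + 22 * L + 6" using s A(2) B(2) by simp
    finally have n6: "6 * n \<le> L * L + 22 * L + 6" .
    have "n + j + 1 \<le> j * (L - j) + 2 * L"
    proof (cases "L = 2 * j")
      case t: True
      then obtain i where i: "j = i + 14" using False le_Suc_ex[of 14 j] by (auto simp: add.commute)
      show ?thesis using n6 unfolding t i by (simp add: algebra_simps)
    next
      case t: False
      then have t': "L = 2 * j + 1" using j by simp
      obtain i where i: "j = i + 13" using j le_Suc_ex[of 13 j] by (auto simp: add.commute)
      show ?thesis using n6 unfolding t' i by (simp add: algebra_simps)
    qed
    then show ?thesis using gen False by (simp add: j_def)
  next
    case True
    then have "L = 4 \<or> L = 5 \<or> L = 6 \<or> L = 7 \<or> L = 8 \<or> L = 9 \<or> L = 10 \<or> L = 11 \<or> L = 12 \<or> L = 13 \<or> L = 14 \<or> L = 15 \<or> L = 16 \<or> L = 17 \<or> L = 18 \<or> L = 19 \<or> L = 20 \<or> L = 21 \<or> L = 22 \<or> L = 23 \<or> L = 24 \<or> L = 25 \<or> L = 26"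
      using L(1) by presburger
    then consider "L = 4" | "L = 5" | "L = 6" | "L = 7" | "L = 8" | "L = 9" | "L = 10" | "L = 11" | "L = 12"
      | "L = 13" | "L = 14" | "L = 15" | "L = 16" | "L = 17" | "L = 18" | "L = 19" | "L = 20" | "L = 21"
      | "L = 22" | "L = 23" | "L = 24" | "L = 25" | "L = 26" by blast
    then show ?thesis
    proof cases
      case 1
      have "sum_coprime_6 4 = 0" by (simp add: sum_coprime_6_numeral)
      then have "n \<le> 12" using 1 n A4 B3 by simp
      moreover have "n \<noteq> 10" using ex 1 by simp
      ultimately show ?thesis using 1 L small_core_4 by simp
    next
      case 2
      have "sum_coprime_6 5 = 5" by (simp add: sum_coprime_6_numeral)
      then show ?thesis using 2 L n A4 B3 small_core_5 by simp
    next
      case 3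
      have "sum_coprime_6 6 = 5" by (simp add: sum_coprime_6_numeral)
      then show ?thesis using 3 L n A4 B3 small_core_6 by simp
    next
      case 4
      have "sum_coprime_6 7 = 12" by (simp add: sum_coprime_6_numeral)
      then show ?thesis using 4 L n A4 B3 small_core_7 by simp
    next
      case 5
      have "sum_coprime_6 8 = 12" by (simp add: sum_coprime_6_numeral)
      then have "n \<le> 32" using 5 n A8 B3 by simp
      then show ?thesis using 5 gen small_core_8[of n] by (cases "n \<le> 27") simp_all
    next
      case 6
      have "sum_coprime_6 9 = 12" by (simp add: sum_coprime_6_numeral)
      then have "n \<le> 38" using 6 n A8 B9 by simp
      then show ?thesis using 6 gen small_core_9[of n] by (cases "n \<le> 33") simp_all
    next
      case 8
      have "sum_coprime_6 11 = 23" by (simp add: sum_coprime_6_numeral)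
      then have "n \<le> 49" using 8 n A8 B9 by simp
      then show ?thesis using 8 gen small_core_11[of n] by (cases "n \<le> 46") simp_all
    next
      case 10
      have "sum_coprime_6 13 = 36" by (simp add: sum_coprime_6_numeral)
      then have "n \<le> 62" using 10 n A8 B9 by simp
      then show ?thesis using 10 gen small_core_13[of n] by (cases "n \<le> 61") simp_all
    \<comment> \<open>For all the other lengths from 10 to 26 the general constructions reach as far
      as the bound on \<open>n\<close>.\<close>
    qed (use n gen A8 A16 B9 in \<open>auto simp: sum_coprime_6_numeral\<close>)
  qed
qed

section \<open>Cycle lengths and element orders\<close>

text \<open>Write \<open>m = l * c\<close>. If \<open>p\<close> did not divide \<open>c\<close>, the
  full power of \<open>p\<close> in \<open>m\<close> would divide \<open>l\<close>.\<close>

lemma dvd_div_prime: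
  fixes m :: nat
  assumes p: "prime p" and l: "l dvd m" and m: "m \<noteq> 0" and nd: "\<not> p ^ multiplicity p m dvd l"
  shows "l dvd m div p"
proof -
  obtain c where c: "m = l * c" using l by blast
  have "p dvd c"
  proof (rule ccontr)
    assume "\<not> p dvd c"
    then have "coprime (p ^ multiplicity p m) c" using p by (simp add: prime_imp_coprime)
    moreover have "p ^ multiplicity p m dvd l * c" using c multiplicity_dvd by metis
    ultimately show False using nd coprime_dvd_mult_left_iff by blast
  qed
  then obtain c' where "c = p * c'" by blast
  then show ?thesis using c p by (simp add: prime_gt_0_nat)
qed

lemma alt_group_pow: "g [^]\<^bsub>alt_group n\<^esub> (j :: nat) = g ^^ j"
proof (induction j)
  case 0
  interpret group "alt_group n" by (rule alt_group_is_group)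
  show ?case using alt_group_one[of n] by (simp add: id_def[symmetric])
next
  case (Suc j)
  interpret group "alt_group n" by (rule alt_group_is_group)
  have "g [^]\<^bsub>alt_group n\<^esub> Suc j = (g ^^ j) \<circ> g"
    unfolding nat_pow_Suc Suc.IH by (simp add: alt_group_mult)
  then show ?case by (simp add: funpow_Suc_right del: funpow.simps)
qed

lemma finite_alt_group: "finite (carrier (alt_group n))"
  by (rule finite_subset[OF _ finite_permutations[of "{1..n}"]]) (auto simp: alt_group_carrier)

lemma alt_group_pow_eq_id:
  assumes "g \<in> carrier (alt_group n)"
  shows "g ^^ j = id \<longleftrightarrow> group.ord (alt_group n) g dvd j"
  using group.pow_eq_id[OF alt_group_is_group assms, of j] by (simp add: alt_group_pow alt_group_one)

lemma alt_group_ord_pos: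
  assumes "g \<in> carrier (alt_group n)"
  shows "group.ord (alt_group n) g > 0"
  using group.ord_ge_1[OF alt_group_is_group finite_alt_group assms] by simp

lemma alt_group_ord_eqI:
  assumes "g \<in> carrier (alt_group n)" "\<And>j. g ^^ j = id \<longleftrightarrow> N dvd j"
  shows "group.ord (alt_group n) g = N"
  using assms alt_group_pow_eq_id[OF assms(1)] by (metis dvd_antisym dvd_refl)

text \<open>\<open>least_power g x\<close> is the length of the cycle through \<open>x\<close>, with
  value 1 at fixed points.\<close>

lemma least_power_dvd_ord:
  assumes g: "g \<in> carrier (alt_group n)"
  shows "least_power g x dvd group.ord (alt_group n) g"
proof -
  have "g ^^ group.ord (alt_group n) g = id" using alt_group_pow_eq_id[OF g] by simp
  then show ?thesis using least_power_dvd[OF alt_group_carrier'[OF g]] by (metis id_apply)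
qed

text \<open>Otherwise all cycle lengths would divide the order divided by \<open>p\<close>, and
  already that power of \<open>g\<close> would be the identity.\<close>

lemma exists_cycle_of_prime_power:
  assumes g: "g \<in> carrier (alt_group n)" and p: "prime p" "p dvd group.ord (alt_group n) g"
  shows "\<exists>x\<in>{1..n}. p ^ multiplicity p (group.ord (alt_group n) g) dvd least_power g x"
proof (rule ccontr)
  let ?m = "group.ord (alt_group n) g"
  have perm: "permutation g" using g by (rule alt_group_carrier')
  have gp: "g permutes {1..n}" using g by (simp add: alt_group_carrier)
  have m: "?m > 0" by (rule alt_group_ord_pos[OF g])
  assume n: "\<not> ?thesis"
  have "(g ^^ (?m div p)) x = x" for x
  proof (cases "x \<in> {1..n}")
    case True
    then have "least_power g x dvd ?m div p"
      using n m by (intro dvd_div_prime[OF p(1) least_power_dvd_ord[OF g]]) auto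
    then show ?thesis using least_power_dvd[OF perm] by blast
  next
    case False
    then show ?thesis using permutes_funpow[OF gp, of "?m div p"] by (auto simp: permutes_def)
  qed
  then have "g ^^ (?m div p) = id" by auto
  then have "?m dvd ?m div p" using alt_group_pow_eq_id[OF g] by simp
  moreover have "?m div p > 0" using p m by (auto simp: div_greater_zero_iff dvd_imp_le prime_gt_0_nat)
  ultimately have "?m \<le> ?m div p" by (intro dvd_imp_le)
  moreover have "?m div p < ?m" using m p(1) prime_gt_1_nat by (intro div_less_dividend) auto
  ultimately show False by simp
qed

section \<open>Elements of prescribed order\<close>

lemma funpow_comp_disjoint:
  assumes p: "p permutes A" and c: "c permutes B" and AB: "A \<inter> B = {}"
  shows "(p \<circ> c) ^^ j = id \<longleftrightarrow> p ^^ j = id \<and> c ^^ j = id"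
proof -
  have cB: "(c ^^ i) x \<in> B \<longleftrightarrow> x \<in> B" and pA: "(p ^^ i) x \<in> A \<longleftrightarrow> x \<in> A" for i x
    using permutes_in_image[OF permutes_funpow[OF c]] permutes_in_image[OF permutes_funpow[OF p]] by auto
  have out: "(c ^^ i) x = x" if "x \<notin> B" for i x
    using permutes_funpow[OF c, of i] that by (auto simp: permutes_def)
  have outA: "(p ^^ i) x = x" if "x \<notin> A" for i x
    using permutes_funpow[OF p, of i] that by (auto simp: permutes_def)
  have B: "((p \<circ> c) ^^ i) x = (c ^^ i) x" if "x \<in> B" for i x
  proof (induction i)
    case (Suc i)
    have "c ((c ^^ i) x) \<in> B" using cB[of "Suc i" x] that by simp
    then have "c ((c ^^ i) x) \<notin> A" using AB by blast
    then show ?case using Suc outA[of "c ((c ^^ i) x)" 1] by simp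
  qed simp
  have nB: "((p \<circ> c) ^^ i) x = (p ^^ i) x" if "x \<notin> B" for i x
  proof (induction i)
    case (Suc i)
    have "(p ^^ i) x \<notin> B"
    proof (cases "x \<in> A")
      case True
      then show ?thesis using pA[of i x] AB by blast
    next
      case False
      then show ?thesis using outA[of x i] that by simp
    qed
    then show ?case using Suc out[of "(p ^^ i) x" 1] by simp
  qed simp
  have e: "((p \<circ> c) ^^ j) x = (if x \<in> B then (c ^^ j) x else (p ^^ j) x)" for x
    using B nB by simp
  have pB: "(p ^^ j) x = x" if "x \<in> B" for x using outA that AB by blast
  show ?thesis
  proof
    assume "(p \<circ> c) ^^ j = id"
    then have "(if x \<in> B then (c ^^ j) x else (p ^^ j) x) = x" for x using e by (metis id_apply)
    then show "p ^^ j = id \<and> c ^^ j = id" using out pB by (auto simp: fun_eq_iff) (metis, metis)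
  next
    assume "p ^^ j = id \<and> c ^^ j = id"
    then show "(p \<circ> c) ^^ j = id" using e by (auto simp: fun_eq_iff)
  qed
qed

lemma cycle_of_list_funpow_eq_id:
  assumes "distinct cs" "cs \<noteq> []"
  shows "cycle_of_list cs ^^ j = id \<longleftrightarrow> length cs dvd j"
proof
  assume "cycle_of_list cs ^^ j = id"
  then have "rotate j cs = cs" using cyclic_rotation[OF assms(1), of j] by simp
  then have "cs ! (j mod length cs) = cs ! 0" using nth_rotate[of 0 cs j] assms(2) by simp
  then have "j mod length cs = 0" using assms by (subst (asm) nth_eq_iff_index_eq) auto
  then show "length cs dvd j" by auto
next
  assume "length cs dvd j"
  then obtain i where "j = length cs * i" by blast
  then show "cycle_of_list cs ^^ j = id" using cycle_is_id_root[OF assms(1)] by (simp add: funpow_mult[symmetric])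
qed

text \<open>A product of disjoint cycles with lengths in \<open>F\<close>. The order is expressed by
  the exponents that give the identity, which avoids least common multiples.\<close>

lemma exists_permutation_of_order:
  assumes "finite F" "\<forall>q\<in>F. 1 \<le> q" "finite S" "\<Sum>F \<le> card S"
  shows "\<exists>p. p permutes S \<and> (\<forall>j. p ^^ j = id \<longleftrightarrow> (\<forall>q\<in>F. q dvd j))"
  using assms
proof (induction F arbitrary: S rule: finite_induct)
  case empty
  have "id permutes S" by (rule permutes_id)
  moreover have "id ^^ j = id" for j by (induction j) auto
  ultimately show ?case by (intro exI[of _ id] conjI) blast+
next
  case (insert q F)
  have "q \<le> card S" using insert by simp
  then obtain C where C: "C \<subseteq> S" "card C = q" using obtain_subset_with_card_n[of q S] by blast
  have fC: "finite C" using C insert.prems finite_subset by blast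
  have "\<Sum>F \<le> card (S - C)" using insert C fC by (simp add: card_Diff_subset)
  then have "\<exists>p. p permutes (S - C) \<and> (\<forall>j. p ^^ j = id \<longleftrightarrow> (\<forall>q\<in>F. q dvd j))"
    using insert.prems(1,2) by (intro insert.IH) blast+
  then obtain p where p: "p permutes (S - C)" "\<forall>j. p ^^ j = id \<longleftrightarrow> (\<forall>q\<in>F. q dvd j)"
    by blast
  obtain cs where cs: "set cs = C" "distinct cs" using finite_distinct_list[OF fC] by blast
  have l: "length cs = q" "cs \<noteq> []" using cs C insert.prems distinct_card[of cs] by auto
  have c: "cycle_of_list cs permutes C" using cycle_permutes[of cs] cs by simp
  have "(p \<circ> cycle_of_list cs) permutes S"
    using permutes_subset[OF p(1), of S] permutes_subset[OF c C(1)] by (intro permutes_compose) auto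
  moreover have "(p \<circ> cycle_of_list cs) ^^ j = id \<longleftrightarrow> (\<forall>q\<in>insert q F. q dvd j)" for j
    using funpow_comp_disjoint[OF p(1) c, of j] p(2) cycle_of_list_funpow_eq_id[OF cs(2) l(2)] l(1) by auto
  ultimately show ?case by blast
qed

text \<open>Their sum is the least number of points on which a permutation of order \<open>N\<close>
  exists. Taking a set loses nothing, since nontrivial powers of different primes differ.\<close>

definition prime_power_parts :: "nat \<Rightarrow> nat set"
  where "prime_power_parts N = (\<lambda>p. p ^ multiplicity p N) ` prime_factors N"

lemma prime_power_parts_dvd:
  assumes N: "N \<noteq> 0"
  shows "(\<forall>q\<in>prime_power_parts N. q dvd j) \<longleftrightarrow> N dvd j"
proof
  assume h: "\<forall>q\<in>prime_power_parts N. q dvd j"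
  show "N dvd j"
  proof (cases "j = 0")
    case False
    show ?thesis
    proof (rule multiplicity_le_imp_dvd[OF N])
      fix p :: nat assume p: "prime p"
      show "multiplicity p N \<le> multiplicity p j"
      proof (cases "p dvd N")
        case True
        then have "p ^ multiplicity p N dvd j" using h p N by (auto simp: prime_power_parts_def in_prime_factors_iff)
        then show ?thesis using False p by (intro multiplicity_geI) auto
      qed (simp add: not_dvd_imp_multiplicity_0)
    qed
  qed simp
next
  assume "N dvd j"
  moreover have "q dvd N" if "q \<in> prime_power_parts N" for q
    using that multiplicity_dvd unfolding prime_power_parts_def by blast
  ultimately show "\<forall>q\<in>prime_power_parts N. q dvd j" using dvd_trans by blast
qed

text \<open>The two spare points repair the parity: an odd permutation is multiplied by the
  transposition of \<open>n - 1\<close> and \<open>n\<close>, which keeps the order because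
  \<open>N\<close> is even.\<close>

lemma exists_element_of_order:
  assumes N: "even N" "N > 0" and n: "\<Sum>(prime_power_parts N) + 2 \<le> n"
  shows "N \<in> element_orders (alt_group n)"
proof -
  let ?S = "{1..n - 2}"
  have "finite (prime_power_parts N)" by (simp add: prime_power_parts_def)
  moreover have "\<forall>q\<in>prime_power_parts N. 1 \<le> q"
    by (auto simp: prime_power_parts_def prime_gt_0_nat in_prime_factors_iff Suc_le_eq)
  moreover have "\<Sum>(prime_power_parts N) \<le> card ?S" using n by simp
  ultimately obtain p where p: "p permutes ?S" "\<forall>j. p ^^ j = id \<longleftrightarrow> (\<forall>q\<in>prime_power_parts N. q dvd j)"
    using exists_permutation_of_order[of "prime_power_parts N" ?S] by blast
  have pj: "p ^^ j = id \<longleftrightarrow> N dvd j" for j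
    using p(2) prime_power_parts_dvd[of N j] N by simp
  let ?t = "transpose (n - 1) n"
  have pn: "p permutes {1..n}" using p(1) by (rule permutes_subset) auto
  have t: "?t permutes {n - 1, n}" by (rule permutes_swap_id) auto
  have tn: "?t permutes {1..n}" using n by (intro permutes_swap_id) auto
  have ne: "n - 1 \<noteq> n" using n by simp
  have tj: "N dvd j \<Longrightarrow> ?t ^^ j = id" for j
  proof -
    assume "N dvd j"
    then have "even j" using N dvd_trans by blast
    then obtain i where "j = 2 * i" by blast
    moreover have "?t ^^ 2 = id" by (simp add: numeral_2_eq_2)
    ultimately show "?t ^^ j = id" by (simp add: funpow_mult[symmetric])
  qed
  have j: "(p \<circ> ?t) ^^ j = id \<longleftrightarrow> N dvd j" for j
  proof -
    have "{1..n - 2} \<inter> {n - 1, n} = {}" using n by auto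
    from funpow_comp_disjoint[OF p(1) t this, of j] show ?thesis using pj tj by blast
  qed
  have "\<exists>h\<in>carrier (alt_group n). \<forall>j. h ^^ j = id \<longleftrightarrow> N dvd j"
  proof (cases "evenperm p")
    case True
    then have "p \<in> carrier (alt_group n)" using pn by (simp add: alt_group_carrier)
    then show ?thesis using pj by blast
  next
    case False
    have "evenperm (p \<circ> ?t)"
      using False pn tn ne by (subst evenperm_comp) (auto simp: permutation_permutes evenperm_swap)
    then have "p \<circ> ?t \<in> carrier (alt_group n)" using pn tn by (auto simp: alt_group_carrier intro: permutes_compose)
    then show ?thesis using j by blast
  qed
  then show ?thesis using alt_group_ord_eqI by (auto simp: element_orders_def)
qed

text \<open>Passing from \<open>m\<close> to \<open>2 * m\<close> doubles the 2-part, which is 1 for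
  odd \<open>m\<close>, and leaves the other parts alone. Apart from the 3-part, those are different
  numbers between 5 and \<open>L\<close>, coprime to 6.\<close>

lemma sum_prime_power_parts_le:
  assumes m: "m > 0" and L: "\<And>p. prime p \<Longrightarrow> p dvd m \<Longrightarrow> p ^ multiplicity p m \<le> L"
  shows "\<Sum>(prime_power_parts (2 * m)) \<le>
    2 * 2 ^ multiplicity 2 m + (if 3 dvd m then 3 ^ multiplicity 3 m else 0) + sum_coprime_6 L"
proof -
  let ?f = "\<lambda>p. p ^ multiplicity p (2 * m)" and ?D = "prime_factors (2 * m) - {2, 3}"
  have mult: "multiplicity p (2 * m) = multiplicity p 2 + multiplicity p m" if "prime p" for p
    using prime_elem_multiplicity_mult_distrib[of p 2 m] that m by simp
  have f2: "?f 2 = 2 * 2 ^ multiplicity 2 m"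
    using mult[OF two_is_prime_nat] multiplicity_self[of "2 :: nat"] by simp
  have fp: "?f p = p ^ multiplicity p m" if "prime p" "p \<noteq> 2" for p
  proof -
    have "\<not> p dvd 2" using primes_dvd_imp_eq[OF that(1) two_is_prime_nat] that(2) by blast
    then show ?thesis using mult[OF that(1)] by (simp add: not_dvd_imp_multiplicity_0)
  qed
  have D: "prime p" "p dvd m" "p \<noteq> 2" "p \<noteq> 3" if "p \<in> ?D" for p
  proof -
    have p: "prime p" "p dvd 2 * m" using that by (auto simp: in_prime_factors_iff)
    show "prime p" "p \<noteq> 3" using p that by simp_all
    show "p \<noteq> 2" using that by simp
    show "p dvd m"
      using p prime_dvd_multD[OF p] primes_dvd_imp_eq[OF p(1) two_is_prime_nat] \<open>p \<noteq> 2\<close> by blast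
  qed
  have "\<Sum>(prime_power_parts (2 * m)) \<le> (\<Sum>p\<in>prime_factors (2 * m). ?f p)"
    unfolding prime_power_parts_def using sum_image_le[of "prime_factors (2 * m)" "\<lambda>x. x" ?f] by simp
  also have "\<dots> \<le> (\<Sum>p\<in>{2} \<union> (if 3 dvd m then {3} else {}) \<union> ?D. ?f p)"
  proof (rule sum_mono2)
    have "3 dvd m" if "3 \<in> prime_factors (2 * m)"
    proof -
      have "prime (3 :: nat)" "3 dvd 2 * m" using that by (simp_all add: in_prime_factors_iff)
      then have "3 dvd (2 :: nat) \<or> 3 dvd m" by (rule prime_dvd_multD)
      then show ?thesis by auto
    qed
    then show "prime_factors (2 * m) \<subseteq> {2} \<union> (if 3 dvd m then {3} else {}) \<union> ?D"
      by (auto split: if_splits)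
  qed simp_all
  also have "\<dots> = ?f 2 + (if 3 dvd m then ?f 3 else 0) + (\<Sum>p\<in>?D. ?f p)"
    by (subst sum.union_disjoint; simp add: sum.union_disjoint)
  also have "(\<Sum>p\<in>?D. ?f p) = \<Sum>(?f ` ?D)"
  proof -
    have "inj_on ?f ?D"
    proof (rule inj_onI)
      fix p q assume p: "p \<in> ?D" and q: "q \<in> ?D" and eq: "?f p = ?f q"
      have "multiplicity p m > 0" using D[OF p] m by (simp add: prime_multiplicity_gt_zero_iff)
      then have "p dvd ?f p" using fp[of p] D[OF p] by (simp add: dvd_power)
      then have "p dvd ?f q" unfolding eq .
      then have "p dvd q" using prime_dvd_power[OF D(1)[OF p]] by blast
      then show "p = q" using D[OF p] D[OF q] primes_dvd_imp_eq by blast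
    qed
    from sum.reindex[OF this, of "\<lambda>x. x"] show ?thesis by (simp only: o_def)
  qed
  also have "\<dots> \<le> sum_coprime_6 L"
  proof (rule sum_coprime_6_ge)
    have "?f p \<in> {5..L} \<and> ?f p mod 6 \<in> {1, 5}" if p: "p \<in> ?D" for p
    proof
      have mu: "multiplicity p m > 0" using D[OF p] m by (simp add: prime_multiplicity_gt_zero_iff)
      have "?f p = p ^ multiplicity p m" using fp D[OF p] by blast
      moreover have "p \<le> p ^ multiplicity p m" using mu prime_ge_1_nat[OF D(1)[OF p]] by (intro self_le_power) simp_all
      moreover have "p \<ge> 5"
      proof (rule ccontr)
        assume "\<not> 5 \<le> p"
        then have "p = 0 \<or> p = 1 \<or> p = 4" using D(3,4)[OF p] by presburger
        moreover have "\<not> prime (2 * 2 :: nat)" using prime_product[of 2 2] by auto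
        ultimately show False using D(1)[OF p] by auto
      qed
      ultimately show "?f p \<in> {5..L}" using L[OF D(1,2)[OF p]] by auto
      have "\<not> r dvd ?f p" if "prime r" "r \<noteq> p" for r
        using prime_dvd_power[OF that(1), of p] primes_dvd_imp_eq[OF that(1) D(1)[OF p]] that(2) by blast
      from this[of 2] this[of 3] have "\<not> 2 dvd ?f p" "\<not> 3 dvd ?f p" using D(3,4)[OF p] by auto
      then have "?f p mod 6 = 1 \<or> ?f p mod 6 = 5" by presburger
      then show "?f p mod 6 \<in> {1, 5}" by simp
    qed
    then show "?f ` ?D \<subseteq> {5..L}" "\<forall>x\<in>?f ` ?D. x mod 6 \<in> {1, 5}" by blast+
  qed
  finally show ?thesis using f2 fp[of 3] by (cases "3 dvd m") simp_all
qed

section \<open>Vanishing elements of alternating groups\<close>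

text \<open>Keeps the simplifier from turning \<open>{1..n}\<close> into \<open>{Suc 0..n}\<close>.\<close>

declare One_nat_def [simp del]

lemma virtual_character_fixed_colorings:
  "virtual_character (alt_group n) (\<lambda>p. of_nat (card (fixed_colorings {1..n} p k \<alpha>)))"
proof -
  let ?G = "alt_group n" and ?\<Omega> = "colorings {1..n} k \<alpha>"
  have inv: "inv' p permutes {1..n}" "p (inv' p x) = x" "inv' p (p x) = x" if "p \<in> carrier ?G" for p x
    using that permutes_inverses[of p "{1..n}"] by (auto simp: alt_group_carrier intro: permutes_inv)
  \<comment> \<open>Composing with the inverse gives a left action; its fixed points are the
    colourings fixed by \<open>p\<close>, as \<open>eq\<close> shows.\<close>
  have vc: "virtual_character ?G (\<lambda>p. of_nat (card {c\<in>?\<Omega>. c \<circ> inv' p = c}))"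
  proof (rule virtual_character_permutation[OF alt_group_is_group])
    show "finite ?\<Omega>" by (simp add: finite_colorings)
    show "c \<circ> inv' p \<in> ?\<Omega>" if p: "p \<in> carrier ?G" and c: "c \<in> ?\<Omega>" for p c
    proof -
      have ip: "inv' p x \<in> {1..n} \<longleftrightarrow> x \<in> {1..n}" for x using permutes_in_image[OF inv(1)[OF p]] .
      have "card {x\<in>{1..n}. (c \<circ> inv' p) x = i} = card {x\<in>{1..n}. c x = i}" for i
      proof (rule bij_betw_same_card[of "inv' p"])
        show "bij_betw (inv' p) {x\<in>{1..n}. (c \<circ> inv' p) x = i} {x\<in>{1..n}. c x = i}"
        proof (rule bij_betwI[where g = p])
          show "inv' p \<in> {x\<in>{1..n}. (c \<circ> inv' p) x = i} \<rightarrow> {x\<in>{1..n}. c x = i}"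
            using ip by auto
          have "p x \<in> {1..n} \<longleftrightarrow> x \<in> {1..n}" for x
            using permutes_in_image[of p "{1..n}" x] p by (simp add: alt_group_carrier)
          then show "p \<in> {x\<in>{1..n}. c x = i} \<rightarrow> {x\<in>{1..n}. (c \<circ> inv' p) x = i}"
            using inv(3)[OF p] by auto
        qed (simp_all add: inv(2,3)[OF p])
      qed
      moreover have "c \<circ> inv' p \<in> {1..n} \<rightarrow>\<^sub>E {..<k}"
      proof (rule PiE_I)
        fix x assume "x \<in> {1..n}"
        then have "inv' p x \<in> {1..n}" using ip by blast
        then show "(c \<circ> inv' p) x \<in> {..<k}" using c by (auto simp: colorings_def)
      next
        fix x assume "x \<notin> {1..n}"
        then have "inv' p x \<notin> {1..n}" using ip by blast
        then show "(c \<circ> inv' p) x = undefined" using c by (auto simp: colorings_def PiE_def extensional_def)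
      qed
      ultimately show ?thesis using c by (simp add: colorings_def)
    qed
    show "c \<circ> inv' (p \<otimes>\<^bsub>?G\<^esub> q) = c \<circ> inv' q \<circ> inv' p" if "p \<in> carrier ?G" "q \<in> carrier ?G" for p q c
    proof -
      have "bij p" "bij q" using that by (auto simp: alt_group_carrier permutes_bij)
      then show ?thesis by (simp add: alt_group_mult o_inv_distrib comp_assoc)
    qed
    show "c \<circ> inv' \<one>\<^bsub>?G\<^esub> = c" for c :: "nat \<Rightarrow> nat" by (simp add: alt_group_one)
  qed
  have eq: "{c\<in>?\<Omega>. c \<circ> inv' p = c} = fixed_colorings {1..n} p k \<alpha>" if p: "p \<in> carrier ?G" for p
  proof -
    have "c \<circ> inv' p = c \<longleftrightarrow> (\<forall>x\<in>{1..n}. c (p x) = c x)" if "c \<in> ?\<Omega>" for c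
    proof
      assume "c \<circ> inv' p = c"
      then have "c (inv' p (p x)) = c (p x)" for x by (metis comp_apply)
      then show "\<forall>x\<in>{1..n}. c (p x) = c x" by (simp add: inv(3)[OF p])
    next
      assume h: "\<forall>x\<in>{1..n}. c (p x) = c x"
      show "c \<circ> inv' p = c"
      proof
        fix x show "(c \<circ> inv' p) x = c x"
        proof (cases "x \<in> {1..n}")
          case True
          then have "inv' p x \<in> {1..n}" using permutes_in_image[OF inv(1)[OF p]] by blast
          then show ?thesis using h inv(2)[OF p] by fastforce
        next
          case False
          then show ?thesis using inv(1)[OF p] by (simp add: permutes_def)
        qed
      qed
    qed
    then show ?thesis by (auto simp: fixed_colorings_def)
  qed
  show ?thesis by (rule virtual_character_cong[OF vc]) (simp add: eq)
qed

section \<open>Inner products over the alternating group\<close>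

lemma virtual_character_frobenius:
  "virtual_character (alt_group n) (\<lambda>p. of_int (frobenius_char {1..n} p k \<beta>))"
proof -
  have "virtual_character (alt_group n) (\<lambda>p. \<Sum>w | w permutes {..<k}.
      of_int (sign w) * of_nat (card (fixed_colorings {1..n} p k (\<lambda>i. \<beta> i - int (w i)))))"
    by (intro virtual_character_sum virtual_character_scale virtual_character_fixed_colorings)
      (simp add: finite_permutations)
  then show ?thesis by (simp add: frobenius_char_def)
qed

text \<open>A permutation and its inverse fix the same colourings. This removes the inverse from the
  inner products.\<close>

lemma frobenius_char_inv:
  assumes "p permutes S"
  shows "frobenius_char S (inv' p) k \<beta> = frobenius_char S p k \<beta>"
proof -
  have "(\<forall>x\<in>S. c (inv' p x) = c x) \<longleftrightarrow> (\<forall>x\<in>S. c (p x) = c x)" for c :: "'a \<Rightarrow> nat"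
  proof
    assume h: "\<forall>x\<in>S. c (inv' p x) = c x"
    show "\<forall>x\<in>S. c (p x) = c x"
    proof
      fix x assume "x \<in> S"
      then have "p x \<in> S" using permutes_in_image[OF assms] by blast
      then show "c (p x) = c x" using h permutes_inverses[OF assms] by metis
    qed
  next
    assume h: "\<forall>x\<in>S. c (p x) = c x"
    show "\<forall>x\<in>S. c (inv' p x) = c x"
    proof
      fix x assume "x \<in> S"
      then have "inv' p x \<in> S" using permutes_in_image[OF permutes_inv[OF assms]] by blast
      then show "c (inv' p x) = c x" using h permutes_inverses[OF assms] by metis
    qed
  qed
  then show ?thesis by (simp add: frobenius_char_def fixed_colorings_def)
qed

text \<open>The indicator function of the even permutations is
  \<open>(1 + sign p) / 2\<close>.\<close>

lemma sum_alt_group: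
  "2 * (\<Sum>p\<in>carrier (alt_group n). f p) = (\<Sum>p | p permutes {1..n}. f p) + (\<Sum>p | p permutes {1..n}. sign p * (f p :: int))"
proof -
  have "(\<Sum>p | p permutes {1..n}. f p) + (\<Sum>p | p permutes {1..n}. sign p * f p) =
      (\<Sum>p | p permutes {1..n}. if evenperm p then 2 * f p else 0)"
    unfolding sum.distrib[symmetric] by (intro sum.cong refl) (simp add: sign_def)
  also have "\<dots> = (\<Sum>p\<in>carrier (alt_group n). 2 * f p)"
    by (subst sum.inter_filter[symmetric]) (auto simp: finite_permutations alt_group_carrier intro!: sum.cong)
  finally show ?thesis by (simp add: sum_distrib_left)
qed

text \<open>The twisted sum is the inner product with sign times the character of
  \<open>\<gamma>\<close>, which belongs to the conjugate partition. It vanishes term by term: a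
  pair \<open>w\<close>, \<open>v\<close> admits no colourings at all, or the pigeonhole argument
  applies to it.\<close>

lemma sum_sign_frobenius_char:
  assumes S: "finite S"
    and h: "\<And>w v. w permutes {..<k} \<Longrightarrow> v permutes {..<k} \<Longrightarrow> (\<exists>j<k. \<gamma> j - int (v j) < 0) \<or>
      (\<exists>i<k. \<beta> i - int (w i) > int (card {j. j < k \<and> \<gamma> j - int (v j) \<noteq> 0}))"
  shows "(\<Sum>p | p permutes S. sign p * (frobenius_char S p k \<beta> * frobenius_char S p k \<gamma>)) = 0"
proof -
  let ?W = "{w. w permutes {..<k}}" and ?P = "{p. p permutes S}"
  let ?f = "\<lambda>p \<beta> w. fixed_colorings S p k (\<lambda>i. \<beta> i - int (w i))"
  have "frobenius_char S p k \<beta> * frobenius_char S p k \<gamma> =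
      (\<Sum>w\<in>?W. \<Sum>v\<in>?W. sign w * sign v * int (card (?f p \<beta> w) * card (?f p \<gamma> v)))" for p
    unfolding frobenius_char_def sum_product by (intro sum.cong refl) (simp only: of_nat_mult mult_ac)
  then have "(\<Sum>p\<in>?P. sign p * (frobenius_char S p k \<beta> * frobenius_char S p k \<gamma>)) =
      (\<Sum>p\<in>?P. \<Sum>w\<in>?W. \<Sum>v\<in>?W. sign w * sign v * (sign p * int (card (?f p \<beta> w) * card (?f p \<gamma> v))))"
    by (simp only: sum_distrib_left mult.left_commute)
  also have "\<dots> = (\<Sum>w\<in>?W. \<Sum>v\<in>?W. sign w * sign v * (\<Sum>p\<in>?P. sign p * int (card (?f p \<beta> w) * card (?f p \<gamma> v))))"
    unfolding sum_distrib_left by (subst sum.swap, rule sum.cong[OF refl], rule sum.swap)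
  also have "\<dots> = 0"
  proof (intro sum.neutral ballI)
    fix w v assume "w \<in> ?W" "v \<in> ?W"
    then consider j where "j < k" "\<gamma> j - int (v j) < 0"
      | i where "i < k" "\<beta> i - int (w i) > int (card {j. j < k \<and> \<gamma> j - int (v j) \<noteq> 0})"
      using h[of w v] by blast
    then have "(\<Sum>p\<in>?P. sign p * int (card (?f p \<beta> w) * card (?f p \<gamma> v))) = 0"
    proof cases
      case 1
      then show ?thesis by (simp add: fixed_colorings_neg[of j])
    next
      case 2
      then show ?thesis by (intro sum_sign_card_fixed_colorings_product[OF S, of i])
    qed
    then show "sign w * sign v * (\<Sum>p\<in>?P. sign p * int (card (?f p \<beta> w) * card (?f p \<gamma> v))) = 0" by simp
  qed
  finally show ?thesis .
qed

lemma permutes_lessThan_le: "w permutes {..<k} \<Longrightarrow> i < k \<Longrightarrow> w i \<le> k - (1 :: nat)"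
  using permutes_in_image[of w "{..<k}" i] by simp

text \<open>Since \<open>w i \<le> k - 1\<close>, class \<open>i\<close> has at least
  \<open>k + 1\<close> points, more than there are colours.\<close>

lemma sum_sign_frobenius_char_large:
  assumes S: "finite S" and i: "i < k" "\<beta> i \<ge> 2 * int k"
  shows "(\<Sum>p | p permutes S. sign p * (frobenius_char S p k \<beta> * frobenius_char S p k \<gamma>)) = 0"
proof (rule sum_sign_frobenius_char[OF S], rule disjI2, intro exI conjI)
  fix w v :: "nat \<Rightarrow> nat" assume w: "w permutes {..<k}"
  have "card {j. j < k \<and> \<gamma> j - int (v j) \<noteq> 0} \<le> card {..<k}" by (rule card_mono) auto
  then show "\<beta> i - int (w i) > int (card {j. j < k \<and> \<gamma> j - int (v j) \<noteq> 0})"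
    using permutes_lessThan_le[OF w i(1)] i by simp
qed (rule i)

text \<open>A bead of \<open>\<gamma>\<close> at 0 makes the size of class 0 zero or negative. In
  the first case only \<open>k - 1\<close> colours are left, which gains one over the bound
  \<open>2 * k\<close>. For A_5 this admits the bead 5 with \<open>k = 3\<close>.\<close>

lemma sum_sign_frobenius_char_zero:
  assumes S: "finite S" and i: "i < k" "\<beta> i \<ge> 2 * int k - 1" and \<gamma>: "\<gamma> 0 = 0"
  shows "(\<Sum>p | p permutes S. sign p * (frobenius_char S p k \<beta> * frobenius_char S p k \<gamma>)) = 0"
proof (rule sum_sign_frobenius_char[OF S])
  fix w v :: "nat \<Rightarrow> nat" assume w: "w permutes {..<k}"
  show "(\<exists>j<k. \<gamma> j - int (v j) < 0) \<or> (\<exists>i<k. \<beta> i - int (w i) > int (card {j. j < k \<and> \<gamma> j - int (v j) \<noteq> 0}))"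
  proof (cases "v 0 = 0")
    case True
    have "card {j. j < k \<and> \<gamma> j - int (v j) \<noteq> 0} \<le> card {1..<k}"
    proof (rule card_mono)
      show "{j. j < k \<and> \<gamma> j - int (v j) \<noteq> 0} \<subseteq> {1..<k}"
      proof
        fix j assume j: "j \<in> {j. j < k \<and> \<gamma> j - int (v j) \<noteq> 0}"
        then have "j \<noteq> 0" using True \<gamma> by (cases "j = 0") auto
        then show "j \<in> {1..<k}" using j by simp
      qed
    qed simp
    then have "\<beta> i - int (w i) > int (card {j. j < k \<and> \<gamma> j - int (v j) \<noteq> 0})"
      using permutes_lessThan_le[OF w i(1)] i by simp
    then show ?thesis using i(1) by blast
  next
    case False
    then have "\<gamma> 0 - int (v 0) < 0" using \<gamma> by simp
    then show ?thesis using i(1) by (intro disjI1 exI[of _ 0]) auto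
  qed
qed

lemma frobenius_char_alt_inner:
  assumes n: "n \<ge> 2" and \<beta>: "2 * (\<Sum>i<k. \<beta> i) = 2 * int n + int k * (int k - 1)"
    and s: "(\<Sum>p | p permutes {1..n}. sign p * (frobenius_char {1..n} p k \<beta> * frobenius_char {1..n} p k \<gamma>)) = 0"
  shows "(\<Sum>p\<in>carrier (alt_group n). frobenius_char {1..n} p k \<beta> * frobenius_char {1..n} p k \<gamma>) =
    int (card (carrier (alt_group n))) * signed_matching k \<beta> \<gamma>"
proof -
  have "2 * int (card (carrier (alt_group n))) = fact n"
    using arg_cong[OF alt_group_card_carrier[OF n], of int] by simp
  then have "2 * (\<Sum>p\<in>carrier (alt_group n). frobenius_char {1..n} p k \<beta> * frobenius_char {1..n} p k \<gamma>) =
      2 * (int (card (carrier (alt_group n))) * signed_matching k \<beta> \<gamma>)"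
    using sum_alt_group[of "\<lambda>p. frobenius_char {1..n} p k \<beta> * frobenius_char {1..n} p k \<gamma>" n] s
      sum_frobenius_char_product[where S = "{1..n}" and k = k and \<beta> = \<beta> and \<gamma> = \<gamma>] \<beta> by simp
  then show ?thesis by simp
qed

lemma frobenius_char_alt_inv:
  assumes "x \<in> carrier (alt_group n)"
  shows "frobenius_char {1..n} (inv\<^bsub>alt_group n\<^esub> x) k \<beta> = frobenius_char {1..n} x k \<beta>"
  using assms frobenius_char_inv[of x "{1..n}" k \<beta>] by (simp add: alt_group_inv_equality) (simp add: alt_group_carrier)

lemma vanishing_if_frobenius_char_zero:
  assumes n: "n \<ge> 2" and \<beta>: "2 * (\<Sum>i<k. \<beta> i) = 2 * int n + int k * (int k - 1)"
    and inj: "inj_on \<beta> {..<k}" and nn: "\<forall>a<k. \<beta> a \<ge> 0" and i: "i < k" "\<beta> i \<ge> 2 * int k"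
    and g: "g \<in> carrier (alt_group n)" "frobenius_char {1..n} g k \<beta> = 0"
  shows "vanishing (alt_group n) g"
proof (rule vanishing_if_norm_1[OF alt_group_is_group finite_alt_group virtual_character_frobenius[of n k \<beta>]])
  let ?X = "\<lambda>p. frobenius_char {1..n} p k \<beta>"
  have "(\<Sum>x\<in>carrier (alt_group n). of_int (?X x) * of_int (?X (inv\<^bsub>alt_group n\<^esub> x))) =
      (of_int (\<Sum>x\<in>carrier (alt_group n). ?X x * ?X x) :: complex)"
    by (simp add: frobenius_char_alt_inv)
  also have "\<dots> = of_nat (card (carrier (alt_group n)))"
    using frobenius_char_alt_inner[OF n \<beta>, of \<beta>] signed_matching_self[OF inj nn]
      sum_sign_frobenius_char_large[where S = "{1..n}" and k = k and \<beta> = \<beta> and \<gamma> = \<beta>, OF _ i] by simp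
  finally show "(\<Sum>x\<in>carrier (alt_group n). of_int (?X x) * of_int (?X (inv\<^bsub>alt_group n\<^esub> x))) =
      (of_nat (card (carrier (alt_group n))) :: complex)" .
qed (use g in auto)

definition orb :: "('a \<Rightarrow> 'a) \<Rightarrow> 'a \<Rightarrow> 'a set" where "orb p x = set (support p x)"

section \<open>Cycle removal and vanishing\<close>

lemma finite_orb [simp]: "finite (orb p x)"
  by (simp add: orb_def)

lemma card_orb: "permutation p \<Longrightarrow> card (orb p x) = least_power p x"
  using distinct_card[OF cycle_of_permutation, of p x] by (simp add: orb_def)

lemma orb_subset: "permutation p \<Longrightarrow> p ` S \<subseteq> S \<Longrightarrow> x \<in> S \<Longrightarrow> orb p x \<subseteq> S"
proof
  fix y assume p: "p ` S \<subseteq> S" "x \<in> S" and "y \<in> orb p x"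
  then obtain i where "y = (p ^^ i) x" by (auto simp: orb_def)
  moreover have "(p ^^ i) x \<in> S" for i by (induction i) (use p in auto)
  ultimately show "y \<in> S" by simp
qed

lemma self_in_orb:
  assumes "permutation p" shows "x \<in> orb p x"
  unfolding orb_def support_set[OF assms] by (rule range_eqI[where x = 0]) simp

lemma orb_closed: "permutation p \<Longrightarrow> p y \<in> orb p x \<longleftrightarrow> y \<in> orb p x"
proof -
  assume p: "permutation p"
  have inj: "inj p" using p by (simp add: permutation_bijective bij_is_inj)
  show ?thesis
  proof
    assume "y \<in> orb p x"
    then obtain i where "y = (p ^^ i) x" unfolding orb_def support_set[OF p] by blast
    then have "p y = (p ^^ Suc i) x" by simp
    then show "p y \<in> orb p x" unfolding orb_def support_set[OF p] by blast
  next
    assume "p y \<in> orb p x"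
    then obtain i where i: "p y = (p ^^ i) x" unfolding orb_def support_set[OF p] by blast
    have "(p ^^ (i + least_power p x)) x = (p ^^ i) x"
      using least_power_of_permutation(1)[OF p, of x] by (simp add: funpow_add)
    moreover obtain j where "i + least_power p x = Suc j"
      using least_power_of_permutation(2)[OF p, of x] by (metis add_gr_0 gr0_conv_Suc)
    ultimately have "p y = p ((p ^^ j) x)" using i by simp
    then have "y = (p ^^ j) x" using inj by (simp add: inj_eq)
    then show "y \<in> orb p x" unfolding orb_def support_set[OF p] by blast
  qed
qed

lemma frobenius_char_cycle:
  assumes p: "permutation p" and S: "finite S" "p ` S \<subseteq> S" "x \<in> S"
  shows "frobenius_char S p k \<beta> =
    (\<Sum>i<k. frobenius_char (S - orb p x) p k (\<beta>(i := \<beta> i - int (least_power p x))))"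
proof -
  have "frobenius_char S p k \<beta> = (\<Sum>i<k. frobenius_char (S - orb p x) p k (\<beta>(i := \<beta> i - int (card (orb p x)))))"
  proof (rule frobenius_char_orbit[OF S(1) orb_subset[OF p S(2,3)] self_in_orb[OF p]])
    show "p y \<in> orb p x" if "y \<in> orb p x" for y using orb_closed[OF p, of y x] that by (rule iffD2)
    show "p y \<in> S - orb p x" if "y \<in> S - orb p x" for y
    proof -
      have "p y \<in> S" using that S(2) by blast
      then show ?thesis using orb_closed[OF p, of y x] that by (simp only: Diff_iff simp_thms)
    qed
    show "\<exists>m. y = (p ^^ m) x" if "y \<in> orb p x" for y using that by (auto simp: orb_def)
  qed
  then show ?thesis by (simp only: card_orb[OF p])
qed

lemma orb_complement_closed:
  assumes "permutation p" "p ` S \<subseteq> S" shows "p ` (S - orb p x) \<subseteq> S - orb p x"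
proof
  fix z assume "z \<in> p ` (S - orb p x)"
  then obtain y where y: "y \<in> S" "y \<notin> orb p x" "z = p y" by blast
  then show "z \<in> S - orb p x"
    using orb_closed[OF assms(1), of y x] assms(2) by (simp only: Diff_iff simp_thms) blast
qed

theorem vanishing_if_core:
  assumes n: "n \<ge> 2" and A: "core_beads L n A" and g: "g \<in> carrier (alt_group n)"
    and x: "x \<in> {1..n}" "least_power g x = L"
  shows "vanishing (alt_group n) g"
proof -
  define k where "k = card A"
  have fA: "finite A" and sA: "\<Sum>A = n + \<Sum>{..<k}" and core: "\<And>b. b \<in> A \<Longrightarrow> L \<le> b \<Longrightarrow> b - L \<in> A"
    and big: "\<exists>b\<in>A. 2 * k \<le> b" using A by (auto simp: core_beads_def k_def)
  have perm: "permutation g" and gp: "g permutes {1..n}"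
    using g alt_group_carrier' by (auto simp: alt_group_carrier)
  have gS: "g ` {1..n} \<subseteq> {1..n}" using permutes_image[OF gp] by simp
  have Lpos: "L > 0" using x(2) least_power_of_permutation(2)[OF perm] by metis
  obtain b where b: "bij_betw b {..<k} A"
    using ex_bij_betw_nat_finite[OF fA] by (auto simp: k_def atLeast0LessThan)
  define \<beta> where "\<beta> i = int (b i)" for i
  have inj: "inj_on \<beta> {..<k}" using b by (auto simp: \<beta>_def bij_betw_def inj_on_def)
  obtain i where i: "i < k" "\<beta> i \<ge> 2 * int k"
    using big b by (auto simp: \<beta>_def bij_betw_def)
  have "(\<Sum>i<k. b i) = \<Sum>A" using sum.reindex_bij_betw[OF b, of "\<lambda>x. x"] .
  then have "(\<Sum>i<k. \<beta> i) = int (n + \<Sum>{..<k})" using sA unfolding \<beta>_def by (metis of_nat_sum)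
  then have s: "2 * (\<Sum>i<k. \<beta> i) = 2 * int n + int k * (int k - 1)"
    using double_sum_lessThan[of k] by simp
  have "frobenius_char {1..n} g k \<beta> = (\<Sum>i<k. frobenius_char ({1..n} - orb g x) g k (\<beta>(i := \<beta> i - int L)))"
    using frobenius_char_cycle[OF perm _ gS x(1)] x(2) by simp
  also have "\<dots> = 0"
  proof (rule sum.neutral, rule ballI)
    fix i assume "i \<in> {..<k}"
    then have i: "i < k" by simp
    show "frobenius_char ({1..n} - orb g x) g k (\<beta>(i := \<beta> i - int L)) = 0"
    \<comment> \<open>A lowered bead falls below 0 or, as \<open>A\<close> is an
      \<open>L\<close>-core, lands on the position of a different bead.\<close>
    proof (cases "b i < L")
      case True
      then show ?thesis using i by (intro frobenius_char_neg[of i]) (auto simp: \<beta>_def)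
    next
      case False
      have "b i \<in> A" using b i by (auto simp: bij_betw_def)
      then have "b i - L \<in> A" using core False by simp
      then obtain j where j: "j < k" "b j = b i - L" using b by (auto simp: bij_betw_def)
      have "j \<noteq> i" using j False Lpos by auto
      then show ?thesis using i j False
        by (intro frobenius_char_repeated[OF orb_complement_closed[OF perm gS], of i _ j]) (auto simp: \<beta>_def)
    qed
  qed
  finally have z: "frobenius_char {1..n} g k \<beta> = 0" .
  have nn: "\<forall>a<k. \<beta> a \<ge> 0" by (simp add: \<beta>_def)
  show ?thesis by (rule vanishing_if_frobenius_char_zero[OF n s inj nn i g z])
qed

lemma least_power_orb:
  assumes p: "permutation p" and y: "y \<in> orb p x"
  shows "least_power p y = least_power p x"
proof -
  have inj: "inj (p ^^ i)" for i using permutation_funpow[OF p] by (simp add: permutation_bijective bij_is_inj)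
  obtain i where i: "y = (p ^^ i) x" using y unfolding orb_def support_set[OF p] by blast
  have "(p ^^ j) y = y \<longleftrightarrow> (p ^^ j) x = x" for j
  proof -
    have "(p ^^ j) y = (p ^^ i) ((p ^^ j) x)" unfolding i by (metis comp_apply funpow_add add.commute)
    then show ?thesis unfolding i using inj[of i] by (simp add: inj_eq)
  qed
  then have e: "least_power p y dvd j \<longleftrightarrow> least_power p x dvd j" for j using least_power_dvd[OF p] by blast
  show ?thesis by (rule dvd_antisym) (simp add: e, simp add: e[symmetric])
qed

lemma least_power_1_iff: "permutation p \<Longrightarrow> least_power p x = 1 \<longleftrightarrow> p x = x"
  using least_power_dvd[of p x 1] by (simp add: One_nat_def)

lemma card_minus_orb:
  assumes "permutation p" "finite S" "p ` S \<subseteq> S" "x \<in> S"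
  shows "card (S - orb p x) + least_power p x = card S"
proof -
  have "orb p x \<subseteq> S" using orb_subset assms by metis
  then show ?thesis using card_Diff_subset[of "orb p x" S] card_mono[of S "orb p x"] card_orb[OF assms(1), of x] assms(2) by simp
qed

lemma sum_lessThan_2: "(\<Sum>i<2. f i) = f 0 + (f (1 :: nat) :: int)"
  by (simp add: numeral_2_eq_2 One_nat_def)

text \<open>The beads 1 and n belong to the partition (n - 1, 1). While cycles of length at least 2
  are removed, the bead 1 cannot move, so the other one descends. Once only the fixed point is left,
  both beads are at 1.\<close>

lemma frobenius_char_one_fixed_point:
  assumes p: "permutation p" and "finite S" "p ` S \<subseteq> S" "x0 \<in> S" "p x0 = x0"
    "\<And>x. x \<in> S \<Longrightarrow> p x = x \<Longrightarrow> x = x0"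
  shows "frobenius_char S p 2 (\<lambda>i. if i = 0 then 1 else int (card S)) = 0"
  using assms(2-)
proof (induction "card S" arbitrary: S rule: less_induct)
  case less
  show ?case
  proof (cases "S = {x0}")
    case True
    then have "p ` S \<subseteq> S" "card S = 1" using less.prems(2) by simp_all
    then show ?thesis by (intro frobenius_char_repeated[of _ _ 0 _ 1]) simp_all
  next
    case False
    then obtain x where x: "x \<in> S" "x \<noteq> x0" using less.prems(3) by blast
    then have px: "p x \<noteq> x" using less.prems(5) by blast
    define l where "l = least_power p x"
    have l: "l \<ge> 2" using least_power_gt_one[OF p px] by (simp add: l_def)
    let ?R = "S - orb p x"
    have cR: "card ?R + l = card S" using card_minus_orb[OF p less.prems(1,2) x(1)] by (simp add: l_def)
    have "x0 \<notin> orb p x"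
    proof
      assume "x0 \<in> orb p x"
      then have "least_power p x0 = l" unfolding l_def by (rule least_power_orb[OF p])
      then show False using least_power_1_iff[OF p, of x0] less.prems(4) l by simp
    qed
    then have IH: "frobenius_char ?R p 2 (\<lambda>i. if i = 0 then 1 else int (card ?R)) = 0"
    proof (intro less.hyps)
      show "card ?R < card S" using cR l by simp
      show "finite ?R" using less.prems(1) by simp
      show "p ` ?R \<subseteq> ?R" by (rule orb_complement_closed[OF p less.prems(2)])
      show "x0 \<in> ?R" using \<open>x0 \<notin> orb p x\<close> less.prems(3) by blast
      show "y = x0" if "y \<in> ?R" "p y = y" for y using less.prems(5)[OF _ that(2)] that(1) by blast
    qed (rule less.prems(4))
    let ?\<beta> = "\<lambda>i :: nat. if i = 0 then 1 else int (card S)"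
    have "frobenius_char S p 2 ?\<beta> = (\<Sum>i<2. frobenius_char ?R p 2 (?\<beta>(i := ?\<beta> i - int l)))"
      unfolding l_def by (rule frobenius_char_cycle[OF p less.prems(1,2) x(1)])
    also have "\<dots> = frobenius_char ?R p 2 (?\<beta>(0 := ?\<beta> 0 - int l)) + frobenius_char ?R p 2 (?\<beta>(1 := ?\<beta> 1 - int l))"
      unfolding sum_lessThan_2 ..
    also have "frobenius_char ?R p 2 (?\<beta>(0 := ?\<beta> 0 - int l)) = 0"
      using l by (intro frobenius_char_neg[of 0]) auto
    also have "frobenius_char ?R p 2 (?\<beta>(1 := ?\<beta> 1 - int l)) = frobenius_char ?R p 2 (\<lambda>i. if i = 0 then 1 else int (card ?R))"
      using cR by (intro frobenius_char_cong) auto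
    finally show ?thesis using IH by simp
  qed
qed

lemma vanishing_if_one_fixed_point:
  assumes n: "n \<ge> 4" and g: "g \<in> carrier (alt_group n)" and c: "card {x\<in>{1..n}. least_power g x = 1} = 1"
  shows "vanishing (alt_group n) g"
proof -
  have perm: "permutation g" and gp: "g permutes {1..n}"
    using g alt_group_carrier' by (auto simp: alt_group_carrier)
  obtain x0 where x0: "{x\<in>{1..n}. least_power g x = 1} = {x0}" using c card_1_singletonE by blast
  let ?\<beta> = "\<lambda>i :: nat. if i = 0 then 1 else int n"
  have "frobenius_char {1..n} g 2 (\<lambda>i. if i = 0 then 1 else int (card {1..n})) = 0"
    using x0 permutes_image[OF gp] least_power_1_iff[OF perm]
    by (intro frobenius_char_one_fixed_point[OF perm, of _ x0]) auto
  moreover have "card {1..n} = n" by simp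
  ultimately have z: "frobenius_char {1..n} g 2 ?\<beta> = 0" by (simp only:)
  have "inj_on ?\<beta> {..<2}" using n by (auto simp: inj_on_def)
  then show ?thesis
    using n by (intro vanishing_if_frobenius_char_zero[where k = 2 and \<beta> = ?\<beta> and i = 1, OF _ _ _ _ _ _ g z]) (auto simp: sum_lessThan_2)
qed

text \<open>The points on cycles of length \<open>l\<close> come in blocks of
  \<open>l\<close>.\<close>

lemma dvd_card_least_power:
  assumes p: "permutation p" and "finite S" "p ` S \<subseteq> S"
  shows "l dvd card {x\<in>S. least_power p x = l}"
  using assms(2-)
proof (induction "card S" arbitrary: S rule: less_induct)
  case less
  show ?case
  proof (cases "S = {}")
    case False
    then obtain x where x: "x \<in> S" by blast
    let ?R = "S - orb p x"
    have cR: "card ?R + least_power p x = card S" by (rule card_minus_orb[OF p less.prems x])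
    have sub: "orb p x \<subseteq> S" using orb_subset[OF p less.prems(2) x] .
    have IH: "l dvd card {y\<in>?R. least_power p y = l}"
      using less.prems cR least_power_of_permutation(2)[OF p, of x] orb_complement_closed[OF p less.prems(2)]
      by (intro less.hyps) auto
    have "least_power p y = l \<longleftrightarrow> least_power p x = l" if "y \<in> orb p x" for y
      unfolding least_power_orb[OF p that] ..
    then have "{y\<in>S. least_power p y = l} = {y\<in>?R. least_power p y = l} \<union> (if least_power p x = l then orb p x else {})"
      using sub by (auto split: if_splits)
    moreover have "card ({y\<in>?R. least_power p y = l} \<union> (if least_power p x = l then orb p x else {})) =
        card {y\<in>?R. least_power p y = l} + (if least_power p x = l then l else 0)"
    proof -
      have "card ({y\<in>?R. least_power p y = l} \<union> (if least_power p x = l then orb p x else {})) =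
          card {y\<in>?R. least_power p y = l} + card (if least_power p x = l then orb p x else {})"
        using less.prems(1) by (intro card_Un_disjoint) auto
      then show ?thesis using card_orb[OF p, of x] by simp
    qed
    ultimately have "card {y\<in>S. least_power p y = l} = card {y\<in>?R. least_power p y = l} + (if least_power p x = l then l else 0)"
      by (simp only:)
    then show ?thesis using IH by simp
  qed simp
qed

section \<open>Three beads, and the 3-cycles of A_5\<close>

definition triple :: "int \<Rightarrow> int \<Rightarrow> int \<Rightarrow> nat \<Rightarrow> int"
  where "triple a b c i = (if i = 0 then a else if i = 1 then b else c)"

lemma sum_lessThan_3: "(\<Sum>i<3. f i) = f 0 + f 1 + (f (2 :: nat) :: int)"
  by (simp add: numeral_3_eq_3 numeral_2_eq_2 One_nat_def)

lemma frobenius_char_triple: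
  assumes "permutation p" "finite S" "p ` S \<subseteq> S" "x \<in> S"
  shows "frobenius_char S p 3 (triple a b c) =
    frobenius_char (S - orb p x) p 3 (triple (a - int (least_power p x)) b c) +
    frobenius_char (S - orb p x) p 3 (triple a (b - int (least_power p x)) c) +
    frobenius_char (S - orb p x) p 3 (triple a b (c - int (least_power p x)))"
proof -
  let ?l = "int (least_power p x)" and ?F = "frobenius_char (S - orb p x) p 3"
  have "frobenius_char S p 3 (triple a b c) = (\<Sum>i<3. ?F ((triple a b c)(i := triple a b c i - ?l)))"
    by (rule frobenius_char_cycle[OF assms])
  also have "\<dots> = ?F ((triple a b c)(0 := a - ?l)) + ?F ((triple a b c)(1 := b - ?l)) + ?F ((triple a b c)(2 := c - ?l))"
    unfolding sum_lessThan_3 by (simp only: triple_def) simp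
  also have "?F ((triple a b c)(0 := a - ?l)) = ?F (triple (a - ?l) b c)"
    by (intro frobenius_char_cong) (simp add: triple_def)
  also have "?F ((triple a b c)(1 := b - ?l)) = ?F (triple a (b - ?l) c)"
    by (intro frobenius_char_cong) (simp add: triple_def)
  also have "?F ((triple a b c)(2 := c - ?l)) = ?F (triple a b (c - ?l))"
    by (intro frobenius_char_cong) (auto simp: triple_def)
  finally show ?thesis .
qed

lemma frobenius_char_triple_0:
  assumes "a < 0 \<or> b < 0 \<or> c < 0 \<or> p ` S \<subseteq> S \<and> (a = b \<or> b = c)"
  shows "frobenius_char S p 3 (triple a b c) = 0"
  using assms frobenius_char_neg[of 0 3 "triple a b c" S p] frobenius_char_neg[of 1 3 "triple a b c" S p]
    frobenius_char_neg[of 2 3 "triple a b c" S p] frobenius_char_repeated[of p S 0 3 1 "triple a b c"]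
    frobenius_char_repeated[of p S 1 3 2 "triple a b c"] by (auto simp: triple_def)

lemma frobenius_char_triple_0':
  "p ` S \<subseteq> S \<Longrightarrow> frobenius_char S p 3 (triple a b a) = 0"
  using frobenius_char_repeated[of p S 0 3 2 "triple a b a"] by (auto simp: triple_def)

lemma frobenius_char_empty:
  assumes w: "w permutes {..<k}" "\<And>i. i < k \<Longrightarrow> \<beta> i = int (w i)"
  shows "frobenius_char {} p k \<beta> = sign w"
proof -
  have "frobenius_char {} p k \<beta> = (\<Sum>v | v permutes {..<k}. if v = w then sign w else 0)"
    unfolding frobenius_char_def
  proof (intro sum.cong refl)
    fix v assume "v \<in> {v. v permutes {..<k}}"
    then have v: "v permutes {..<k}" by simp
    have "fixed_colorings {} p k (\<lambda>i. \<beta> i - int (v i)) = (if v = w then {\<lambda>x. undefined} else {})"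
    proof (cases "v = w")
      case True
      then show ?thesis using w(2) by (auto simp: fixed_colorings_def colorings_def)
    next
      case False
      then obtain i where "i < k" "v i \<noteq> w i" using permutes_lessThan_eq[OF v w(1)] by blast
      then show ?thesis using False w(2) by (auto simp: fixed_colorings_def colorings_def)
    qed
    then show "sign v * int (card (fixed_colorings {} p k (\<lambda>i. \<beta> i - int (v i)))) = (if v = w then sign w else 0)"
      by simp
  qed
  also have "\<dots> = sign w" using w(1) by (simp add: finite_permutations)
  finally show ?thesis .
qed

lemma less_3_cases: "(i :: nat) < 3 \<Longrightarrow> i = 0 \<or> i = 1 \<or> i = 2"
  by linarith

lemma frobenius_char_empty_012: "frobenius_char {} p 3 (triple 0 1 2) = 1"
  using frobenius_char_empty[OF permutes_id, of 3 "triple 0 1 2" p]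
  by (auto simp: triple_def dest: less_3_cases)

lemma frobenius_char_empty_021: "frobenius_char {} p 3 (triple 0 2 1) = - 1"
proof -
  have "transpose 1 2 permutes {..<3 :: nat}" by (rule permutes_swap_id) auto
  moreover have "triple 0 2 1 i = int (transpose 1 2 i)" if "i < 3" for i
    using less_3_cases[OF that] by (elim disjE) (simp_all add: triple_def transpose_def)
  ultimately show ?thesis using frobenius_char_empty[of "transpose 1 2" 3 "triple 0 2 1" p] by (simp add: sign_swap_id)
qed

lemma frobenius_char_empty_120: "frobenius_char {} p 3 (triple 1 2 0) \<noteq> 0"
proof -
  let ?w = "transpose 0 1 \<circ> transpose 1 (2 :: nat)"
  have "?w permutes {..<3}" by (intro permutes_compose permutes_swap_id) auto
  moreover have "triple 1 2 0 i = int (?w i)" if "i < 3" for i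
    using less_3_cases[OF that] by (elim disjE) (simp_all add: triple_def transpose_def)
  ultimately show ?thesis using frobenius_char_empty[of ?w 3 "triple 1 2 0" p] by (simp add: sign_def)
qed

lemma orb_fixed: "permutation p \<Longrightarrow> p y = y \<Longrightarrow> orb p y = {y}"
  using least_power_1_iff[of p y] by (simp add: orb_def One_nat_def)

text \<open>If \<open>g\<close> exchanged the two points outside the 3-cycle, \<open>g ^^ 3\<close>
  would be a transposition, although \<open>g\<close> is even.\<close>

lemma three_cycle_structure:
  assumes g: "g \<in> carrier (alt_group 5)" and a: "a \<in> {1..5}" "least_power g a = 3"
  obtains y z where "{1..5} - orb g a = {y, z}" "y \<noteq> z" "g y = y" "g z = z"
proof -
  have perm: "permutation g" and gp: "g permutes {1..5}" and ev: "evenperm g"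
    using g alt_group_carrier' by (auto simp: alt_group_carrier)
  have gS: "g ` {1..5} \<subseteq> {1..5}" using permutes_image[OF gp] by simp
  have ginj: "g u = g v \<longleftrightarrow> u = v" for u v using permutes_inj[OF gp] by (auto simp: inj_def)
  have "card ({1..5} - orb g a) = 2" using card_minus_orb[OF perm _ gS a(1)] a(2) by simp
  then obtain y z where yz: "{1..5} - orb g a = {y, z}" "y \<noteq> z" by (auto simp: card_2_iff)
  have closed: "g ` {y, z} \<subseteq> {y, z}" using orb_complement_closed[OF perm gS, of a] yz by simp
  have "g y = y"
  proof (rule ccontr)
    assume "g y \<noteq> y"
    then have gy: "g y = z" using closed by auto
    then have gz: "g z = y" using closed ginj[of y z] yz(2) by auto
    have "g ^^ 3 = transpose y z"
    proof
      fix x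
      consider "x = y" | "x = z" | "x \<in> orb g a" | "x \<notin> {1..5}" using yz(1) by blast
      then show "(g ^^ 3) x = transpose y z x"
      proof cases
        case 3
        then have "(g ^^ 3) x = x"
          using least_power_of_permutation(1)[OF perm, of x] unfolding least_power_orb[OF perm 3] a(2) by simp
        moreover have "x \<noteq> y" "x \<noteq> z" using 3 yz(1) by blast+
        ultimately show ?thesis by simp
      next
        case 4
        then have "(g ^^ 3) x = x" using permutes_funpow[OF gp, of 3] by (simp add: permutes_def)
        moreover have "x \<noteq> y" "x \<noteq> z" using 4 yz(1) by blast+
        ultimately show ?thesis by simp
      qed (simp_all add: numeral_3_eq_3 gy gz)
    qed
    moreover have "g ^^ 3 \<in> carrier (alt_group 5)"
      using monoid.nat_pow_closed[OF group.is_monoid[OF alt_group_is_group] g, of 3] by (simp add: alt_group_pow)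
    ultimately have "evenperm (transpose y z)" by (simp add: alt_group_carrier)
    then show False using yz(2) by (simp add: evenperm_swap)
  qed
  moreover have "g z = z" using closed calculation ginj[of y z] yz(2) by auto
  ultimately show thesis using that yz by blast
qed

text \<open>The bead sets belong to the partitions (5), (4,1) and (3,2). The 3-cycle and then the
  two fixed points are removed; at each stage all moves but one lead to a negative or an occupied
  position. The value -1 is the sign of the final bead order 0, 2, 1.\<close>

lemma three_cycle_values:
  assumes g: "g \<in> carrier (alt_group 5)" and a: "a \<in> {1..5}" "least_power g a = 3"
  shows "frobenius_char {1..5} g 3 (triple 0 1 7) = 1" "frobenius_char {1..5} g 3 (triple 0 2 6) = 1"
    "frobenius_char {1..5} g 3 (triple 0 3 5) = - 1"
proof -
  have perm: "permutation g" and gp: "g permutes {1..5}"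
    using g alt_group_carrier' by (auto simp: alt_group_carrier)
  have gS: "g ` {1..5} \<subseteq> {1..5}" using permutes_image[OF gp] by simp
  obtain y z where R: "{1..5} - orb g a = {y, z}" and yz: "y \<noteq> z" "g y = y" "g z = z"
    using three_cycle_structure[OF g a] by blast
  have ly: "least_power g y = 1" "least_power g z = 1" using yz least_power_1_iff[OF perm] by blast+
  have o: "{y, z} - orb g y = {z}" "{z} - orb g z = {}"
    using yz orb_fixed[OF perm] by simp_all
  have im: "g ` {y, z} \<subseteq> {y, z}" "g ` {z} \<subseteq> {z}" "g ` {} \<subseteq> {}" using yz by auto
  have 1: "frobenius_char {1..5} g 3 (triple u v w) = frobenius_char {y, z} g 3 (triple (u - 3) v w) +
      frobenius_char {y, z} g 3 (triple u (v - 3) w) + frobenius_char {y, z} g 3 (triple u v (w - 3))" for u v w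
    using frobenius_char_triple[OF perm _ gS a(1), of u v w] unfolding R a(2) by simp
  have 2: "frobenius_char {y, z} g 3 (triple u v w) = frobenius_char {z} g 3 (triple (u - 1) v w) +
      frobenius_char {z} g 3 (triple u (v - 1) w) + frobenius_char {z} g 3 (triple u v (w - 1))" for u v w
    using frobenius_char_triple[OF perm _ im(1), of y u v w] unfolding o ly by simp
  have 3: "frobenius_char {z} g 3 (triple u v w) = frobenius_char {} g 3 (triple (u - 1) v w) +
      frobenius_char {} g 3 (triple u (v - 1) w) + frobenius_char {} g 3 (triple u v (w - 1))" for u v w
    using frobenius_char_triple[OF perm _ im(2), of z u v w] unfolding o ly by simp
  note z = frobenius_char_triple_0 frobenius_char_triple_0'
  have e1: "frobenius_char {z} g 3 (triple 0 1 3) = 1"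
    using 3[of 0 1 3] by (simp add: z frobenius_char_empty_012)
  have e2: "frobenius_char {z} g 3 (triple 0 3 1) = - 1"
    using 3[of 0 3 1] by (simp add: z frobenius_char_empty_021)
  have f1: "frobenius_char {y, z} g 3 (triple 0 1 4) = 1"
    using 2[of 0 1 4] im by (simp add: z e1)
  have f2: "frobenius_char {y, z} g 3 (triple 0 2 3) = 1"
    using 2[of 0 2 3] im by (simp add: z e1)
  have f3: "frobenius_char {y, z} g 3 (triple 0 3 2) = - 1"
    using 2[of 0 3 2] im by (simp add: z e2)
  show "frobenius_char {1..5} g 3 (triple 0 1 7) = 1" using 1[of 0 1 7] by (simp add: z f1)
  show "frobenius_char {1..5} g 3 (triple 0 2 6) = 1" using 1[of 0 2 6] by (simp add: z f2)
  show "frobenius_char {1..5} g 3 (triple 0 3 5) = - 1" using 1[of 0 3 5] im by (simp add: z f3)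
qed

text \<open>The centralizer of \<open>g\<close> in A_5 consists of the powers of \<open>g\<close>,
  so conjugation has fibres of at most 3 elements on a group of order 60.\<close>

lemma card_conjugates_three_cycle:
  assumes g: "g \<in> carrier (alt_group 5)" and a: "a \<in> {1..5}" "least_power g a = 3"
  shows "20 \<le> card ((\<lambda>h. h \<circ> g \<circ> inv' h) ` carrier (alt_group 5))"
proof -
  let ?C = "carrier (alt_group 5)" and ?f = "\<lambda>h. h \<circ> g \<circ> inv' h"
  have perm: "permutation g" and gp: "g permutes {1..5}"
    using g alt_group_carrier' by (auto simp: alt_group_carrier)
  have gS: "g ` {1..5} \<subseteq> {1..5}" using permutes_image[OF gp] by simp
  obtain y z where R: "{1..5} - orb g a = {y, z}" and yz: "y \<noteq> z" "g y = y" "g z = z"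
    using three_cycle_structure[OF g a] by blast
  have oS: "orb g a \<subseteq> {1..5}" by (rule orb_subset[OF perm gS a(1)])
  \<comment> \<open>\<open>c\<close> cannot send \<open>a\<close> to a fixed point of
    \<open>g\<close>, so on the 3-cycle it acts as some \<open>g ^^ i\<close>. On the two fixed
    points it is the identity or the swap, and the swap would make it odd.\<close>
  have centr: "c \<in> (\<lambda>i. g ^^ i) ` {..<3}" if c: "c \<in> ?C" and comm: "c \<circ> g = g \<circ> c" for c
  proof -
    have cp: "c permutes {1..5}" and ev: "evenperm c" using c by (auto simp: alt_group_carrier)
    have cinj: "c u = c v \<longleftrightarrow> u = v" for u v using permutes_inj[OF cp] by (auto simp: inj_def)
    have cm: "c (g x) = g (c x)" for x using comm by (metis comp_apply)
    have cmi: "c ((g ^^ i) x) = (g ^^ i) (c x)" for i x by (induction i) (simp_all add: cm)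
    have ca: "c a \<in> {1..5}" using permutes_in_image[OF cp] a(1) by blast
    have "c a \<in> orb g a"
    proof (rule ccontr)
      assume "c a \<notin> orb g a"
      then have "c a \<in> {y, z}" using ca R by blast
      then have "g (c a) = c a" using yz by auto
      then have "g a = a" using cm cinj by metis
      then show False using least_power_1_iff[OF perm, of a] a(2) by simp
    qed
    then obtain i where i: "i < 3" "c a = (g ^^ i) a" using a(2) by (auto simp: orb_def)
    have on: "c x = (g ^^ i) x" if "x \<in> orb g a" for x
    proof -
      obtain j where "x = (g ^^ j) a" using \<open>x \<in> orb g a\<close> unfolding orb_def support_set[OF perm] by blast
      then have "c x = (g ^^ j) ((g ^^ i) a)" using cmi i by simp
      then show ?thesis using \<open>x = (g ^^ j) a\<close> by (metis comp_apply funpow_add add.commute)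
    qed
    have off: "c x \<in> {y, z}" if "x \<in> {y, z}" for x
    proof -
      have "c x \<in> {1..5}" using permutes_in_image[OF cp] that R by blast
      moreover have "c x \<notin> orb g a"
      proof
        assume "c x \<in> orb g a"
        then have "least_power g (c x) = 3" unfolding a(2)[symmetric] by (rule least_power_orb[OF perm])
        moreover have "g (c x) = c x" using cm[of x] that yz by auto
        ultimately show False using least_power_1_iff[OF perm, of "c x"] by simp
      qed
      ultimately show ?thesis using R by blast
    qed
    have gi: "(g ^^ i) x = x" if "x \<in> {y, z}" for x i using that yz by (induction i) auto
    have out: "c x = x" "(g ^^ i) x = x" if "x \<notin> {1..5}" for x
      using that cp permutes_funpow[OF gp, of i] by (simp_all add: permutes_def)
    show ?thesis
    proof (cases "c y = y")
      case True
      then have cz: "c z = z" using off[of z] cinj[of y z] yz(1) by auto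
      have "c = g ^^ i"
      proof
        fix x
        have "x \<in> orb g a \<or> x \<in> {y, z} \<or> x \<notin> {1..5}" using R by blast
        then show "c x = (g ^^ i) x" using on gi[of x i] out True cz by auto
      qed
      then show ?thesis using i by blast
    next
      case False
      then have cy: "c y = z" using off[of y] by auto
      then have cz: "c z = y" using off[of z] cinj[of y z] yz(1) by auto
      have "c = (g ^^ i) \<circ> transpose y z"
      proof
        fix x
        consider "x = y" | "x = z" | "x \<in> orb g a" "x \<noteq> y" "x \<noteq> z" | "x \<notin> {1..5}" "x \<noteq> y" "x \<noteq> z" using R by blast
        then show "c x = ((g ^^ i) \<circ> transpose y z) x"
          by cases (simp_all add: cy cz gi on out)
      qed
      moreover have "g ^^ i \<in> ?C"
        using monoid.nat_pow_closed[OF group.is_monoid[OF alt_group_is_group] g, of i] by (simp add: alt_group_pow)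
      then have "evenperm (g ^^ i)" "permutation (g ^^ i)" using alt_group_carrier' by (auto simp: alt_group_carrier)
      ultimately have "\<not> evenperm c" using yz(1) by (simp add: evenperm_comp permutation_swap_id evenperm_swap)
      then show ?thesis using ev by simp
    qed
  qed
  \<comment> \<open>Elements with the same conjugate of \<open>g\<close> differ by an element of the
    centralizer.\<close>
  have fib: "card {h\<in>?C. ?f h = x} \<le> 3" if x: "x \<in> ?f ` ?C" for x
  proof -
    obtain h0 where h0: "h0 \<in> ?C" "x = ?f h0" using x by blast
    have h0p: "h0 permutes {1..5}" using h0 by (simp add: alt_group_carrier)
    have inv: "inv' h0 (h0 u) = u" "h0 (inv' h0 u) = u" for u using permutes_inverses[OF h0p] by auto
    have "{h\<in>?C. ?f h = x} \<subseteq> (\<lambda>i. h0 \<circ> (g ^^ i)) ` {..<3}"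
    proof
      fix h assume "h \<in> {h\<in>?C. ?f h = x}"
      then have h: "h \<in> ?C" "?f h = ?f h0" using h0 by auto
      have hp: "h permutes {1..5}" using h by (simp add: alt_group_carrier)
      have hinv: "inv' h (h u) = u" for u using permutes_inverses[OF hp] by auto
      have e: "h (g u) = h0 (g (inv' h0 (h u)))" for u using fun_cong[OF h(2), of "h u"] hinv by simp
      have "inv' h0 \<circ> h \<in> ?C"
        using alt_group_inv_closed[OF h0(1)] h(1) monoid.m_closed[OF group.is_monoid[OF alt_group_is_group], of "inv' h0" 5 h]
        by (simp add: alt_group_mult)
      moreover have "(inv' h0 \<circ> h) \<circ> g = g \<circ> (inv' h0 \<circ> h)" by (rule ext) (simp add: e inv)
      ultimately obtain i where "i < 3" "inv' h0 \<circ> h = g ^^ i" using centr by blast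
      then have "h = h0 \<circ> (g ^^ i)" using inv(2) by (metis comp_apply ext)
      then show "h \<in> (\<lambda>i. h0 \<circ> (g ^^ i)) ` {..<3}" using \<open>i < 3\<close> by blast
    qed
    then have "card {h\<in>?C. ?f h = x} \<le> card ((\<lambda>i. h0 \<circ> (g ^^ i)) ` {..<3 :: nat})" by (rule card_mono[rotated]) simp
    also have "\<dots> \<le> 3" using card_image_le[of "{..<3 :: nat}"] by simp
    finally show ?thesis .
  qed
  have "card ?C = (\<Sum>x\<in>?f ` ?C. card {h\<in>?C. ?f h = x})"
  proof -
    have "?C = (\<Union>x\<in>?f ` ?C. {h\<in>?C. ?f h = x})" by blast
    moreover have "card (\<Union>x\<in>?f ` ?C. {h\<in>?C. ?f h = x}) = (\<Sum>x\<in>?f ` ?C. card {h\<in>?C. ?f h = x})"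
      by (rule card_UN_disjoint) (auto simp: finite_alt_group)
    ultimately show ?thesis by simp
  qed
  also have "\<dots> \<le> (\<Sum>x\<in>?f ` ?C. 3)" by (rule sum_mono) (rule fib)
  finally have "card ?C \<le> 3 * card (?f ` ?C)" by simp
  moreover have "card ?C = 60" using alt_group_card_carrier[of 5] by (simp add: fact_numeral)
  ultimately show ?thesis by simp
qed

text \<open>A quick test that two bead sets differ: a rearrangement preserves the sum of
  squares.\<close>

lemma signed_matching_squares:
  assumes "(\<Sum>i<k. \<beta> i * \<beta> i) \<noteq> (\<Sum>i<k. \<gamma> i * \<gamma> i)"
  shows "signed_matching k \<beta> \<gamma> = 0"
proof (rule ccontr)
  assume "signed_matching k \<beta> \<gamma> \<noteq> 0"
  then obtain t where t: "t permutes {..<k}" "\<forall>a<k. \<beta> a = \<gamma> (t a) \<and> \<beta> a \<ge> 0"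
    using signed_matching_nonzeroD(2) by blast
  have "(\<Sum>i<k. \<beta> i * \<beta> i) = (\<Sum>i<k. \<gamma> (t i) * \<gamma> (t i))" using t(2) by simp
  also have "\<dots> = (\<Sum>i<k. \<gamma> i * \<gamma> i)"
    using sum.permute[OF t(1), of "\<lambda>i. \<gamma> i * \<gamma> i"] by (simp add: o_def)
  finally show False using assms by simp
qed

lemma sum_triple: "(\<Sum>i<3. f (triple a b c i)) = f a + f b + (f c :: int)"
  unfolding sum_lessThan_3 by (simp add: triple_def)

text \<open>The bound 5 is \<open>2 * 3 - 1\<close>; together with the bead 0 of the second triple
  it lets \<open>sum_sign_frobenius_char_zero\<close> apply.\<close>

lemma inner_A5:
  assumes "a + b + c = 8" "5 \<le> c"
  shows "(\<Sum>x\<in>carrier (alt_group 5). frobenius_char {1..5} x 3 (triple a b c) * frobenius_char {1..5} x 3 (triple 0 d e))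
    = 60 * signed_matching 3 (triple a b c) (triple 0 d e)"
proof -
  have card: "card (carrier (alt_group 5)) = 60" using alt_group_card_carrier[of 5] by (simp add: fact_numeral)
  have "2 * (\<Sum>i<3. triple a b c i) = 2 * int 5 + int 3 * (int 3 - 1)"
    using sum_triple[of "\<lambda>x. x" a b c] assms(1) by simp
  moreover have "(\<Sum>p | p permutes {1..5 :: nat}. sign p * (frobenius_char {1..5} p 3 (triple a b c) * frobenius_char {1..5} p 3 (triple 0 d e))) = 0"
    using assms(2) by (intro sum_sign_frobenius_char_zero[where i = 2]) (simp_all add: triple_def)
  ultimately show ?thesis
    using frobenius_char_alt_inner[where n = 5 and k = 3 and \<beta> = "triple a b c" and \<gamma> = "triple 0 d e"] card by simp
qed

lemma least_power_conjugate:
  assumes g: "permutation g" and x: "permutation x" and hx: "\<And>u. x (h u) = h (g u)" and inj: "inj h"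
  shows "least_power x (h a) = least_power g a"
proof -
  have "(x ^^ j) (h u) = h ((g ^^ j) u)" for j u by (induction j) (simp_all add: hx)
  then have "(x ^^ j) (h a) = h a \<longleftrightarrow> (g ^^ j) a = a" for j using inj by (simp add: inj_eq)
  then have e: "least_power x (h a) dvd j \<longleftrightarrow> least_power g a dvd j" for j
    using least_power_dvd[OF g] least_power_dvd[OF x] by blast
  show ?thesis by (rule dvd_antisym) (simp add: e, simp add: e[symmetric])
qed

text \<open>Provides an element at which the character labelled (3,1,1) is nonzero. It is even
  because \<open>sign p ^ 5 = 1\<close>.\<close>

lemma exists_5_cycle:
  obtains p a where "p \<in> carrier (alt_group 5)" "a \<in> {1..5}" "least_power p a = 5"
proof -
  obtain p where p: "p permutes {1..5 :: nat}" "\<forall>j. p ^^ j = id \<longleftrightarrow> (\<forall>q\<in>{5}. q dvd j)"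
    using exists_permutation_of_order[of "{5}" "{1..5 :: nat}"] by auto
  have perm: "permutation p" using p(1) by (auto simp: permutation_permutes)
  have p5: "p ^^ 5 = id" using p(2) by simp
  have sj: "sign (p ^^ j) = sign p ^ j" for j
  proof (induction j)
    case (Suc j)
    have "sign (p \<circ> p ^^ j) = sign p * sign (p ^^ j)"
      by (rule sign_compose[OF perm permutation_funpow[OF perm]])
    then show ?case by (simp only: funpow.simps power_Suc Suc)
  qed simp
  have "sign p ^ 5 = 1" using sj[of 5] p5 by simp
  then have "evenperm p" by (auto simp: sign_def split: if_splits)
  then have pc: "p \<in> carrier (alt_group 5)" using p(1) by (simp add: alt_group_carrier)
  have "p \<noteq> id"
  proof
    assume "p = id"
    then have "p ^^ 1 = id" by simp
    then show False using p(2) by (metis insertI1 nat_dvd_1_iff_1 numeral_eq_one_iff semiring_norm(86))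
  qed
  then obtain a where a: "p a \<noteq> a" by (metis eq_id_iff)
  have "a \<in> {1..5}" using a p(1) unfolding permutes_def by blast
  moreover have "least_power p a dvd 5" using p5 least_power_dvd[OF perm, of a 5] by simp
  moreover have "least_power p a \<noteq> 1" using least_power_1_iff[OF perm, of a] a by simp
  moreover have "prime (5 :: nat)" by simp
  ultimately have "least_power p a = 5" unfolding prime_nat_iff by blast
  then show thesis using that pc \<open>a \<in> {1..5}\<close> by blast
qed

text \<open>The 3-cycles of \<open>A\<^sub>5\<close> are only killed by the two constituents of the self-conjugate character
  of \<open>S\<^sub>5\<close> labelled (3,1,1), which has norm 2 on \<open>A\<^sub>5\<close>. The characters labelled (5), (4,1), (3,2) take
  the values 1, 1, -1 on a 3-cycle, whose centralizer has order 3; so \<open>\<chi>\<^sub>5 + \<chi>\<^sub>4\<^sub>1 - \<chi>\<^sub>3\<^sub>2\<close> is three times the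
  indicator of its class, and every other irreducible character vanishes there.\<close>

theorem vanishing_three_cycle_A5:
  assumes g: "g \<in> carrier (alt_group 5)" and a: "a \<in> {1..5}" "least_power g a = 3"
  shows "vanishing (alt_group 5) g"
proof -
  let ?G = "alt_group 5"
  let ?X = "\<lambda>b c x. frobenius_char {1..5} x 3 (triple 0 b c)"
  \<comment> \<open>The beads 1, 2, 5 belong to the partition (3,1,1).\<close>
  let ?W = "\<lambda>x. frobenius_char {1..5} x 3 (triple 1 2 5)"
  let ?K = "(\<lambda>h. h \<circ> g \<circ> inv' h) ` carrier ?G"
  interpret G: group ?G by (rule alt_group_is_group)
  have fin: "finite (carrier ?G)" by (rule finite_alt_group)
  have perm: "permutation g" using g by (rule alt_group_carrier')
  have card: "card (carrier ?G) = 60" using alt_group_card_carrier[of 5] by (simp add: fact_numeral)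
  have self: "signed_matching 3 (triple 0 b c) (triple 0 b c) = 1" if "0 < b" "b < c" for b c
    using that by (intro signed_matching_self) (auto simp: inj_on_def triple_def)
  have diff: "signed_matching 3 (triple a b c) (triple 0 d e) = 0" if "a * a + b * b + c * c \<noteq> d * d + e * e" for a b c d e
    using that sum_triple[of "\<lambda>x. x * x"] by (intro signed_matching_squares) simp
  \<comment> \<open>Three orthonormal characters combined with coefficients 1, 1, -1 have norm 3;
    the group order 60 makes it 180.\<close>
  have sq: "(\<Sum>x\<in>carrier ?G. (?X 1 7 x + ?X 2 6 x - ?X 3 5 x) * (?X 1 7 x + ?X 2 6 x - ?X 3 5 x)) = 180"
  proof -
    have "(\<Sum>x\<in>carrier ?G. (?X 1 7 x + ?X 2 6 x - ?X 3 5 x) * (?X 1 7 x + ?X 2 6 x - ?X 3 5 x)) =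
      (\<Sum>x\<in>carrier ?G. ?X 1 7 x * ?X 1 7 x) + (\<Sum>x\<in>carrier ?G. ?X 2 6 x * ?X 2 6 x) + (\<Sum>x\<in>carrier ?G. ?X 3 5 x * ?X 3 5 x)
      + 2 * (\<Sum>x\<in>carrier ?G. ?X 1 7 x * ?X 2 6 x) - 2 * (\<Sum>x\<in>carrier ?G. ?X 1 7 x * ?X 3 5 x) - 2 * (\<Sum>x\<in>carrier ?G. ?X 2 6 x * ?X 3 5 x)"
      unfolding sum_distrib_left sum.distrib[symmetric] sum_subtractf[symmetric]
      by (intro sum.cong refl) (simp add: algebra_simps)
    also have "\<dots> = 180" using inner_A5[of 0 1 7] inner_A5[of 0 2 6] inner_A5[of 0 3 5] self diff by simp
    finally show ?thesis .
  qed
  have inK: "x \<in> carrier ?G" "?X 1 7 x = 1" "?X 2 6 x = 1" "?X 3 5 x = - 1" if x: "x \<in> ?K" for x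
  proof -
    obtain h where h: "h \<in> carrier ?G" "x = h \<circ> g \<circ> inv' h" using x by blast
    have hp: "h permutes {1..5}" using h by (simp add: alt_group_carrier)
    have "h \<otimes>\<^bsub>?G\<^esub> g \<otimes>\<^bsub>?G\<^esub> inv\<^bsub>?G\<^esub> h \<in> carrier ?G" using h g by simp
    then show xc: "x \<in> carrier ?G" using h by (simp add: alt_group_mult alt_group_inv_equality)
    have "least_power x (h a) = 3"
      using least_power_conjugate[OF perm alt_group_carrier'[OF xc], of h a] a(2) permutes_inj[OF hp]
        permutes_inverses(2)[OF hp] h(2) by simp
    moreover have "h a \<in> {1..5}" using permutes_in_image[OF hp] a(1) by blast
    ultimately show "?X 1 7 x = 1" "?X 2 6 x = 1" "?X 3 5 x = - 1" using three_cycle_values[OF xc] by blast+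
  qed
  \<comment> \<open>The at least 20 conjugates of \<open>g\<close>, with value 3 each, already
    account for 20 * 9 = 180, so nothing is left for the other elements.\<close>
  have off: "?X 1 7 x + ?X 2 6 x - ?X 3 5 x = 0" if x: "x \<in> carrier ?G - ?K" for x
  proof -
    let ?\<theta> = "\<lambda>x. ?X 1 7 x + ?X 2 6 x - ?X 3 5 x"
    have fK: "finite ?K" using fin by simp
    have "?K \<subseteq> carrier ?G" using inK by blast
    then have "(\<Sum>x\<in>carrier ?G. ?\<theta> x * ?\<theta> x) = (\<Sum>x\<in>carrier ?G - ?K. ?\<theta> x * ?\<theta> x) + (\<Sum>x\<in>?K. ?\<theta> x * ?\<theta> x)"
      using fin by (rule sum.subset_diff)
    moreover have "(\<Sum>x\<in>?K. ?\<theta> x * ?\<theta> x) = (\<Sum>x\<in>?K. 9)" by (rule sum.cong[OF refl]) (simp add: inK)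
    moreover have "(\<Sum>x\<in>?K. 9) \<ge> (180 :: int)" using card_conjugates_three_cycle[OF g a] by simp
    ultimately have "(\<Sum>x\<in>carrier ?G - ?K. ?\<theta> x * ?\<theta> x) \<le> 0" using sq by linarith
    moreover have "?\<theta> x * ?\<theta> x \<le> (\<Sum>x\<in>carrier ?G - ?K. ?\<theta> x * ?\<theta> x)"
      using x fin by (intro member_le_sum[where f = "\<lambda>x. ?\<theta> x * ?\<theta> x"]) auto
    ultimately have "?\<theta> x * ?\<theta> x \<le> 0" by linarith
    then show ?thesis by (metis mult_eq_0_iff not_square_less_zero order_antisym_conv linorder_not_less)
  qed
  obtain p b where p: "p \<in> carrier ?G" "b \<in> {1..5}" "least_power p b = 5" using exists_5_cycle by blast
  have Wp: "?W p \<noteq> 0"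
  proof -
    have "p permutes {1..5}" using p(1) by (simp add: alt_group_carrier)
    then have pp: "permutation p" "p ` {1..5} \<subseteq> {1..5}"
      using alt_group_carrier'[OF p(1)] by (simp_all add: permutes_image)
    have "card ({1..5} - orb p b) = 0" using card_minus_orb[OF pp(1) _ pp(2) p(2)] p(3) by simp
    then have R: "{1..5} - orb p b = {}" by (metis card_0_eq finite_Diff finite_atLeastAtMost)
    have "?W p = frobenius_char {} p 3 (triple 1 2 0)"
      using frobenius_char_triple[OF pp(1) _ pp(2) p(2), of 1 2 5] unfolding R p(3) by (simp add: frobenius_char_triple_0)
    then show ?thesis using frobenius_char_empty_120 by simp
  qed
  obtain \<chi> where \<chi>: "\<chi> \<in> irreducible_characters ?G" "(\<Sum>x\<in>carrier ?G. of_int (?W x) * \<chi> (inv\<^bsub>?G\<^esub> x)) \<noteq> 0"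
    using exists_constituent[OF alt_group_is_group fin virtual_character_frobenius[of 5 3 "triple 1 2 5"] p(1)] Wp by auto
  \<comment> \<open>Up to an integer factor \<open>?X b c\<close> is an irreducible character
    \<open>\<psi>\<close>. Since \<open>?W\<close> is orthogonal to \<open>\<psi>\<close> but not to
    its constituent \<open>\<chi>\<close>, the two differ.\<close>
  have orth: "(\<Sum>x\<in>carrier ?G. \<chi> x * of_int (?X b c x)) = 0" if bc: "b + c = 8" "0 < b" "b < c" "5 \<le> c" for b c
  proof -
    have "(\<Sum>x\<in>carrier ?G. of_int (?X b c x) * of_int (?X b c (inv\<^bsub>?G\<^esub> x))) =
        (of_int (\<Sum>x\<in>carrier ?G. ?X b c x * ?X b c x) :: complex)"
      by (simp add: frobenius_char_alt_inv)
    also have "\<dots> = of_nat (card (carrier ?G))"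
      using inner_A5[of 0 b c b c] self[OF bc(2,3)] bc card by simp
    finally obtain \<psi> e where \<psi>: "\<psi> \<in> irreducible_characters ?G" "e \<noteq> 0"
      "\<And>x. x \<in> carrier ?G \<Longrightarrow> of_int (?X b c x) = of_int e * \<psi> x"
      using norm_1_irreducible[OF alt_group_is_group fin virtual_character_frobenius[of 5 3 "triple 0 b c"]] by blast
    have "b = 1 \<or> b = 2 \<or> b = 3" using bc by linarith
    then have "1 * 1 + 2 * 2 + 5 * 5 \<noteq> b * b + c * c" using bc by auto
    then have W0: "(\<Sum>x\<in>carrier ?G. ?W x * ?X b c x) = 0" using inner_A5[of 1 2 5 b c] diff[of 1 2 5 b c] by simp
    have "of_int e * (\<Sum>x\<in>carrier ?G. of_int (?W x) * \<psi> (inv\<^bsub>?G\<^esub> x)) =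
        (\<Sum>x\<in>carrier ?G. of_int (?W x) * of_int (?X b c (inv\<^bsub>?G\<^esub> x)))"
      unfolding sum_distrib_left by (intro sum.cong refl) (simp add: \<psi>(3))
    also have "\<dots> = of_int (\<Sum>x\<in>carrier ?G. ?W x * ?X b c x)"
      by (simp add: frobenius_char_alt_inv)
    finally have "(\<Sum>x\<in>carrier ?G. of_int (?W x) * \<psi> (inv\<^bsub>?G\<^esub> x)) = 0" using W0 \<psi>(2) by simp
    then have ne: "\<chi> \<noteq> \<psi>" using \<chi>(2) by blast
    have "(\<Sum>x\<in>carrier ?G. \<chi> x * of_int (?X b c x)) = (\<Sum>x\<in>carrier ?G. \<chi> x * of_int (?X b c (inv\<^bsub>?G\<^esub> x)))"
      by (simp add: frobenius_char_alt_inv)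
    also have "\<dots> = of_int e * (\<Sum>x\<in>carrier ?G. \<chi> x * \<psi> (inv\<^bsub>?G\<^esub> x))"
      unfolding sum_distrib_left by (intro sum.cong refl) (simp add: \<psi>(3))
    also have "\<dots> = 0" using irreducible_characters_orthogonal[OF alt_group_is_group fin \<chi>(1) \<psi>(1)] ne by simp
    finally show ?thesis .
  qed
  have "(\<Sum>x\<in>carrier ?G. \<chi> x * of_int (?X 1 7 x + ?X 2 6 x - ?X 3 5 x)) = 0"
  proof -
    have "(\<Sum>x\<in>carrier ?G. \<chi> x * of_int (?X 1 7 x + ?X 2 6 x - ?X 3 5 x)) =
      (\<Sum>x\<in>carrier ?G. \<chi> x * of_int (?X 1 7 x)) + (\<Sum>x\<in>carrier ?G. \<chi> x * of_int (?X 2 6 x)) - (\<Sum>x\<in>carrier ?G. \<chi> x * of_int (?X 3 5 x))"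
      unfolding sum.distrib[symmetric] sum_subtractf[symmetric] by (intro sum.cong refl) (simp add: algebra_simps)
    then show ?thesis using orth[of 1 7] orth[of 2 6] orth[of 3 5] by simp
  qed
  \<comment> \<open>The combination is supported on the class of \<open>g\<close>, where
    \<open>\<chi>\<close> is constant, so the sum is a nonzero multiple of
    \<open>\<chi> g\<close>.\<close>
  moreover have "(\<Sum>x\<in>carrier ?G. \<chi> x * of_int (?X 1 7 x + ?X 2 6 x - ?X 3 5 x)) = (\<Sum>x\<in>?K. \<chi> g * 3)"
  proof (rule sum.mono_neutral_cong_right[OF fin])
    show "?K \<subseteq> carrier ?G" using inK by blast
    show "\<forall>x\<in>carrier ?G - ?K. \<chi> x * of_int (?X 1 7 x + ?X 2 6 x - ?X 3 5 x) = 0" using off by simp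
    fix x assume x: "x \<in> ?K"
    then obtain h where h: "h \<in> carrier ?G" "x = h \<circ> g \<circ> inv' h" by blast
    have "x = h \<otimes>\<^bsub>?G\<^esub> g \<otimes>\<^bsub>?G\<^esub> inv\<^bsub>?G\<^esub> h" using h by (simp add: alt_group_mult alt_group_inv_equality)
    then have "\<chi> x = \<chi> g" using irreducible_character_conjugate[OF alt_group_is_group \<chi>(1) g h(1)] by simp
    then show "\<chi> x * of_int (?X 1 7 x + ?X 2 6 x - ?X 3 5 x) = \<chi> g * 3" using inK[OF x] by simp
  qed
  moreover have "card ?K \<noteq> 0" using card_conjugates_three_cycle[OF g a] by linarith
  ultimately have "\<chi> g = 0" by simp
  then show ?thesis using \<chi>(1) g by (auto simp: vanishing_def)
qed

text \<open>The hypotheses on \<open>n\<close> are what a bound \<open>n \<le> 2 * A + B + 1\<close>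
  leaves when the 2-part \<open>A\<close> is at most 2 and \<open>B\<close> is at most 3. The proof
  counts \<open>u\<close> cycles of length 2 and \<open>v\<close> of length 3, so that the number of
  fixed points is \<open>n - 2 * u - 3 * v\<close>.\<close>

lemma vanishing_small_cycles:
  assumes n: "5 \<le> n" "n \<noteq> 7" and g: "g \<in> carrier (alt_group n)"
    and l: "\<And>x. x \<in> {1..n} \<Longrightarrow> least_power g x \<le> 3"
    and no3: "\<not> 3 dvd group.ord (alt_group n) g \<Longrightarrow> n \<le> 5"
    and no2: "\<not> 2 dvd group.ord (alt_group n) g \<Longrightarrow> n \<le> 6" and n8: "n \<le> 8"
    and no23: "\<not> 2 dvd group.ord (alt_group n) g \<Longrightarrow> \<not> 3 dvd group.ord (alt_group n) g \<Longrightarrow> n \<le> 3"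
  shows "vanishing (alt_group n) g"
proof -
  let ?m = "group.ord (alt_group n) g"
  let ?c = "\<lambda>i. card {x\<in>{1..n}. least_power g x = i}"
  have perm: "permutation g" and gp: "g permutes {1..n}" and ev: "evenperm g"
    using g alt_group_carrier' by (auto simp: alt_group_carrier)
  have gS: "g ` {1..n} \<subseteq> {1..n}" using permutes_image[OF gp] by simp
  have l123: "least_power g x = 1 \<or> least_power g x = 2 \<or> least_power g x = 3" if "x \<in> {1..n}" for x
    using l[OF that] least_power_of_permutation(2)[OF perm, of x] by linarith
  have total: "?c 1 + ?c 2 + ?c 3 = n"
  proof -
    let ?C = "\<lambda>i. {x\<in>{1..n}. least_power g x = i}"
    have U: "?C 1 \<union> ?C 2 \<union> ?C 3 = {1..n}" using l123 by blast
    have "card (?C 1 \<union> ?C 2 \<union> ?C 3) = ?c 1 + ?c 2 + ?c 3"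
      by (subst card_Un_disjoint, simp, simp, force, subst card_Un_disjoint) auto
    moreover have "card {1..n} = n" by simp
    ultimately show ?thesis unfolding U by linarith
  qed
  have d: "2 dvd ?c 2" "3 dvd ?c 3" using dvd_card_least_power[OF perm _ gS] by auto
  \<comment> \<open>A single 2-cycle is impossible by parity: the cube of \<open>g\<close> would be
    a transposition.\<close>
  have c2: "?c 2 \<noteq> 2"
  proof
    assume "?c 2 = 2"
    then obtain y z where yz: "{x\<in>{1..n}. least_power g x = 2} = {y, z}" "y \<noteq> z" by (auto simp: card_2_iff)
    have ginj: "g u = g v \<longleftrightarrow> u = v" for u v using permutes_inj[OF gp] by (auto simp: inj_def)
    have y: "y \<in> {1..n}" "least_power g y = 2" using yz by blast+
    have gy: "g y \<noteq> y" using least_power_1_iff[OF perm, of y] y by simp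
    have "g y \<in> orb g y" using orb_closed[OF perm] self_in_orb[OF perm] by blast
    then have "least_power g (g y) = 2" unfolding y(2)[symmetric] by (rule least_power_orb[OF perm])
    moreover have "g y \<in> {1..n}" using permutes_in_image[OF gp] y(1) by blast
    ultimately have gyz: "g y = z" using yz gy by blast
    have "g (g y) = y" using least_power_of_permutation(1)[OF perm, of y] y(2) by (simp add: numeral_2_eq_2)
    then have gzy: "g z = y" using gyz by simp
    have "g ^^ 3 = transpose y z"
    proof
      fix x
      consider "x = y" | "x = z" | "x \<in> {1..n}" "x \<noteq> y" "x \<noteq> z" | "x \<notin> {1..n}" "x \<noteq> y" "x \<noteq> z" using yz by blast
      then show "(g ^^ 3) x = transpose y z x"
      proof cases
        case 3
        then have "least_power g x \<noteq> 2" using yz by blast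
        then have "least_power g x dvd 3" using l123[OF 3(1)] by auto
        then have "(g ^^ 3) x = x" using least_power_dvd[OF perm] by blast
        then show ?thesis using 3 by simp
      next
        case 4
        then have "(g ^^ 3) x = x" using permutes_funpow[OF gp, of 3] by (simp add: permutes_def)
        then show ?thesis using 4 by simp
      qed (simp_all add: numeral_3_eq_3 gyz gzy)
    qed
    moreover have "g ^^ 3 \<in> carrier (alt_group n)"
      using monoid.nat_pow_closed[OF group.is_monoid[OF alt_group_is_group] g, of 3] by (simp add: alt_group_pow)
    ultimately have "evenperm (transpose y z)" by (simp add: alt_group_carrier)
    then show False using yz(2) by (simp add: evenperm_swap)
  qed
  have c3pos: "?c 3 \<noteq> 0" if m: "3 dvd ?m"
  proof -
    obtain x where x: "x \<in> {1..n}" "3 ^ multiplicity 3 ?m dvd least_power g x"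
      using exists_cycle_of_prime_power[OF g _ m] by auto
    have "multiplicity 3 ?m > 0"
      using m alt_group_ord_pos[OF g] by (simp add: prime_multiplicity_gt_zero_iff)
    then have "3 dvd least_power g x" using x(2) dvd_trans dvd_power by blast
    then have "least_power g x = 3" using l123[OF x(1)] by auto
    then have "x \<in> {x\<in>{1..n}. least_power g x = 3}" using x(1) by simp
    moreover have "finite {x\<in>{1..n}. least_power g x = 3}" by simp
    ultimately show ?thesis using card_0_eq[of "{x\<in>{1..n}. least_power g x = 3}"] by blast
  qed
  have c2pos: "?c 2 \<noteq> 0" if m: "2 dvd ?m"
  proof -
    obtain x where x: "x \<in> {1..n}" "2 ^ multiplicity 2 ?m dvd least_power g x"
      using exists_cycle_of_prime_power[OF g _ m] by auto
    have "multiplicity 2 ?m > 0"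
      using m alt_group_ord_pos[OF g] by (simp add: prime_multiplicity_gt_zero_iff)
    then have "2 dvd least_power g x" using x(2) dvd_trans dvd_power by blast
    then have "least_power g x = 2" using l123[OF x(1)] by auto
    then have "x \<in> {x\<in>{1..n}. least_power g x = 2}" using x(1) by simp
    moreover have "finite {x\<in>{1..n}. least_power g x = 2}" by simp
    ultimately show ?thesis using card_0_eq[of "{x\<in>{1..n}. least_power g x = 2}"] by blast
  qed
  obtain u v where u: "?c 2 = 2 * u" and v: "?c 3 = 3 * v" using d by (auto elim!: dvdE)
  have t: "?c 1 + 2 * u + 3 * v = n" using total u v by simp
  have u1: "u \<noteq> 1" using u c2 by auto
  have u0: "u = 0 \<Longrightarrow> n \<le> 6" using c2pos no2 u by auto
  have v0: "v = 0 \<Longrightarrow> n = 5 \<and> u \<noteq> 0" using c3pos no3 no23 c2pos u v n(1) by fastforce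
  consider "?c 1 = 1" | "v \<noteq> 0" "n = 5" | "v \<noteq> 0" "n = 6"
  proof (cases "v = 0")
    case True
    then have "n = 5" "u \<noteq> 0" using v0 by simp_all
    \<comment> \<open>Here \<open>n = 5\<close> and \<open>u \<ge> 2\<close>, so there are two
      2-cycles and one fixed point.\<close>
    then have "?c 1 = 1" using u1 t True by presburger
    then show ?thesis by (rule that(1))
  next
    case v: False
    show ?thesis
    proof (cases "u = 0")
      case True
      then have "n = 5 \<or> n = 6" using u0 n(1) by auto
      then show ?thesis using v that(2,3) by blast
    next
      case False
      \<comment> \<open>Here \<open>u \<ge> 2\<close> and \<open>v \<ge> 1\<close>, so
        \<open>n \<ge> 7\<close>. For \<open>n = 7\<close> there would be no fixed point; with that
        case excluded, \<open>n = 8\<close>, \<open>u = 2\<close>, \<open>v = 1\<close> and one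
        fixed point remain.\<close>
      then have "?c 1 = 1" using v u1 t n n8 by presburger
      then show ?thesis by (rule that(1))
    qed
  qed
  then show ?thesis
  proof cases
    case 1
    then show ?thesis using vanishing_if_one_fixed_point[OF _ g] n(1) by simp
  next
    case 2
    then have "{x\<in>{1..n}. least_power g x = 3} \<noteq> {}" using v by (metis card.empty mult_eq_0_iff zero_neq_numeral)
    then obtain a where "a \<in> {1..n}" "least_power g a = 3" by blast
    then show ?thesis using vanishing_three_cycle_A5[of g a] g 2 by simp
  next
    case 3
    then have "{x\<in>{1..n}. least_power g x = 3} \<noteq> {}" using v by (metis card.empty mult_eq_0_iff zero_neq_numeral)
    then obtain a where a: "a \<in> {1..n}" "least_power g a = 3" by blast
    \<comment> \<open>The beads of the partition (4,2).\<close>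
    have "core_beads 3 6 {2, 5}" by (auto simp: core_beads_def lessThan_nat_numeral)
    then show ?thesis using vanishing_if_core[of n 3 "{2, 5}" g a] a g 3 by simp
  qed
qed

theorem theorem1p9:
  fixes n :: nat and g :: "nat \<Rightarrow> nat"
  assumes "n > 4"
    and "g \<in> carrier (alt_group n)"
    and "2 * group.ord (alt_group n) g \<notin> element_orders (alt_group n)"
    and "3 * group.ord (alt_group n) g \<notin> element_orders (alt_group n)"
    and "n \<noteq> 7"
  shows "vanishing (alt_group n) g"
proof -
  define m where "m = group.ord (alt_group n) g"
  have g: "g \<in> carrier (alt_group n)" and perm: "permutation g" and gp: "g permutes {1..n}"
    using assms(2) alt_group_carrier'[OF assms(2)] by (simp_all add: alt_group_carrier)
  have gS: "g ` {1..n} \<subseteq> {1..n}" using permutes_image[OF gp] by simp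
  have m: "m > 0" unfolding m_def by (rule alt_group_ord_pos[OF g])
  define L where "L = Max (least_power g ` {1..n})"
  have "L \<in> least_power g ` {1..n}" unfolding L_def by (rule Max_in) (use assms(1) in auto)
  then obtain x where x: "x \<in> {1..n}" "least_power g x = L" by auto
  have le_L: "least_power g y \<le> L" if "y \<in> {1..n}" for y
    unfolding L_def by (rule Max_ge) (use that in auto)
  have Ln: "L \<le> n" using card_minus_orb[OF perm _ gS x(1)] x(2) by simp
  have pL: "p ^ multiplicity p m \<le> L" if p: "prime p" "p dvd m" for p
  proof -
    obtain y where y: "y \<in> {1..n}" "p ^ multiplicity p m dvd least_power g y"
      using exists_cycle_of_prime_power[OF g] p unfolding m_def by blast
    have "p ^ multiplicity p m \<le> least_power g y"
      by (rule dvd_imp_le[OF y(2) least_power_of_permutation(2)[OF perm]])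
    then show ?thesis using le_L[OF y(1)] by (rule order_trans)
  qed
  define A where "A = (2 :: nat) ^ multiplicity 2 m"
  \<comment> \<open>If 3 does not divide \<open>m\<close>, no cycle is spent on it, hence 0 and not
    1. For odd \<open>m\<close>, in contrast, \<open>A = 1\<close> is right: \<open>2 * A\<close> is
    the 2-part of \<open>2 * m\<close>.\<close>
  define B where "B = (if 3 dvd m then (3 :: nat) ^ multiplicity 3 m else 0)"
  have L1: "L \<ge> 1" using x(2) least_power_of_permutation(2)[OF perm, of x] by simp
  have AL: "A \<le> L"
  proof (cases "2 dvd m")
    case True
    then show ?thesis unfolding A_def by (intro pL) simp_all
  next
    case False
    then show ?thesis using L1 by (simp add: A_def not_dvd_imp_multiplicity_0)
  qed
  have BL: "B \<le> L" using pL[of 3] by (simp add: B_def)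
  \<comment> \<open>The final 1 reflects the two spare points that the construction of an element of
    order \<open>2 * m\<close> asks for.\<close>
  have bound: "n \<le> 2 * A + B + sum_coprime_6 L + 1"
  proof -
    have "n \<le> \<Sum>(prime_power_parts (2 * m)) + 1"
      using exists_element_of_order[of "2 * m" n] m assms(3) by (fold m_def) force
    also have "\<dots> \<le> 2 * A + B + sum_coprime_6 L + 1"
      using sum_prime_power_parts_le[OF m pL] by (simp add: A_def B_def)
    finally show ?thesis .
  qed
  show ?thesis
  proof (cases "4 \<le> L")
    case True
    show ?thesis
    proof (cases "(L, n) = (4, 10)")
      case False
      have "\<exists>T. core_beads L n T"
        by (rule exists_core[OF True _ Ln _ AL _ BL bound False]) (use assms(1) in \<open>auto simp: A_def B_def\<close>)
      then show ?thesis using vanishing_if_core[OF _ _ g x] assms(1) by auto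
    next
      case True
      \<comment> \<open>No 4-core of 10 is suitable, but \<open>g\<close> has a 3-cycle, and there is a 3-core of 10.\<close>
      then have "B \<noteq> 0" using bound AL by (auto simp: sum_coprime_6_small)
      then have "3 dvd m" by (auto simp: B_def split: if_splits)
      then obtain y where y: "y \<in> {1..n}" "3 ^ multiplicity 3 m dvd least_power g y"
        using exists_cycle_of_prime_power[OF g, of 3] unfolding m_def by auto
      have "multiplicity 3 m > 0" using \<open>3 dvd m\<close> m by (simp add: prime_multiplicity_gt_zero_iff)
      then have "3 dvd least_power g y" using y(2) dvd_trans dvd_power by blast
      moreover have "0 < least_power g y" by (rule least_power_of_permutation(2)[OF perm])
      moreover have "least_power g y \<le> 4" using le_L[OF y(1)] True by simp
      ultimately have "least_power g y = 3" by (auto elim!: dvdE)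
      \<comment> \<open>The beads of the partition (5,3,1,1). That 3 divides \<open>m\<close> was
        forced by size: without it the bound on \<open>n\<close> would be 2 * 4 + 1 = 9.\<close>
      moreover have "core_beads 3 10 {1, 2, 5, 8}" by (auto simp: core_beads_def lessThan_nat_numeral)
      ultimately show ?thesis using vanishing_if_core[OF _ _ g y(1)] True by simp
    qed
  next
    case False
    then have L3: "L \<le> 3" by simp
    have b: "n \<le> 2 * A + B + 1" using bound L3 by (simp add: sum_coprime_6_small)
    \<comment> \<open>A power of 2 that is at most 3 is at most 2.\<close>
    have A2: "A \<le> 2"
    proof (rule ccontr)
      assume "\<not> A \<le> 2"
      then have "A = 3" using AL L3 by simp
      then have "multiplicity 2 m \<noteq> 0 \<Longrightarrow> even (3 :: nat)" unfolding A_def by (metis dvd_power neq0_conv)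
      then show False using \<open>A = 3\<close> by (cases "multiplicity 2 m = 0") (auto simp: A_def)
    qed
    have B3: "B \<le> 3" using BL L3 by simp
    have B0: "\<not> 3 dvd m \<Longrightarrow> B = 0" by (simp add: B_def)
    have A1: "\<not> 2 dvd m \<Longrightarrow> A = 1" by (simp add: A_def not_dvd_imp_multiplicity_0)
    show ?thesis
    proof (rule vanishing_small_cycles[OF _ assms(5) g, folded m_def])
      show "least_power g y \<le> 3" if "y \<in> {1..n}" for y using le_L[OF that] L3 by simp
      show "n \<le> 5" if "\<not> 3 dvd m" using b A2 B0[OF that] by simp
      show "n \<le> 6" if "\<not> 2 dvd m" using b A1[OF that] B3 by simp
      show "n \<le> 3" if "\<not> 2 dvd m" "\<not> 3 dvd m" using b A1[OF that(1)] B0[OF that(2)] by simp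
      show "n \<le> 8" using b A2 B3 by simp
    qed (use assms(1) in simp)
  qed
qed

end
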